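(* Let $F_n(z):=F_{n,0}(z)$ denote the $n$-th Taylor coefficient at $s=0$ of the doubly-completed weight-$0$ Eisenstein series, i.e. $\widehat{\widehat{E}}_0(z,s)=\sum_{n\ge 0}F_n(z)s^n$. For every integer $m\ge 1$ one has $V_0^m(0)=V_0^{m-1/2}(0)$, the space $V_0^m(0)$ is $m$-dimensional, and $\{F_0(z),F_1(z),\dots,F_{m-1}(z)\}$ is a basis of $V_0^m(0)$.
   Context: Write $z=x+iy\in\mathbb H$ (upper half-plane). For $k\in 2\mathbb Z$ the weight-$k$ hyperbolic Laplacian is $\Delta_k=y^2(\partial_x^2+\partial_y^2)-iky(\partial_x+i\partial_y)$. A weight-$k$ modular form here means a smooth $f:\mathbb H\to\mathbb C$ with $f(\frac{az+b}{cz+d})=(cz+d)^kf(z)$ for all $\begin{pmatrix}a&b\\c&d\end{pmatrix}\in SL_2(\mathbb Z)$; it has moderate growth if there is $\alpha\in\mathbb R$ with $f(x+iy)=O(y^\alpha)$ as $y\to\infty$ uniformly in $x$. For an integer $m\ge0$, $V_k^m(0)$ is the complex vector space of weight-$k$ modular forms of moderate growth with $\Delta_k^m f=0$ (so $V_k^0(0)=\{0\}$), and $V_k^{m+1/2}(0)$ is the space of weight-$k$ modular forms of moderate growth such that $\Delta_k^m f$ is a holomorphic function on $\mathbb H$ (so $V_k^{1/2}(0)=M_k$, the space of holomorphic weight-$k$ modular forms of moderate growth). Eisenstein series: for $k\in2\mathbb Z$, $E_k(z,s)=\frac12\sum_{(m,n)\in\mathbb Z^2\setminus\{(0,0)\}}\frac{y^s}{(mz+n)^k|mz+n|^{2s}}$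 for $\mathrm{Re}(2s+k)>2$, meromorphically continued in $s$; $\widehat E_k(z,s)=\pi^{-(s+k/2)}\Gamma(s+\frac k2+\frac{|k|}2)E_k(z,s)$; and $\widehat{\widehat E}_k(z,s)=(s+\frac k2)(s+\frac k2-1)\widehat E_k(z,s)$, which is entire in $s$. Its Taylor coefficients at $s=0$ are denoted $F_{n,k}(z)$ for $k\le0$ and $G_{n,k}(z)$ for $k\ge2$: $\widehat{\widehat E}_k(z,s)=\sum_{n\ge0}F_{n,k}(z)s^n$ ($k\le 0$), $=\sum_{n\ge0}G_{n,k}(z)s^n$ ($k\ge2$). *)

theory Defs
  imports "HOL-Analysis.Analysis" "HOL-Library.Function_Algebras"
begin

definition upper_half :: "complex set" where
  "upper_half = {z. Im z > 0}"

definition pdx :: "(complex \<Rightarrow> complex) \<Rightarrow> complex \<Rightarrow> complex" where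
  "pdx f z = frechet_derivative f (at z) 1"

definition pdy :: "(complex \<Rightarrow> complex) \<Rightarrow> complex \<Rightarrow> complex" where
  "pdy f z = frechet_derivative f (at z) \<i>"

fun iter_partials :: "bool list \<Rightarrow> (complex \<Rightarrow> complex) \<Rightarrow> complex \<Rightarrow> complex" where
  "iter_partials [] f = f"
| "iter_partials (b # bs) f = (if b then pdx else pdy) (iter_partials bs f)"

definition smooth_on_H :: "(complex \<Rightarrow> complex) \<Rightarrow> bool" where
  "smooth_on_H f \<longleftrightarrow> (\<forall>bs. \<forall>z\<in>upper_half. iter_partials bs f differentiable (at z))"

definition hyp_laplacian :: "int \<Rightarrow> (complex \<Rightarrow> complex) \<Rightarrow> complex \<Rightarrow> complex" where
  "hyp_laplacian k f z =
     complex_of_real ((Im z)\<^sup>2) * (pdx (pdx f) z + pdy (pdy f) z)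
     - \<i> * of_int k * complex_of_real (Im z) * (pdx f z + \<i> * pdy f z)"

definition modular_of_weight :: "int \<Rightarrow> (complex \<Rightarrow> complex) \<Rightarrow> bool" where
  "modular_of_weight k f \<longleftrightarrow>
     (\<forall>a b c d :: int. a * d - b * c = 1 \<longrightarrow>
       (\<forall>z\<in>upper_half. f ((of_int a * z + of_int b) / (of_int c * z + of_int d))
                      = (of_int c * z + of_int d) powi k * f z))"

definition moderate_growth :: "(complex \<Rightarrow> complex) \<Rightarrow> bool" where
  "moderate_growth f \<longleftrightarrow>
     (\<exists>\<alpha> C Y :: real. \<forall>z. Im z \<ge> Y \<longrightarrow> cmod (f z) \<le> C * Im z powr \<alpha>)"

text \<open>Functions on H are represented by functions C -> C that vanish off H.\<close>
definition on_H :: "(complex \<Rightarrow> complex) \<Rightarrow> bool" where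
  "on_H f \<longleftrightarrow> (\<forall>z. z \<notin> upper_half \<longrightarrow> f z = 0)"

definition weight_form_space :: "int \<Rightarrow> (complex \<Rightarrow> complex) set" where
  "weight_form_space k = {f. on_H f \<and> smooth_on_H f \<and> modular_of_weight k f \<and> moderate_growth f}"

definition V_int :: "int \<Rightarrow> nat \<Rightarrow> (complex \<Rightarrow> complex) set" where
  "V_int k m = {f \<in> weight_form_space k.
                 \<forall>z\<in>upper_half. (hyp_laplacian k ^^ m) f z = 0}"

text \<open>V_k^{m+1/2}(0).\<close>
definition V_half :: "int \<Rightarrow> nat \<Rightarrow> (complex \<Rightarrow> complex) set" where
  "V_half k m = {f \<in> weight_form_space k.
                  (hyp_laplacian k ^^ m) f holomorphic_on upper_half}"

text \<open>Weight-0 Eisenstein series, for Re s > 1.\<close>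
definition E0 :: "complex \<Rightarrow> complex \<Rightarrow> complex" where
  "E0 z s = (1/2) * (\<Sum>\<^sub>\<infinity>(m,n)\<in>(UNIV - {(0::int,0::int)}).
     complex_of_real (Im z) powr s / complex_of_real (cmod (of_int m * z + of_int n)) powr (2 * s))"

text \<open>The doubly completed series (s)(s-1) pi^{-s} Gamma(s) E_0(z,s), as the
  (unique) entire continuation in s; set to 0 for z outside H.\<close>
definition EE0 :: "complex \<Rightarrow> complex \<Rightarrow> complex" where
  "EE0 = (THE G. \<forall>z. (z \<in> upper_half \<longrightarrow> G z holomorphic_on UNIV \<and>
            (\<forall>s. Re s > 1 \<longrightarrow> G z s = s * (s - 1) * complex_of_real pi powr (- s) * Gamma s * E0 z s))
          \<and> (z \<notin> upper_half \<longrightarrow> G z = (\<lambda>s. 0)))"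

definition F :: "nat \<Rightarrow> complex \<Rightarrow> complex" where
  "F n z = (deriv ^^ n) (EE0 z) 0 / of_nat (fact n)"

definition fscale :: "complex \<Rightarrow> (complex \<Rightarrow> complex) \<Rightarrow> complex \<Rightarrow> complex" where
  "fscale c f = (\<lambda>z. c * f z)"

end

theory Submission
  imports Defs "HOL-Complex_Analysis.Complex_Analysis" "HOL-Probability.Probability"
    "HOL-Real_Asymp.Real_Asymp"
begin

text \<open>The weight-0 Laplacian \<open>\<Delta>\<close> annihilates constants only, among the forms \<open>g = \<Delta>\<^sup>m f\<close> with
  \<open>f\<close> modular of moderate growth: such a harmonic \<open>g\<close> splits as \<open>h + cnj k\<close> with \<open>h\<close>, \<open>k\<close> holomorphic and
  modular. An exponentially growing Fourier coefficient of \<open>g\<close> would propagate back to \<open>f\<close> through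
  the ordinary differential equations satisfied by the coefficients, so \<open>h\<close> and \<open>k\<close> are bounded at
  the cusp, hence constant by the maximum principle. Thus \<open>\<Delta>\<^sup>m\<close> maps \<open>V_int 0 (Suc m)\<close> into the
  constants, with kernel \<open>V_int 0 m\<close>. Conversely the Laplace equation
  \<open>\<Delta> E(z,s) = s (s - 1) E(z,s)\<close> of the completed Eisenstein series gives
  \<open>\<Delta> F\<^sub>n = F\<^sub>n\<^sub>-\<^sub>2 - F\<^sub>n\<^sub>-\<^sub>1\<close>, and \<open>F\<^sub>0 = 1/2\<close> because \<open>E(z,0)\<close> only sees the constant term of the theta series;
  so \<open>\<Delta>\<^sup>m F\<^sub>m = (-1)\<^sup>m / 2\<close>, and the theorem follows by induction on \<open>m\<close>.
  The entire continuation of \<open>E\<close> is Riemann's: the Mellin transform of a theta series, folded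
  at \<open>t = 1\<close> by Poisson summation.\<close>

section \<open>Smooth functions and the weight-0 Laplacian\<close>

text \<open>Growth is assumed of f but not of its derivatives, so nothing bounds the harmonic
  function g at the cusp directly; only the differential equations, one chain for each frequency,
  bring the hypothesis to bear. On the Eisenstein side, smoothness means all iterated partial
  derivatives in x and y, and the recursion for \<open>F n\<close> exchanges them with derivatives
  in s; making x, y and s complex turns both questions into Cauchy estimates. The Laplace equation
  is not visible in the folded integral, whose terms satisfy it only up to boundary contributions at
  t = 1. It is read off the original series, each term of which is an eigenfunction, on Re s > 1,
  and reaches s = 0 by the identity theorem in s; modular invariance takes the same route. Growth is
  the opposite case: it needs s near 0, and hence the folded form. The recursion is the action of s
  (s - 1) = s^2 - s on Taylor coefficients.\<close>

lemma open_upper_half: "open upper_half"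
  unfolding upper_half_def by (rule open_halfspace_Im_gt)

lemma frechet_derivative_cong_open:
  assumes "open S" "z \<in> S" "\<And>w. w \<in> S \<Longrightarrow> f w = g w"
  shows "frechet_derivative f (at z) = frechet_derivative g (at z)"
proof -
  have "(f has_derivative D) (at z) \<longleftrightarrow> (g has_derivative D) (at z)" for D
    using assms has_derivative_transform_within_open[of f D z UNIV S g]
      has_derivative_transform_within_open[of g D z UNIV S f] by auto
  then show ?thesis unfolding frechet_derivative_def by simp
qed

lemma pd_cong:
  assumes "\<And>w. w \<in> upper_half \<Longrightarrow> f w = g w" "z \<in> upper_half"
  shows "pdx f z = pdx g z" "pdy f z = pdy g z"
  using frechet_derivative_cong_open[OF open_upper_half assms(2), of f g] assms(1)
  by (auto simp: pdx_def pdy_def)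

lemma iter_partials_cong:
  assumes "\<And>w. w \<in> upper_half \<Longrightarrow> f w = g w" "z \<in> upper_half"
  shows "iter_partials bs f z = iter_partials bs g z"
  using assms
proof (induction bs arbitrary: z)
  case (Cons b bs)
  then have "\<And>w. w \<in> upper_half \<Longrightarrow> iter_partials bs f w = iter_partials bs g w" by blast
  from pd_cong[OF this Cons.prems(2)] show ?case by simp
qed simp

lemma differentiable_cong_upper_half:
  assumes "\<And>w. w \<in> upper_half \<Longrightarrow> f w = g w" "z \<in> upper_half"
  shows "f differentiable (at z) \<longleftrightarrow> g differentiable (at z)"
  unfolding differentiable_def
  using assms open_upper_half has_derivative_transform_within_open[of f _ z UNIV upper_half g]
      has_derivative_transform_within_open[of g _ z UNIV upper_half f] by metis

lemma iter_partials_append: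
  "iter_partials (bs @ cs) f = iter_partials bs (iter_partials cs f)"
  by (induction bs) auto

text \<open>The class P is closed under both partial derivatives up to equality on the half-plane.
  Since \<open>iter_partials\<close> applies the last entry of the list innermost, the induction
  peels the list from the end and lets f vary.\<close>

lemma smooth_on_H_coinduct:
  assumes "P f"
    and step: "\<And>f. P f \<Longrightarrow> (\<forall>z\<in>upper_half. f differentiable (at z)) \<and>
      (\<exists>g. P g \<and> (\<forall>z\<in>upper_half. pdx f z = g z)) \<and> (\<exists>g. P g \<and> (\<forall>z\<in>upper_half. pdy f z = g z))"
  shows "smooth_on_H f"
proof -
  have "\<forall>f. P f \<longrightarrow> (\<forall>z\<in>upper_half. iter_partials bs f differentiable (at z))" for bs
  proof (induction bs rule: rev_induct)
    case Nil
    then show ?case using step by simp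
  next
    case (snoc b bs)
    show ?case
    proof (intro allI impI ballI)
      fix f z assume f: "P f" and z: "z \<in> upper_half"
      obtain g where g: "P g" "\<And>z. z \<in> upper_half \<Longrightarrow> iter_partials [b] f z = g z"
        using step[OF f] by (cases b) auto
      have "iter_partials (bs @ [b]) f w = iter_partials bs g w" if "w \<in> upper_half" for w
        unfolding iter_partials_append using g(2) that by (rule iter_partials_cong)
      then show "iter_partials (bs @ [b]) f differentiable (at z)"
        using differentiable_cong_upper_half z snoc g(1) by metis
    qed
  qed
  then show ?thesis unfolding smooth_on_H_def using assms(1) by blast
qed

lemma smooth_on_H_differentiable: "smooth_on_H f \<Longrightarrow> z \<in> upper_half \<Longrightarrow> f differentiable (at z)"
  unfolding smooth_on_H_def using iter_partials.simps(1) by metis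

lemma smooth_on_H_pdx: "smooth_on_H f \<Longrightarrow> smooth_on_H (pdx f)"
  and smooth_on_H_pdy: "smooth_on_H f \<Longrightarrow> smooth_on_H (pdy f)"
proof -
  have "iter_partials bs (pdx f) = iter_partials (bs @ [True]) f"
    "iter_partials bs (pdy f) = iter_partials (bs @ [False]) f" for bs
    by (simp_all add: iter_partials_append)
  then show "smooth_on_H f \<Longrightarrow> smooth_on_H (pdx f)" "smooth_on_H f \<Longrightarrow> smooth_on_H (pdy f)"
    unfolding smooth_on_H_def by metis+
qed

lemma pd_eqI:
  assumes "(f has_derivative D) (at z)"
  shows "pdx f z = D 1" "pdy f z = D \<i>"
  using frechet_derivative_at[OF assms] by (simp_all add: pdx_def pdy_def)

text \<open>A real-linear map on the complex plane is determined by its values at 1 and \<i>, which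
  \<open>pdx\<close> and \<open>pdy\<close> record. Every rule for partial derivatives is read off
  from this total derivative.\<close>

lemma has_derivative_pd:
  assumes "f differentiable (at z)"
  shows "(f has_derivative (\<lambda>v. of_real (Re v) * pdx f z + of_real (Im v) * pdy f z)) (at z)"
proof -
  let ?D = "frechet_derivative f (at z)"
  have D: "(f has_derivative ?D) (at z)" using assms by (simp add: frechet_derivative_works)
  interpret linear ?D using D has_derivative_linear by blast
  have "?D v = of_real (Re v) * pdx f z + of_real (Im v) * pdy f z" for v
  proof -
    have "v = Re v *\<^sub>R 1 + Im v *\<^sub>R \<i>" by (simp add: complex_eq_iff)
    then have "?D v = ?D (Re v *\<^sub>R 1 + Im v *\<^sub>R \<i>)" by simp
    also have "\<dots> = Re v *\<^sub>R ?D 1 + Im v *\<^sub>R ?D \<i>" by (simp only: add scaleR)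
    finally show ?thesis by (simp add: pdx_def pdy_def scaleR_conv_of_real)
  qed
  then have "?D = (\<lambda>v. of_real (Re v) * pdx f z + of_real (Im v) * pdy f z)" by blast
  then show ?thesis using D by simp
qed

section \<open>Leibniz rules and closure of smooth functions under sums and products\<close>

lemma pd_add:
  assumes "f differentiable (at z)" "g differentiable (at z)"
  shows "pdx (\<lambda>z. f z + g z) z = pdx f z + pdx g z" "pdy (\<lambda>z. f z + g z) z = pdy f z + pdy g z"
  using pd_eqI[OF has_derivative_add[OF has_derivative_pd[OF assms(1)] has_derivative_pd[OF assms(2)]]]
  by simp_all

lemma pd_minus:
  assumes "f differentiable (at z)"
  shows "pdx (\<lambda>z. - f z) z = - pdx f z" "pdy (\<lambda>z. - f z) z = - pdy f z"
  using pd_eqI[OF has_derivative_minus[OF has_derivative_pd[OF assms]]] by simp_all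

lemma pd_mult:
  assumes "f differentiable (at z)" "g differentiable (at z)"
  shows "pdx (\<lambda>z. f z * g z) z = pdx f z * g z + f z * pdx g z"
    "pdy (\<lambda>z. f z * g z) z = pdy f z * g z + f z * pdy g z"
  using pd_eqI[OF has_derivative_mult[OF has_derivative_pd[OF assms(1)] has_derivative_pd[OF assms(2)]]]
  by simp_all

text \<open>A derivative of a product is a product only up to addition, so the class closed under
  both partial derivatives, to which coinduction applies, is that of finite sums of
  products.\<close>

inductive sum_of_products :: "(complex \<Rightarrow> complex) \<Rightarrow> bool" where
  prod: "smooth_on_H f \<Longrightarrow> smooth_on_H g \<Longrightarrow> sum_of_products (\<lambda>z. f z * g z)"
| sum: "sum_of_products f \<Longrightarrow> sum_of_products g \<Longrightarrow> sum_of_products (\<lambda>z. f z + g z)"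

lemma sum_of_products_step:
  assumes "sum_of_products f"
  shows "(\<forall>z\<in>upper_half. f differentiable (at z)) \<and>
      (\<exists>g. sum_of_products g \<and> (\<forall>z\<in>upper_half. pdx f z = g z)) \<and>
      (\<exists>g. sum_of_products g \<and> (\<forall>z\<in>upper_half. pdy f z = g z))"
  using assms
proof induction
  case (prod f g)
  have d: "f differentiable (at z)" "g differentiable (at z)" if "z \<in> upper_half" for z
    using prod that smooth_on_H_differentiable by blast+
  note s = sum_of_products.sum[OF sum_of_products.prod sum_of_products.prod]
  show ?case
  proof (intro conjI ballI)
    show "(\<lambda>z. f z * g z) differentiable at z" if "z \<in> upper_half" for z
      by (rule differentiable_mult[OF d[OF that]])
    show "\<exists>h. sum_of_products h \<and> (\<forall>z\<in>upper_half. pdx (\<lambda>z. f z * g z) z = h z)"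
      using s[OF smooth_on_H_pdx[OF prod(1)] prod(2) prod(1) smooth_on_H_pdx[OF prod(2)]] pd_mult(1)[OF d]
      by (rule_tac exI[of _ "\<lambda>z. pdx f z * g z + f z * pdx g z"]) simp
    show "\<exists>h. sum_of_products h \<and> (\<forall>z\<in>upper_half. pdy (\<lambda>z. f z * g z) z = h z)"
      using s[OF smooth_on_H_pdy[OF prod(1)] prod(2) prod(1) smooth_on_H_pdy[OF prod(2)]] pd_mult(2)[OF d]
      by (rule_tac exI[of _ "\<lambda>z. pdy f z * g z + f z * pdy g z"]) simp
  qed
next
  case (sum f g)
  then obtain f1 f2 g1 g2 where
    *: "sum_of_products f1" "\<forall>z\<in>upper_half. pdx f z = f1 z" "sum_of_products f2" "\<forall>z\<in>upper_half. pdy f z = f2 z"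
    "sum_of_products g1" "\<forall>z\<in>upper_half. pdx g z = g1 z" "sum_of_products g2" "\<forall>z\<in>upper_half. pdy g z = g2 z"
    by (elim conjE exE)
  have d: "f differentiable (at z)" "g differentiable (at z)" if "z \<in> upper_half" for z
    using sum that by simp_all
  show ?case
  proof (intro conjI ballI)
    show "(\<lambda>z. f z + g z) differentiable at z" if "z \<in> upper_half" for z
      by (rule differentiable_add[OF d[OF that]])
    show "\<exists>h. sum_of_products h \<and> (\<forall>z\<in>upper_half. pdx (\<lambda>z. f z + g z) z = h z)"
      using sum_of_products.sum[OF *(1) *(5)] pd_add(1)[OF d] *(2,6)
      by (rule_tac exI[of _ "\<lambda>z. f1 z + g1 z"]) simp
    show "\<exists>h. sum_of_products h \<and> (\<forall>z\<in>upper_half. pdy (\<lambda>z. f z + g z) z = h z)"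
      using sum_of_products.sum[OF *(3) *(7)] pd_add(2)[OF d] *(4,8)
      by (rule_tac exI[of _ "\<lambda>z. f2 z + g2 z"]) simp
  qed
qed

lemma smooth_on_H_sum_of_products: "sum_of_products f \<Longrightarrow> smooth_on_H f"
  by (rule smooth_on_H_coinduct[where P = sum_of_products, OF _ sum_of_products_step])

lemma smooth_on_H_mult:
  assumes "smooth_on_H f" "smooth_on_H g"
  shows "smooth_on_H (\<lambda>z. f z * g z)"
  by (rule smooth_on_H_sum_of_products[OF sum_of_products.prod[OF assms]])

text \<open>Partial derivatives of affine functions are constants, hence again affine. The instances
  of interest are the constants and \<open>Im\<close>.\<close>

lemma smooth_on_H_affine: "smooth_on_H (\<lambda>z. a * of_real (Re z) + b * of_real (Im z) + c)"
proof -
  define L where "L = (\<lambda>a b c z. a * complex_of_real (Re z) + b * complex_of_real (Im z) + c)"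
  have D: "(L a b c has_derivative (\<lambda>v. a * complex_of_real (Re v) + b * complex_of_real (Im v))) (at z)" for a b c z
    unfolding L_def by (auto intro!: derivative_eq_intros)
  have pd: "pdx (L a b c) z = L 0 0 a z" "pdy (L a b c) z = L 0 0 b z" for a b c z
    using pd_eqI[OF D[of a b c z]] by (simp_all add: L_def)
  have "smooth_on_H (L a b c)"
  proof (rule smooth_on_H_coinduct[where P = "\<lambda>f. \<exists>a b c. f = L a b c"])
    fix f assume "\<exists>a b c. f = L a b c"
    then obtain a b c where f: "f = L a b c" by (elim exE)
    show "(\<forall>z\<in>upper_half. f differentiable at z) \<and> (\<exists>g. (\<exists>a b c. g = L a b c) \<and> (\<forall>z\<in>upper_half. pdx f z = g z)) \<and>
         (\<exists>g. (\<exists>a b c. g = L a b c) \<and> (\<forall>z\<in>upper_half. pdy f z = g z))"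
    proof (intro conjI ballI)
      show "f differentiable at z" for z using D[of a b c z] unfolding f differentiable_def by blast
      show "\<exists>g. (\<exists>a b c. g = L a b c) \<and> (\<forall>z\<in>upper_half. pdx f z = g z)"
        by (rule exI[of _ "L 0 0 a"]) (use pd f in auto)
      show "\<exists>g. (\<exists>a b c. g = L a b c) \<and> (\<forall>z\<in>upper_half. pdy f z = g z)"
        by (rule exI[of _ "L 0 0 b"]) (use pd f in auto)
    qed
  next
    show "\<exists>a' b' c'. L a b c = L a' b' c'" by (intro exI) (rule refl)
  qed
  then show ?thesis by (simp add: L_def)
qed

lemma smooth_on_H_const: "smooth_on_H (\<lambda>z. c)"
  using smooth_on_H_affine[of 0 0 c] by simp

lemma smooth_on_H_Im: "smooth_on_H (\<lambda>z. of_real (Im z))"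
  using smooth_on_H_affine[of 0 1 0] by simp

lemma smooth_on_H_add:
  assumes "smooth_on_H f" "smooth_on_H g"
  shows "smooth_on_H (\<lambda>z. f z + g z)"
proof -
  \<comment> \<open>Each summand is written as a product with 1, which reuses the coinduction for
    products.\<close>
  have "sum_of_products (\<lambda>z. f z * (\<lambda>_. 1) z + g z * (\<lambda>_. 1) z)"
    by (rule sum_of_products.sum[OF sum_of_products.prod[OF assms(1) smooth_on_H_const]
        sum_of_products.prod[OF assms(2) smooth_on_H_const]])
  from smooth_on_H_sum_of_products[OF this] show ?thesis by simp
qed

text \<open>The nested product is the form that \<open>smooth_on_H_mult\<close> can take
  apart.\<close>

lemma hyp_laplacian_0:
  "hyp_laplacian 0 f = (\<lambda>z. of_real (Im z) * (of_real (Im z) * (pdx (pdx f) z + pdy (pdy f) z)))"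
  by (simp add: fun_eq_iff hyp_laplacian_def power2_eq_square algebra_simps)

lemma smooth_on_H_laplacian: "smooth_on_H f \<Longrightarrow> smooth_on_H (hyp_laplacian 0 f)"
  unfolding hyp_laplacian_0
  by (rule smooth_on_H_mult[OF smooth_on_H_Im smooth_on_H_mult[OF smooth_on_H_Im
     smooth_on_H_add[OF smooth_on_H_pdx[OF smooth_on_H_pdx] smooth_on_H_pdy[OF smooth_on_H_pdy]]]])

lemma smooth_on_H_laplacian_pow: "smooth_on_H f \<Longrightarrow> smooth_on_H ((hyp_laplacian 0 ^^ n) f)"
  by (induction n) (auto intro: smooth_on_H_laplacian)

lemma laplacian_cong:
  assumes "\<And>w. w \<in> upper_half \<Longrightarrow> f w = g w" "z \<in> upper_half"
  shows "hyp_laplacian 0 f z = hyp_laplacian 0 g z"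
proof -
  have "pdx (pdx f) z = pdx (pdx g) z" "pdy (pdy f) z = pdy (pdy g) z"
    using assms by (auto intro!: pd_cong)
  then show ?thesis by (simp add: hyp_laplacian_0)
qed

lemma laplacian_pow_cong:
  assumes "\<And>w. w \<in> upper_half \<Longrightarrow> f w = g w" "z \<in> upper_half"
  shows "(hyp_laplacian 0 ^^ n) f z = (hyp_laplacian 0 ^^ n) g z"
  using assms(2) by (induction n arbitrary: z) (auto intro!: laplacian_cong assms(1))

lemma laplacian_lincomb:
  assumes "smooth_on_H f" "smooth_on_H g" "z \<in> upper_half"
  shows "hyp_laplacian 0 (\<lambda>z. a * f z + b * g z) z = a * hyp_laplacian 0 f z + b * hyp_laplacian 0 g z"
proof -
  have pdl: "pdx (\<lambda>z. a * f z + b * g z) z = a * pdx f z + b * pdx g z"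
    "pdy (\<lambda>z. a * f z + b * g z) z = a * pdy f z + b * pdy g z"
    if "smooth_on_H f" "smooth_on_H g" "z \<in> upper_half" for f g z
    using pd_eqI[OF has_derivative_add[OF has_derivative_mult_right[OF has_derivative_pd] has_derivative_mult_right[OF has_derivative_pd]],
       of f z g a b] smooth_on_H_differentiable that by auto
  have "pdx (pdx (\<lambda>z. a * f z + b * g z)) z = a * pdx (pdx f) z + b * pdx (pdx g) z"
    using pd_cong(1)[OF pdl(1)[OF assms(1,2)] assms(3)] pdl(1)[OF smooth_on_H_pdx[OF assms(1)] smooth_on_H_pdx[OF assms(2)] assms(3)] by simp
  moreover have "pdy (pdy (\<lambda>z. a * f z + b * g z)) z = a * pdy (pdy f) z + b * pdy (pdy g) z"
    using pd_cong(2)[OF pdl(2)[OF assms(1,2)] assms(3)] pdl(2)[OF smooth_on_H_pdy[OF assms(1)] smooth_on_H_pdy[OF assms(2)] assms(3)] by simp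
  ultimately show ?thesis unfolding hyp_laplacian_0 by (simp add: algebra_simps)
qed

lemma smooth_on_H_lincomb:
  "smooth_on_H f \<Longrightarrow> smooth_on_H g \<Longrightarrow> smooth_on_H (\<lambda>z. a * f z + b * g z)"
  by (intro smooth_on_H_add smooth_on_H_mult smooth_on_H_const)

lemma laplacian_pow_lincomb:
  assumes "smooth_on_H f" "smooth_on_H g" "z \<in> upper_half"
  shows "(hyp_laplacian 0 ^^ n) (\<lambda>z. a * f z + b * g z) z =
    a * (hyp_laplacian 0 ^^ n) f z + b * (hyp_laplacian 0 ^^ n) g z"
  using assms(3)
proof (induction n arbitrary: z)
  case (Suc n)
  have "(hyp_laplacian 0 ^^ Suc n) (\<lambda>z. a * f z + b * g z) z
     = hyp_laplacian 0 (\<lambda>z. a * (hyp_laplacian 0 ^^ n) f z + b * (hyp_laplacian 0 ^^ n) g z) z"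
    using Suc by (simp add: laplacian_cong[OF Suc.IH])
  then show ?case using laplacian_lincomb[OF smooth_on_H_laplacian_pow smooth_on_H_laplacian_pow] assms Suc.prems by simp
qed simp

lemma pd_holomorphic:
  assumes "f holomorphic_on upper_half" "z \<in> upper_half"
  shows "pdx f z = deriv f z" "pdy f z = \<i> * deriv f z"
proof -
  have "(f has_field_derivative deriv f z) (at z)"
    using assms open_upper_half holomorphic_derivI by blast
  from pd_eqI[OF this[unfolded has_field_derivative_def]]
  show "pdx f z = deriv f z" "pdy f z = \<i> * deriv f z" by simp_all
qed

text \<open>By Cauchy-Riemann \<open>pdy\<close> is \<i> times the complex derivative, so the second
  y-derivative is minus the second x-derivative.\<close>

lemma laplacian_holomorphic:
  assumes "f holomorphic_on upper_half" "z \<in> upper_half"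
  shows "hyp_laplacian 0 f z = 0"
proof -
  have h: "deriv f holomorphic_on upper_half" "(\<lambda>z. \<i> * deriv f z) holomorphic_on upper_half"
    using holomorphic_deriv[OF assms(1) open_upper_half] by (auto intro: holomorphic_intros)
  have "deriv (\<lambda>z. \<i> * deriv f z) z = \<i> * deriv (deriv f) z"
    by (rule deriv_cmult) (use h assms open_upper_half holomorphic_on_imp_differentiable_at in blast)
  then have "pdx (pdx f) z = deriv (deriv f) z" "pdy (pdy f) z = - deriv (deriv f) z"
    using pd_cong[OF pd_holomorphic(1)[OF assms(1)] assms(2)] pd_cong[OF pd_holomorphic(2)[OF assms(1)] assms(2)]
      pd_holomorphic[OF h(1) assms(2)] pd_holomorphic[OF h(2) assms(2)] by simp_all
  then show ?thesis by (simp add: hyp_laplacian_0)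
qed

section \<open>Invariance of the Laplacian under the generators of the modular group\<close>

lemma pd_translate:
  assumes "smooth_on_H f" "\<And>z. z \<in> upper_half \<Longrightarrow> f (z + 1) = f z" "z \<in> upper_half"
  shows "pdx f (z + 1) = pdx f z" "pdy f (z + 1) = pdy f z"
proof -
  have z1: "z + 1 \<in> upper_half" using assms(3) by (simp add: upper_half_def)
  have "((\<lambda>z. f (z + 1)) has_derivative (\<lambda>v. of_real (Re v) * pdx f (z+1) + of_real (Im v) * pdy f (z+1))) (at z)"
    by (rule has_derivative_compose[of "\<lambda>z. z + 1" "\<lambda>v. v" z UNIV f, simplified])
       (auto intro!: derivative_eq_intros has_derivative_pd smooth_on_H_differentiable assms(1) z1)
  from pd_eqI[OF this] pd_cong[OF assms(2,3)]
  show "pdx f (z + 1) = pdx f z" "pdy f (z + 1) = pdy f z" by simp_all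
qed

lemma laplacian_translate:
  assumes "smooth_on_H f" "\<And>z. z \<in> upper_half \<Longrightarrow> f (z + 1) = f z" "z \<in> upper_half"
  shows "hyp_laplacian 0 f (z + 1) = hyp_laplacian 0 f z"
proof -
  have "pdx (pdx f) (z + 1) = pdx (pdx f) z"
    using assms by (intro pd_translate smooth_on_H_pdx) auto
  moreover have "pdy (pdy f) (z + 1) = pdy (pdy f) z"
    using assms by (intro pd_translate smooth_on_H_pdy) auto
  ultimately show ?thesis by (simp add: hyp_laplacian_0)
qed

lemma inversion_upper_half:
  assumes "z \<in> upper_half"
  shows "z \<noteq> 0" "- 1 / z \<in> upper_half"
  using assms by (auto simp: upper_half_def Im_divide intro!: divide_pos_pos add_nonneg_pos)

text \<open>The map from z to -1/z has derivative 1/z^2, so its Jacobian is the rotation-dilation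
  with entries Re and Im of 1/z^2. Invariance of g is not assumed, because the lemma is applied to
  \<open>pdx f\<close> and \<open>pdy f\<close>, which lack it.\<close>

lemma pd_compose_inversion:
  assumes g: "smooth_on_H g" and z: "z \<in> upper_half"
  shows "pdx (\<lambda>z. g (-1/z)) z = of_real (Re (1/z^2)) * pdx g (-1/z) + of_real (Im (1/z^2)) * pdy g (-1/z)"
    "pdy (\<lambda>z. g (-1/z)) z = - of_real (Im (1/z^2)) * pdx g (-1/z) + of_real (Re (1/z^2)) * pdy g (-1/z)"
    "(\<lambda>z. g (-1/z)) differentiable (at z)"
proof -
  have "((\<lambda>z. -1 / z) has_derivative (\<lambda>v. v / z^2)) (at z)"
    using inversion_upper_half(1)[OF z] by (auto intro!: derivative_eq_intros simp: power2_eq_square field_simps)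
  from has_derivative_compose[OF this has_derivative_pd[OF smooth_on_H_differentiable[OF g inversion_upper_half(2)[OF z]]]]
  have comp: "((\<lambda>z. g (- 1 / z)) has_derivative
      (\<lambda>v. of_real (Re (v / z^2)) * pdx g (-1/z) + of_real (Im (v / z^2)) * pdy g (-1/z))) (at z)" .
  have "Re (\<i> / z^2) = - Im (1 / z^2)" "Im (\<i> / z^2) = Re (1 / z^2)"
    by (simp_all add: Re_divide Im_divide)
  then show "pdx (\<lambda>z. g (-1/z)) z = of_real (Re (1/z^2)) * pdx g (-1/z) + of_real (Im (1/z^2)) * pdy g (-1/z)"
    "pdy (\<lambda>z. g (-1/z)) z = - of_real (Im (1/z^2)) * pdx g (-1/z) + of_real (Re (1/z^2)) * pdy g (-1/z)"
    using pd_eqI[OF comp] by simp_all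
  show "(\<lambda>z. g (-1/z)) differentiable (at z)" using comp unfolding differentiable_def by blast
qed

lemma pd_inversion:
  assumes f: "smooth_on_H f" and inv: "\<And>z. z \<in> upper_half \<Longrightarrow> f (- 1 / z) = f z" and z: "z \<in> upper_half"
  shows "pdx f z = of_real (Re (1/z^2)) * pdx f (-1/z) + of_real (Im (1/z^2)) * pdy f (-1/z)"
    "pdy f z = - of_real (Im (1/z^2)) * pdx f (-1/z) + of_real (Re (1/z^2)) * pdy f (-1/z)"
  using pd_compose_inversion[OF f z] pd_cong[OF inv z] by simp_all

text \<open>Conformal invariance. After two differentiations the first-order terms cancel because A
  + \<i> B = 1/z^2 satisfies the Cauchy-Riemann equations, the mixed second derivatives cancel in
  the sum, and the remaining factor A^2 + B^2 = |z|^(-4) is exactly how (Im z)^2 changes.\<close>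

lemma laplacian_inversion:
  assumes f: "smooth_on_H f" and inv: "\<And>z. z \<in> upper_half \<Longrightarrow> f (- 1 / z) = f z" and z: "z \<in> upper_half"
  shows "hyp_laplacian 0 f (- 1 / z) = hyp_laplacian 0 f z"
proof -
  define A where "A = (\<lambda>z::complex. complex_of_real (Re (1 / z^2)))"
  define B where "B = (\<lambda>z::complex. complex_of_real (Im (1 / z^2)))"
  note nz = inversion_upper_half(1)
  have cx: "pdx (\<lambda>z. g (-1/z)) z = A z * pdx g (-1/z) + B z * pdy g (-1/z)"
    and cy: "pdy (\<lambda>z. g (-1/z)) z = - B z * pdx g (-1/z) + A z * pdy g (-1/z)"
    and cd: "(\<lambda>z. g (-1/z)) differentiable (at z)"
    if "smooth_on_H g" "z \<in> upper_half" for g z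
    using pd_compose_inversion[OF that] by (simp_all add: A_def B_def)
  have AD: "(A has_derivative (\<lambda>v. of_real (Re (-2 * v / z^3)))) (at z)"
    and BD: "(B has_derivative (\<lambda>v. of_real (Im (-2 * v / z^3)))) (at z)"
  proof -
    have *: "((\<lambda>z. 1 / z^2) has_derivative (\<lambda>v. -2 * v / z^3)) (at z)"
      using nz[OF z] by (auto intro!: derivative_eq_intros simp: power2_eq_square power3_eq_cube field_simps)
    show "(A has_derivative (\<lambda>v. of_real (Re (-2 * v / z^3)))) (at z)"
      "(B has_derivative (\<lambda>v. of_real (Im (-2 * v / z^3)))) (at z)"
      unfolding A_def B_def
      by (rule has_derivative_of_real, rule has_derivative_Re, rule *)
         (rule has_derivative_of_real, rule has_derivative_Im, rule *)
  qed
  have ABd: "A differentiable (at z)" "B differentiable (at z)" using AD BD unfolding differentiable_def by blast+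
  have Ipart: "Re (-2 * \<i> / z^3) = - Im (-2 / z^3)" "Im (-2 * \<i> / z^3) = Re (-2 / z^3)"
    by (simp_all add: Re_divide Im_divide)
  have Ax: "pdx A z = of_real (Re (-2/z^3))" and Ay: "pdy A z = - of_real (Im (-2/z^3))"
    and Bx: "pdx B z = of_real (Im (-2/z^3))" and By: "pdy B z = of_real (Re (-2/z^3))"
    using pd_eqI[OF AD] pd_eqI[OF BD] Ipart by simp_all
  have fx: "smooth_on_H (pdx f)" and fy: "smooth_on_H (pdy f)" using f smooth_on_H_pdx smooth_on_H_pdy by auto
  note dd = ABd cd[OF fx z] cd[OF fy z]
  have "pdx (pdx f) z = pdx (\<lambda>w. A w * pdx f (-1/w) + B w * pdy f (-1/w)) z"
    by (rule pd_cong(1)[OF _ z]) (unfold A_def B_def, rule pd_inversion(1)[OF f inv])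
  also have "\<dots> = pdx A z * pdx f (-1/z) + A z * (A z * pdx (pdx f) (-1/z) + B z * pdy (pdx f) (-1/z))
      + (pdx B z * pdy f (-1/z) + B z * (A z * pdx (pdy f) (-1/z) + B z * pdy (pdy f) (-1/z)))"
    using dd by (subst pd_add) (auto intro!: differentiable_mult simp: pd_mult cx[OF fx z, simplified] cx[OF fy z, simplified])
  finally have xx: "pdx (pdx f) z = \<dots>" .
  have "pdy (pdy f) z = pdy (\<lambda>w. - (B w * pdx f (-1/w)) + A w * pdy f (-1/w)) z"
    by (rule pd_cong(2)[OF _ z]) (unfold A_def B_def minus_mult_left, rule pd_inversion(2)[OF f inv])
  also have "\<dots> = - (pdy B z * pdx f (-1/z) + B z * (- B z * pdx (pdx f) (-1/z) + A z * pdy (pdx f) (-1/z)))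
      + (pdy A z * pdy f (-1/z) + A z * (- B z * pdx (pdy f) (-1/z) + A z * pdy (pdy f) (-1/z)))"
    using dd by (subst pd_add) (auto intro!: differentiable_mult differentiable_minus
        simp: pd_minus pd_mult cy[OF fx z, simplified] cy[OF fy z, simplified])
  finally have yy: "pdy (pdy f) z = \<dots>" .
  have "pdx (pdx f) z + pdy (pdy f) z = (A z ^ 2 + B z ^ 2) * (pdx (pdx f) (-1/z) + pdy (pdy f) (-1/z))"
    unfolding xx yy Ax Ay Bx By by (simp add: algebra_simps power2_eq_square)
  moreover have "of_real (Im (-1/z)) ^ 2 = of_real (Im z) ^ 2 * (A z ^ 2 + B z ^ 2)"
  proof -
    have "(Im (-1/z))^2 = (Im z)^2 * ((Re (1/z^2))^2 + (Im (1/z^2))^2)"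
    proof -
      have "(Re (1/z^2))^2 + (Im (1/z^2))^2 = (cmod (1/z^2))^2" by (simp add: cmod_power2)
      also have "\<dots> = 1 / (cmod z)^4" by (simp add: norm_divide norm_power power_divide)
      finally show ?thesis
        by (simp add: Im_divide cmod_power2[symmetric] power_divide)
    qed
    then show ?thesis by (simp add: A_def B_def flip: of_real_power of_real_add of_real_mult)
  qed
  ultimately show ?thesis by (simp add: hyp_laplacian_def)
qed

lemma laplacian_pow_invariant:
  assumes f: "smooth_on_H f" and T: "\<And>z. z \<in> upper_half \<Longrightarrow> f (z + 1) = f z"
    and S: "\<And>z. z \<in> upper_half \<Longrightarrow> f (- 1 / z) = f z" and z: "z \<in> upper_half"
  shows "(hyp_laplacian 0 ^^ n) f (z + 1) = (hyp_laplacian 0 ^^ n) f z"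
    "(hyp_laplacian 0 ^^ n) f (- 1 / z) = (hyp_laplacian 0 ^^ n) f z"
  using z
proof (induction n arbitrary: z)
  case (Suc n)
  { case 1 then show ?case using laplacian_translate[OF smooth_on_H_laplacian_pow[OF f] Suc(1)] by simp }
  { case 2 then show ?case using laplacian_inversion[OF smooth_on_H_laplacian_pow[OF f] Suc(2)] by simp }
qed (use T S in auto)

section \<open>Fourier coefficients along horizontal lines\<close>

text \<open>Applied to a Fourier coefficient \<open>u\<close> of \<open>f\<close> and the corresponding coefficient \<open>v\<close> of \<open>\<Delta> f\<close>; the
  proof factors the operator as \<open>(d/dy - c) (d/dy + c)\<close>.\<close>
lemma exp_growth_transfer:
  fixes u u' v :: "real \<Rightarrow> real"
  assumes c: "c > 0"
    and d1: "\<And>y. y > Y \<Longrightarrow> (u has_real_derivative u' y) (at y)"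
    and d2: "\<And>y. y > Y \<Longrightarrow> (u' has_real_derivative u'' y) (at y)"
    and ode: "\<And>y. y > Y \<Longrightarrow> y^2 * (u'' y - c^2 * u y) = v y"
    and b: "b > 0" and v: "eventually (\<lambda>y. \<sigma> * v y \<ge> exp (b * y)) at_top"
    and sig: "\<sigma> = 1 \<or> \<sigma> = -1"
  shows "\<exists>\<tau> b. (\<tau> = 1 \<or> \<tau> = -1) \<and> b > 0 \<and> eventually (\<lambda>y. \<tau> * u y \<ge> exp (b * y)) at_top"
proof -
  \<comment> \<open>Below b, so that division by y^2 is absorbed; below c, so that exp ((b1 - c) y)
    decreases and its value at the right end bounds the integrand from below.\<close>
  define b1 where "b1 = min b c / 2"
  have b1: "b1 > 0" "b1 < c" "b1 < b" using b c by (auto simp: b1_def)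
  define p where "p = (\<lambda>y. \<sigma> * (u' y + c * u y))"
  define V where "V = (\<lambda>y. \<sigma> * (u'' y - c^2 * u y))"
  \<comment> \<open>Integrating factor for d/dy - c: the derivative of \<phi> is exp (- c y) times
    the inhomogeneity V.\<close>
  define \<phi> where "\<phi> = (\<lambda>y. exp (- c * y) * p y)"
  have phi_d: "(\<phi> has_real_derivative exp (- c * y) * V y) (at y)" if "y > Y" for y
    unfolding \<phi>_def p_def V_def
    by (auto intro!: derivative_eq_intros d1[OF that] d2[OF that] simp: algebra_simps power2_eq_square)
  have "eventually (\<lambda>y. exp (b * y) / y^2 \<ge> exp (b1 * y)) at_top"
    using b1 b by real_asymp
  then have "eventually (\<lambda>y. V y \<ge> exp (b1 * y)) at_top"
    using v eventually_gt_at_top[of "max Y 0"]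
  proof eventually_elim
    case (elim y)
    have "V y = \<sigma> * v y / y^2" using ode[of y] elim(3) unfolding V_def by (auto simp: field_simps)
    also have "\<dots> \<ge> exp (b * y) / y^2" using elim by (intro divide_right_mono) auto
    finally show ?case using elim by linarith
  qed
  then obtain Y1 where Y1: "Y1 > Y" "\<And>y. y \<ge> Y1 \<Longrightarrow> V y \<ge> exp (b1 * y)"
    unfolding eventually_at_top_linorder by (metis gt_ex max.bounded_iff max_less_iff_conj order.strict_trans1 max.cobounded2 max.cobounded1 less_le_trans nle_le)
  have inc: "\<phi> y \<ge> \<phi> x + (y - x) * exp ((b1 - c) * y)" if "Y1 \<le> x" "x \<le> y" for x y
  proof (cases "x = y")
    case False
    then have "x < y" using that by simp
    from MVT2[OF this phi_d] that Y1(1) obtain z where z: "x < z" "z < y" "\<phi> y - \<phi> x = (y - x) * (exp (- c * z) * V z)" by force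
    have "exp ((b1 - c) * y) \<le> exp ((b1 - c) * z)" using z b1 by (simp add: mult_left_mono_neg)
    also have "\<dots> = exp (- c * z) * exp (b1 * z)" by (simp add: algebra_simps flip: exp_add)
    also have "\<dots> \<le> exp (- c * z) * V z" using Y1(2)[of z] z that by (intro mult_left_mono) auto
    finally have "(y - x) * exp ((b1 - c) * y) \<le> (y - x) * (exp (- c * z) * V z)" using z by (intro mult_left_mono) auto
    then show ?thesis using z(3) by linarith
  qed simp
  \<comment> \<open>\<phi> increases beyond Y1. If it is ever positive, it stays bounded away from 0
    and p grows like exp (c y). Otherwise \<phi> (y + 1) \<le> 0 forces \<phi> y \<le> - exp ((b1 -
    c) (y + 1)), which is growth of p with the opposite sign; hence the free sign \<tau>.\<close>
  have "\<exists>\<tau> b2. (\<tau> = 1 \<or> \<tau> = -1) \<and> b2 > 0 \<and> eventually (\<lambda>y. \<tau> * p y \<ge> exp (b2 * y)) at_top"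
  proof (cases "\<exists>y0\<ge>Y1. \<phi> y0 > 0")
    case True
    then obtain y0 where y0: "y0 \<ge> Y1" "\<phi> y0 > 0" by blast
    have "eventually (\<lambda>y. \<phi> y0 * exp (c * y) \<ge> exp (b1 * y)) at_top"
      using y0 b1 by real_asymp
    then have "eventually (\<lambda>y. 1 * p y \<ge> exp (b1 * y)) at_top"
      using eventually_ge_at_top[of y0]
    proof eventually_elim
      case (elim y)
      have "0 \<le> (y - y0) * exp ((b1 - c) * y)" using elim(2) by simp
      then have "\<phi> y \<ge> \<phi> y0" using inc[OF y0(1) elim(2)] by linarith
      then have "\<phi> y0 * exp (c * y) \<le> exp (c * y) * \<phi> y" by (simp add: mult.commute)
      also have "\<dots> = p y" by (simp add: \<phi>_def flip: exp_add mult.assoc)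
      finally show ?case using elim by simp
    qed
    then show ?thesis using b1 by blast
  next
    case False
    have "eventually (\<lambda>y. exp (b1 * y) * exp (b1 - c) \<ge> exp (b1 / 2 * y)) at_top"
      using b1 by real_asymp
    then have "eventually (\<lambda>y. (-1) * p y \<ge> exp (b1 / 2 * y)) at_top"
      using eventually_ge_at_top[of Y1]
    proof eventually_elim
      case (elim y)
      have "\<phi> (y + 1) \<le> 0" using False elim(2) by (auto simp: not_less)
      then have "exp ((b1 - c) * (y + 1)) \<le> - \<phi> y" using inc[OF elim(2), of "y+1"] by simp
      then have "exp (c * y) * exp ((b1 - c) * (y + 1)) \<le> exp (c * y) * (- \<phi> y)" by (intro mult_left_mono) auto
      also have "\<dots> = - p y" by (simp add: \<phi>_def flip: exp_add mult.assoc)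
      finally have "exp (b1 * y) * exp (b1 - c) \<le> - p y" by (simp add: algebra_simps flip: exp_add)
      then show ?case using elim by simp
    qed
    then show ?thesis using b1 by (intro exI[of _ "-1"] exI[of _ "b1/2"]) auto
  qed
  then obtain \<tau> b2 where tau: "\<tau> = 1 \<or> \<tau> = -1" and b2: "b2 > 0" and ev: "eventually (\<lambda>y. \<tau> * p y \<ge> exp (b2 * y)) at_top" by blast
  from ev obtain Y2 where Y2: "Y2 > Y" "\<And>y. y \<ge> Y2 \<Longrightarrow> \<tau> * p y \<ge> exp (b2 * y)"
    unfolding eventually_at_top_linorder by (metis gt_ex max.bounded_iff max_less_iff_conj order.strict_trans1 max.cobounded2 max.cobounded1 less_le_trans nle_le)
  \<comment> \<open>Integrating factor for d/dy + c. Up to the sign, its derivative is at least exp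
    ((b2 + c) y), which outgrows exp (c y); the unknown initial value is swamped and no second case
    arises.\<close>
  define \<psi> where "\<psi> = (\<lambda>y. \<tau> * \<sigma> * (exp (c * y) * u y))"
  have psi_d: "(\<psi> has_real_derivative exp (c * y) * (\<tau> * p y)) (at y)" if "y > Y" for y
    unfolding \<psi>_def p_def
    by (auto intro!: derivative_eq_intros d1[OF that] simp: algebra_simps)
  have inc2: "\<psi> y \<ge> \<psi> x + (y - x) * exp ((b2 + c) * x)" if "Y2 \<le> x" "x < y" for x y
  proof -
    from MVT2[OF that(2) psi_d] that Y2(1) obtain z where z: "x < z" "z < y" "\<psi> y - \<psi> x = (y - x) * (exp (c * z) * (\<tau> * p z))" by force
    have "exp ((b2 + c) * x) \<le> exp ((b2 + c) * z)" using z b2 c by simp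
    also have "\<dots> = exp (c * z) * exp (b2 * z)" by (simp add: algebra_simps flip: exp_add)
    also have "\<dots> \<le> exp (c * z) * (\<tau> * p z)" using Y2(2)[of z] z that by (intro mult_left_mono) auto
    finally have "(y - x) * exp ((b2 + c) * x) \<le> (y - x) * (exp (c * z) * (\<tau> * p z))" using z by (intro mult_left_mono) auto
    then show ?thesis using z(3) by linarith
  qed
  have "eventually (\<lambda>y. exp (- c * y) * (\<psi> Y2 + exp ((b2 + c) * (y - 1))) \<ge> exp (b2 / 2 * y)) at_top"
  proof -
    have "((\<lambda>y. exp (- c * y) * \<psi> Y2) \<longlongrightarrow> 0) at_top" using c by real_asymp
    from order_tendstoD(1)[OF this, of "-1"] have "eventually (\<lambda>y. exp (- c * y) * \<psi> Y2 > -1) at_top" by simp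
    moreover have "eventually (\<lambda>y. exp (b2 * y) * exp (- (b2 + c)) \<ge> exp (b2 / 2 * y) + 1) at_top"
      using b2 by real_asymp
    ultimately show ?thesis
    proof eventually_elim
      case (elim y)
      have "exp (- c * y) * exp ((b2 + c) * (y - 1)) = exp (b2 * y) * exp (- (b2 + c))"
        by (simp add: algebra_simps flip: exp_add)
      then show ?case using elim by (simp add: distrib_left)
    qed
  qed
  then have "eventually (\<lambda>y. (\<tau> * \<sigma>) * u y \<ge> exp (b2 / 2 * y)) at_top"
    using eventually_gt_at_top[of "Y2 + 1"]
  proof eventually_elim
    case (elim y)
    have "0 \<le> (y - 1 - Y2) * exp ((b2 + c) * Y2)" using elim(2) by simp
    then have "\<psi> (y - 1) \<ge> \<psi> Y2" using inc2[of Y2 "y - 1"] elim(2) by linarith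
    moreover have "\<psi> y \<ge> \<psi> (y - 1) + exp ((b2 + c) * (y - 1))" using inc2[of "y - 1" y] elim(2) by simp
    ultimately have "exp (- c * y) * (\<psi> Y2 + exp ((b2 + c) * (y - 1))) \<le> exp (- c * y) * \<psi> y"
      by (intro mult_left_mono) auto
    also have "\<dots> = (\<tau> * \<sigma>) * u y" by (simp add: \<psi>_def flip: exp_add mult.assoc)
    finally show ?case using elim by linarith
  qed
  then show ?thesis using b2 tau sig by (intro exI[of _ "\<tau> * \<sigma>"] exI[of _ "b2/2"]) auto
qed

section \<open>Uniqueness of Fourier coefficients for continuous periodic functions\<close>

definition cis1 :: "int \<Rightarrow> real \<Rightarrow> complex" where
  "cis1 k x = cis (2 * pi * of_int k * x)"

lemma cis1_add: "cis1 (j + k) x = cis1 j x * cis1 k x"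
  by (simp add: cis1_def cis_mult algebra_simps)

lemma continuous_on_cis1 [continuous_intros]: "continuous_on A (cis1 k)"
  unfolding cis1_def[abs_def] by (intro continuous_intros)

lemma cis1_0 [simp]: "cis1 0 x = 1" "cis1 k 0 = 1" by (simp_all add: cis1_def)

lemma norm_cis1 [simp]: "norm (cis1 k x) = 1" by (simp add: cis1_def)

lemma cis1_int: "cis1 k (of_int n) = 1"
proof -
  have "cis1 k (of_int n) = cis (2 * pi * of_int (k * n))" by (simp add: cis1_def algebra_simps)
  also have "\<dots> = 1" by (rule cis_multiple_2pi) simp
  finally show ?thesis .
qed

lemma cis1_add_int: "cis1 k (x + of_int n) = cis1 k x"
  using cis1_int[of k n] by (simp add: cis1_def cis_mult[symmetric] distrib_left)

lemma cis1_minus: "cis1 (-k) x = cnj (cis1 k x)" by (simp add: cis1_def cis_cnj)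

lemma periodic_integral_shift:
  fixes f :: "real \<Rightarrow> complex"
  assumes "continuous_on UNIV f" "\<And>x. f (x + 1) = f x"
  shows "integral {a..a+1} f = integral {0..1} f"
proof -
  have int: "f integrable_on {a..b}" for a b
    by (rule integrable_continuous_real) (use assms(1) continuous_on_subset in blast)
  have cont: "continuous_on {a..b} f" for a b using assms(1) continuous_on_subset by blast
  define G where "G = (\<lambda>x. integral {0..x} f - integral {0..(0::real)} f)"
  have per: "f (x + of_int n) = f x" for x n
  proof (induction n rule: int_induct[where k = 0])
    case (step1 i) then show ?case using assms(2)[of "x + of_int i"] by (simp add: add.assoc)
  next
    case (step2 i) then show ?case using assms(2)[of "x + of_int (i - 1)"] by (simp add: algebra_simps)
  qed simp
  define n where "n = \<lfloor>a\<rfloor>"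
  have n: "of_int n \<le> a" "a < of_int n + 1" by (auto simp: n_def)
  have sh: "integral {a + c..b + c} f = integral {a..b} (\<lambda>x. f (x + c))" if "a \<le> b" for a b c :: real
    using integral_shift_real_ivl[of "a+c" c "b+c" f] int[of "a+c" "b+c"] by (simp add: algebra_simps)
  \<comment> \<open>Cut at the integer inside the interval and move the right-hand piece back by one
    period.\<close>
  have "integral {a..a+1} f = integral {a..of_int n+1} f + integral {of_int n+1..a+1} f"
    using n by (intro Henstock_Kurzweil_Integration.integral_combine[symmetric] int) auto
  also have "integral {of_int n+1..a+1} f = integral {of_int n..a} (\<lambda>x. f (x + 1))"
    using sh[of "of_int n" a 1] n by simp
  also have "\<dots> = integral {of_int n..a} f" using assms(2) by simp
  also have "integral {a..of_int n+1} f + integral {of_int n..a} f = integral {of_int n..of_int n + 1} f"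
    using n by (subst add.commute, intro Henstock_Kurzweil_Integration.integral_combine int) auto
  also have "\<dots> = integral {0..1} (\<lambda>x. f (x + of_int n))"
    using sh[of 0 1 "of_int n"] by (simp add: add.commute)
  finally show ?thesis by (simp add: per)
qed

text \<open>The powers of \<open>cos\<^sup>2 (\<pi> x)\<close> are trigonometric polynomials that concentrate at \<open>0\<close>.\<close>
lemma fourier_modes_not_all_orthogonal:
  fixes g :: "real \<Rightarrow> complex"
  assumes cont: "continuous_on UNIV g" and g0: "g 0 = 1"
    and van: "\<And>k. ((\<lambda>x. g x * cis1 k x) has_integral 0) {-1/2..1/2}"
  shows False
proof -
  define T where "T = (\<lambda>x::real. (cos (pi * x))^2)"
  have T: "complex_of_real (T x) = (2 + cis1 1 x + cis1 (-1) x) / 4" for x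
  proof -
    have "cis1 1 x + cis1 (-1) x = of_real (2 * cos (2 * (pi * x)))"
      by (simp add: cis1_def complex_eq_iff algebra_simps)
    then show ?thesis unfolding T_def cos_double_cos by (simp add: algebra_simps)
  qed
  \<comment> \<open>Multiplication by T couples the frequency k with k + 1 and k - 1, so the
    induction keeps k arbitrary.\<close>
  have J: "((\<lambda>x. g x * cis1 k x * of_real (T x ^ N)) has_integral 0) {-1/2..1/2}" for N k
  proof (induction N arbitrary: k)
    case (Suc N)
    have "((\<lambda>x. (2 * (g x * cis1 k x * of_real (T x ^ N)) + g x * cis1 (k+1) x * of_real (T x ^ N)
       + g x * cis1 (k-1) x * of_real (T x ^ N)) / 4) has_integral ((2 * 0 + 0 + 0) / 4)) {-1/2..1/2}"
      by (intro has_integral_divide has_integral_add has_integral_mult_right Suc)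
    moreover have "(2 * (g x * cis1 k x * of_real (T x ^ N)) + g x * cis1 (k+1) x * of_real (T x ^ N)
       + g x * cis1 (k-1) x * of_real (T x ^ N)) / 4 = g x * cis1 k x * of_real (T x ^ Suc N)" for x
      by (simp add: T cis1_add diff_conv_add_uminus del: add_uminus_conv_diff) (simp add: field_simps)
    ultimately show ?case by simp
  qed (use van in simp)
  define u where "u = (\<lambda>x. Re (g x))"
  have Ju: "((\<lambda>x. u x * T x ^ N) has_integral 0) {-1/2..1/2}" for N
    using has_integral_Re[OF J[of 0 N]] by (simp add: u_def)
  have contu: "continuous_on UNIV u" unfolding u_def using cont by (intro continuous_intros)
  have "isCont u 0" using contu by (simp add: continuous_on_eq_continuous_at)
  then have "\<exists>d>0. \<forall>x. x \<noteq> 0 \<and> norm (x - 0) < d \<longrightarrow> norm (u x - u 0) < 1/2"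
    unfolding isCont_def by (rule LIM_D) simp
  then obtain d where d: "d > 0" "\<And>x. x \<noteq> 0 \<and> norm (x - 0) < d \<longrightarrow> norm (u x - u 0) < 1/2" by blast
  have u0: "u 0 = 1" by (simp add: u_def g0)
  define \<delta> where "\<delta> = min (d / 2) (1/4)"
  have \<delta>: "\<delta> > 0" "\<delta> < 1/2" "\<And>x. \<bar>x\<bar> \<le> \<delta> \<Longrightarrow> u x \<ge> 1/2"
  proof -
    show "\<delta> > 0" "\<delta> < 1/2" using d by (auto simp: \<delta>_def)
    fix x :: real assume "\<bar>x\<bar> \<le> \<delta>"
    then have "\<bar>x\<bar> < d" using d(1) by (simp add: \<delta>_def)
    then have "x = 0 \<or> \<bar>u x - 1\<bar> < 1/2" using d(2)[of x] u0 by auto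
    then show "u x \<ge> 1/2" using u0 by (auto simp: abs_less_iff simp del: less_divide_eq_numeral1)
  qed
  have "bounded (u ` {-1/2..1/2})"
    by (intro compact_imp_bounded compact_continuous_image continuous_on_subset[OF contu]) auto
  then obtain M where M: "M > 0" "\<And>x. x \<in> {-1/2..1/2} \<Longrightarrow> \<bar>u x\<bar> \<le> M"
    by (auto simp: bounded_pos)
  define r1 where "r1 = T (\<delta>/2)"
  define r2 where "r2 = T \<delta>"
  have cospi: "cos (pi * x) > cos (pi * y)" if "0 \<le> x" "x < y" "y \<le> 1/2" for x y
    using that by (intro cos_monotone_0_pi) auto
  have cospi0: "cos (pi * y) \<ge> 0" if "0 \<le> y" "y \<le> 1/2" for y
  proof (rule cos_ge_zero)
    show "pi * y \<le> pi / 2" using that by (simp add: field_simps)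
    have "0 \<le> pi * y" using that by simp
    then show "- (pi / 2) \<le> pi * y" using pi_gt_zero by linarith
  qed
  have Tabs: "T x = T \<bar>x\<bar>" for x by (simp add: T_def abs_if)
  have Tmono: "T y \<le> T x" if "0 \<le> x" "x \<le> y" "y \<le> 1/2" for x y
    using cospi[of x y] cospi0[of y] that by (cases "x = y") (auto simp: T_def intro!: power_mono)
  have r2: "r2 > 0" using cospi[of \<delta> "1/2"] cospi0[of "1/2"] \<delta> by (auto simp: r2_def T_def)
  have r12: "r2 < r1" unfolding r1_def r2_def T_def using cospi[of "\<delta>/2" \<delta>] cospi0[of \<delta>] \<delta>
    by (intro power_strict_mono) auto
  \<comment> \<open>Take r1^N / 2 on the inner interval, 0 elsewhere, and subtract M r2^N
    throughout. The result lies below u T^N: inside, u \<ge> 1/2 and T \<ge> r1; up to \<delta> the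
    product is nonnegative; beyond \<delta>, T \<le> r2 and |u| \<le> M. Its integral is therefore
    at most 0, which fails for large N because r2 < r1.\<close>
  have key: "\<delta> * r1 ^ N / 2 \<le> M * r2 ^ N" for N
  proof -
    have "((\<lambda>x. r1 ^ N / 2) has_integral (\<delta>/2 - (-\<delta>/2)) * (r1 ^ N / 2)) {-\<delta>/2..\<delta>/2}"
      using has_integral_const_real[of "r1 ^ N / 2" "-\<delta>/2" "\<delta>/2"] \<delta> by simp
    then have "((\<lambda>x. if x \<in> {-\<delta>/2..\<delta>/2} then r1 ^ N / 2 else 0) has_integral (\<delta>/2 - (-\<delta>/2)) * (r1 ^ N / 2)) {-1/2..1/2}"
      using \<delta> by (subst has_integral_restrict) auto
    moreover have "((\<lambda>x. M * r2 ^ N) has_integral M * r2 ^ N) {-1/2..1/2::real}"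
      using has_integral_const_real[of "M * r2 ^ N" "-1/2" "1/2"] by simp
    ultimately have "((\<lambda>x. (if x \<in> {-\<delta>/2..\<delta>/2} then r1 ^ N / 2 else 0) - M * r2 ^ N)
       has_integral ((\<delta>/2 - (-\<delta>/2)) * (r1 ^ N / 2) - M * r2 ^ N)) {-1/2..1/2}"
      by (rule has_integral_diff)
    then have "(\<delta>/2 - (-\<delta>/2)) * (r1 ^ N / 2) - M * r2 ^ N \<le> 0"
    proof (rule has_integral_le[OF _ Ju[of N]])
      fix x :: real assume x: "x \<in> {-1/2..1/2}"
      have T0: "T x \<ge> 0" by (simp add: T_def)
      have Mr: "M * r2 ^ N \<ge> 0" using M r2 by simp
      consider "\<bar>x\<bar> \<le> \<delta>/2" | "\<delta>/2 < \<bar>x\<bar>" "\<bar>x\<bar> \<le> \<delta>" | "\<delta> < \<bar>x\<bar>" by linarith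
      then show "(if x \<in> {-\<delta>/2..\<delta>/2} then r1 ^ N / 2 else 0) - M * r2 ^ N \<le> u x * T x ^ N"
      proof cases
        case 1
        have "r1 \<le> T x" using Tmono[of "\<bar>x\<bar>" "\<delta>/2"] 1 \<delta> Tabs[of x] by (simp add: r1_def)
        then have "r1 ^ N \<le> T x ^ N" using r2 r12 by (intro power_mono) auto
        then have "1/2 * r1 ^ N \<le> u x * T x ^ N" using \<delta>(3)[of x] 1 \<delta>(1) r2 r12 by (intro mult_mono) auto
        then show ?thesis using Mr 1 by (auto split: if_splits)
      next
        case 2
        have "0 \<le> u x * T x ^ N" using \<delta>(3)[of x] 2 T0 by auto
        moreover have nx: "x \<notin> {-\<delta>/2..\<delta>/2}" using 2 by auto
        ultimately show ?thesis using Mr unfolding if_not_P[OF nx] by linarith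
      next
        case 3
        have "\<bar>x\<bar> \<le> 1/2" using x by auto
        then have "T x \<le> r2" using Tmono[of \<delta> "\<bar>x\<bar>"] 3 \<delta> Tabs[of x] by (simp add: r2_def)
        then have "\<bar>u x\<bar> * T x ^ N \<le> M * r2 ^ N" using M(2)[OF x] M(1) T0 by (intro mult_mono power_mono) auto
        then have "\<bar>u x * T x ^ N\<bar> \<le> M * r2 ^ N" using T0 by (simp add: abs_mult)
        moreover have nx: "x \<notin> {-\<delta>/2..\<delta>/2}" using 3 \<delta> by auto
        ultimately show ?thesis unfolding if_not_P[OF nx] by linarith
      qed
    qed
    then show ?thesis by simp
  qed
  obtain N where N: "2 * M / \<delta> < (r1 / r2) ^ N" using real_arch_pow[of "r1/r2" "2 * M / \<delta>"] r12 r2 by auto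
  have "2 * M / \<delta> * r2 ^ N < r1 ^ N" using N r2 by (simp add: power_divide pos_less_divide_eq)
  then have "\<delta> * r1 ^ N / 2 > M * r2 ^ N" using \<delta>(1) by (simp add: field_simps)
  with key[of N] show False by linarith
qed

text \<open>A point where f is nonzero is moved to the origin and the value there is scaled to 1.
  Translation only multiplies each Fourier coefficient by a number of modulus 1, so the coefficients
  still vanish.\<close>

lemma fourier_uniqueness:
  fixes f :: "real \<Rightarrow> complex"
  assumes cont: "continuous_on UNIV f" and per: "\<And>x. f (x + 1) = f x"
    and van: "\<And>k. integral {0..1} (\<lambda>x. f x * cis1 k x) = 0"
  shows "f x0 = 0"
proof (rule ccontr)
  assume nz: "f x0 \<noteq> 0"
  define g where "g = (\<lambda>x. f (x + x0) / f x0)"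
  have cg: "continuous_on UNIV g" unfolding g_def using nz
    by (intro continuous_intros continuous_on_compose2[OF cont]) auto
  show False
  proof (rule fourier_modes_not_all_orthogonal[OF cg])
    show "g 0 = 1" using nz by (simp add: g_def)
    fix k
    let ?F = "\<lambda>x. f x * cis1 k (x - x0)"
    have cF: "continuous_on UNIV ?F" unfolding cis1_def[abs_def] by (intro continuous_intros cont)
    have int: "?F integrable_on {a..b}" for a b
      by (rule integrable_continuous_real) (use cF continuous_on_subset in blast)
    have pF: "?F (x + 1) = ?F x" for x
      using per[of x] cis1_add_int[of k "x - x0" 1] by (simp add: algebra_simps)
    have "integral {x0 - 1/2..x0 - 1/2 + 1} ?F = integral {0..1} ?F"
      by (rule periodic_integral_shift[OF cF pF])
    also have "integral {0..1} ?F = 0"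
    proof -
      have "?F x = cis1 k (-x0) * (f x * cis1 k x)" for x by (simp add: cis1_def cis_mult algebra_simps)
      then have "integral {0..1} ?F = integral {0..1} (\<lambda>x. cis1 k (-x0) * (f x * cis1 k x))" by (simp only:)
      then show ?thesis using van[of k] by simp
    qed
    finally have "integral {x0 - 1/2..x0 - 1/2 + 1} ?F = 0" .
    moreover have "x0 - 1/2 + 1 = x0 + 1/2" by simp
    ultimately have "(?F has_integral 0) {x0 - 1/2..x0 + 1/2}" using int[of "x0-1/2" "x0+1/2"]
      by (metis has_integral_iff)
    then have "((\<lambda>x. ?F (x + x0)) has_integral 0) {-1/2..1/2}"
      using has_integral_shift_real_ivl[of ?F 0 "x0-1/2" "x0+1/2" x0] by simp
    from has_integral_divide[OF this, of "f x0"]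
    show "((\<lambda>x. g x * cis1 k x) has_integral 0) {- 1 / 2..1 / 2}" by (simp add: g_def)
  qed
qed

section \<open>Fourier coefficients of periodic functions on the half-plane\<close>

definition fourier_coeff :: "(complex \<Rightarrow> complex) \<Rightarrow> int \<Rightarrow> real \<Rightarrow> complex" where
  "fourier_coeff f n y = integral {0..1} (\<lambda>x. f (Complex x y) * cis1 (-n) x)"

lemma Complex_upper_half [simp]: "Complex x y \<in> upper_half \<longleftrightarrow> y > 0"
  by (simp add: upper_half_def)

lemma continuous_on_Complex [continuous_intros]:
  assumes "continuous_on A f" "continuous_on A g"
  shows "continuous_on A (\<lambda>x. Complex (f x) (g x))"
  unfolding Complex_eq by (intro continuous_intros assms)

lemma continuous_on_horizontal:
  assumes "continuous_on upper_half f"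
  shows "continuous_on ({0<..} \<times> A) (\<lambda>(y, x). f (Complex x y) * cis1 k x)"
  unfolding case_prod_unfold
  by (intro continuous_intros continuous_on_compose2[OF assms] continuous_on_compose2[OF continuous_on_cis1[of UNIV]]) auto

lemma continuous_on_horizontal_line:
  assumes "continuous_on upper_half f" "y > 0"
  shows "continuous_on A (\<lambda>x. f (Complex x y) * cis1 k x)"
  by (intro continuous_intros continuous_on_compose2[OF assms(1)] continuous_on_compose2[OF continuous_on_cis1[of UNIV]])
     (use assms in auto)

lemma integrable_horizontal:
  assumes "continuous_on upper_half f" "y > 0"
  shows "(\<lambda>x. f (Complex x y) * cis1 k x) integrable_on {a..b}"
  by (rule integrable_continuous_real[OF continuous_on_horizontal_line[OF assms]])

lemma smooth_on_H_continuous: "smooth_on_H f \<Longrightarrow> continuous_on upper_half f"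
  by (intro continuous_at_imp_continuous_on ballI differentiable_imp_continuous_within smooth_on_H_differentiable)

lemma vector_derivative_vertical:
  assumes "f differentiable (at (Complex x y))"
  shows "((\<lambda>y. f (Complex x y)) has_vector_derivative pdy f (Complex x y)) (at y)"
    "((\<lambda>x. f (Complex x y)) has_vector_derivative pdx f (Complex x y)) (at x)"
proof -
  have "((\<lambda>y. Complex x y) has_derivative (\<lambda>h. Complex 0 h)) (at y)"
    "((\<lambda>x. Complex x y) has_derivative (\<lambda>h. Complex h 0)) (at x)"
    unfolding Complex_eq by (auto intro!: derivative_eq_intros)
  from this[THEN has_derivative_compose, OF has_derivative_pd[OF assms]]
  show "((\<lambda>y. f (Complex x y)) has_vector_derivative pdy f (Complex x y)) (at y)"
    "((\<lambda>x. f (Complex x y)) has_vector_derivative pdx f (Complex x y)) (at x)"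
    by (simp_all add: has_vector_derivative_def scaleR_conv_of_real)
qed

lemma fourier_coeff_vertical_derivative:
  assumes f: "smooth_on_H f" and y: "y > 0"
  shows "(fourier_coeff f n has_vector_derivative fourier_coeff (pdy f) n y) (at y)"
proof -
  have "((\<lambda>y. integral (cbox 0 1) (\<lambda>x. f (Complex x y) * cis1 (-n) x)) has_vector_derivative
      integral (cbox 0 1) (\<lambda>x. pdy f (Complex x y) * cis1 (-n) x)) (at y within {0<..})"
  proof (rule leibniz_rule_vector_derivative)
    fix y x :: real assume y: "y \<in> {0<..}"
    have "((\<lambda>y. f (Complex x y)) has_vector_derivative pdy f (Complex x y)) (at y)"
      by (rule vector_derivative_vertical) (use f y smooth_on_H_differentiable in simp)
    then show "((\<lambda>y. f (Complex x y) * cis1 (- n) x) has_vector_derivative pdy f (Complex x y) * cis1 (- n) x) (at y within {0<..})"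
      by (rule has_vector_derivative_mult_left[OF has_vector_derivative_at_within])
    show "(\<lambda>x. f (Complex x y) * cis1 (-n) x) integrable_on cbox 0 1"
      using integrable_horizontal[OF smooth_on_H_continuous[OF f]] y by simp
  next
    show "continuous_on ({0<..} \<times> cbox 0 1) (\<lambda>(y, x). pdy f (Complex x y) * cis1 (- n) x)"
      by (rule continuous_on_horizontal[OF smooth_on_H_continuous[OF smooth_on_H_pdy[OF f]]])
  qed (simp_all add: y)
  moreover have "at y within {0<..} = at y" by (rule at_within_open) (simp_all add: y)
  ultimately show ?thesis unfolding fourier_coeff_def[abs_def] by simp
qed

lemma cis1_has_vector_derivative:
  "(cis1 k has_vector_derivative 2 * pi * \<i> * of_int k * cis1 k x) (at x within A)"
proof -
  let ?c = "2 * pi * \<i> * of_int k"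
  have *: "cis1 k = (\<lambda>x. exp (?c * of_real x))"
    by (rule ext) (simp add: cis1_def cis_conv_exp mult_ac)
  have "((\<lambda>z. exp (?c * z)) has_field_derivative ?c * exp (?c * of_real x)) (at (of_real x))"
    by (auto intro!: derivative_eq_intros)
  from has_vector_derivative_real_field[OF this] show ?thesis unfolding * .
qed

text \<open>Integration by parts over one period; the boundary terms agree by periodicity.\<close>

lemma fourier_coeff_horizontal_derivative:
  assumes f: "smooth_on_H f" and per: "\<And>z. z \<in> upper_half \<Longrightarrow> f (z + 1) = f z" and y: "y > 0"
  shows "fourier_coeff (pdx f) n y = 2 * pi * \<i> * of_int n * fourier_coeff f n y"
proof -
  have "((\<lambda>x. f (Complex x y) * (2 * pi * \<i> * of_int (-n) * cis1 (-n) x) + pdx f (Complex x y) * cis1 (-n) x)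
     has_integral (f (Complex 1 y) * cis1 (-n) 1 - f (Complex 0 y) * cis1 (-n) 0)) {0..1}"
  proof (rule fundamental_theorem_of_calculus)
    fix x :: real
    have "((\<lambda>x. f (Complex x y)) has_vector_derivative pdx f (Complex x y)) (at x within {0..1})"
      by (rule has_vector_derivative_at_within[OF vector_derivative_vertical(2)[OF smooth_on_H_differentiable[OF f]]])
        (simp add: y)
    from has_vector_derivative_mult[OF this cis1_has_vector_derivative]
    show "((\<lambda>x. f (Complex x y) * cis1 (-n) x) has_vector_derivative
      f (Complex x y) * (2 * pi * \<i> * of_int (-n) * cis1 (-n) x) + pdx f (Complex x y) * cis1 (-n) x) (at x within {0..1})" .
  qed simp
  moreover have "f (Complex 1 y) * cis1 (-n) 1 - f (Complex 0 y) * cis1 (-n) 0 = 0"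
    using per[of "Complex 0 y"] y cis1_int[of "-n" 1] plus_complex.ctr[of "Complex 0 y" 1] by simp
  ultimately have "((\<lambda>x. (2 * pi * \<i> * of_int (-n)) * (f (Complex x y) * cis1 (-n) x) + pdx f (Complex x y) * cis1 (-n) x)
     has_integral 0) {0..1}" by (simp add: algebra_simps)
  from has_integral_unique[OF this has_integral_add[OF has_integral_mult_right[OF integrable_integral[OF
      integrable_horizontal[OF smooth_on_H_continuous[OF f] y]]] integrable_integral[OF
      integrable_horizontal[OF smooth_on_H_continuous[OF smooth_on_H_pdx[OF f]] y]]]]
  show ?thesis by (simp add: fourier_coeff_def)
qed

text \<open>Two x-derivatives become the factor -(2 \<pi> n)^2, which leaves an equation in y alone.
  It is the equation of \<open>exp_growth_transfer\<close> with c = 2 \<pi> |n|.\<close>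

lemma fourier_coeff_laplacian:
  assumes f: "smooth_on_H f" and per: "\<And>z. z \<in> upper_half \<Longrightarrow> f (z + 1) = f z" and y: "y > 0"
  shows "fourier_coeff (hyp_laplacian 0 f) n y =
    of_real (y^2) * (fourier_coeff (pdy (pdy f)) n y - of_real ((2 * pi * of_int n)^2) * fourier_coeff f n y)"
proof -
  have "fourier_coeff (hyp_laplacian 0 f) n y = integral {0..1} (\<lambda>x. of_real (y^2) *
    (pdx (pdx f) (Complex x y) * cis1 (-n) x + pdy (pdy f) (Complex x y) * cis1 (-n) x))"
    by (simp add: fourier_coeff_def hyp_laplacian_def algebra_simps)
  also have "\<dots> = of_real (y^2) * (fourier_coeff (pdx (pdx f)) n y + fourier_coeff (pdy (pdy f)) n y)"
    unfolding fourier_coeff_def using f y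
    by (simp add: Henstock_Kurzweil_Integration.integral_add integrable_horizontal smooth_on_H_continuous smooth_on_H_pdx smooth_on_H_pdy)
  also have "fourier_coeff (pdx (pdx f)) n y = 2 * pi * \<i> * of_int n * fourier_coeff (pdx f) n y"
    by (rule fourier_coeff_horizontal_derivative[OF smooth_on_H_pdx[OF f] pd_translate(1)[OF f per] y])
  also have "fourier_coeff (pdx f) n y = 2 * pi * \<i> * of_int n * fourier_coeff f n y"
    by (rule fourier_coeff_horizontal_derivative[OF f per y])
  finally show ?thesis by (simp add: algebra_simps power2_eq_square)
qed

section \<open>Invariant harmonic functions\<close>

text \<open>Up to a term independent of x, g is the x-integral of \<open>pdx g\<close>.
  Differentiating under this integral in y, and then the integral itself in x, gives the two orders
  of differentiation.\<close>

lemma pd_commute: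
  assumes g: "smooth_on_H g" and z: "z \<in> upper_half"
  shows "pdx (pdy g) z = pdy (pdx g) z"
proof -
  define x0 y0 where "x0 = Re z" and "y0 = Im z"
  have z_eq: "z = Complex x0 y0" and y0: "y0 > 0" using z by (auto simp: x0_def y0_def upper_half_def)
  have diff: "h differentiable at (Complex x y)" if "smooth_on_H h" "y > 0" for h x y
    using that by (simp add: smooth_on_H_differentiable)
  have line: "continuous_on A (\<lambda>t. h (Complex t y))" if "smooth_on_H h" "y > 0" for h y A
    using continuous_on_horizontal_line[OF smooth_on_H_continuous[OF that(1)] that(2), of A 0] by simp
  \<comment> \<open>Integration starts at x0 - 1 so that x0 is an interior point and the derivative
    of the integral there is two-sided.\<close>
  have eq1: "g (Complex x y) = g (Complex (x0 - 1) y) + integral {x0 - 1..x} (\<lambda>t. pdx g (Complex t y))"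
    if "y > 0" "x \<ge> x0 - 1" for x y
  proof -
    have "((\<lambda>t. pdx g (Complex t y)) has_integral (g (Complex x y) - g (Complex (x0 - 1) y))) {x0 - 1..x}"
      by (rule fundamental_theorem_of_calculus[OF that(2)])
        (rule has_vector_derivative_at_within[OF vector_derivative_vertical(2)[OF diff[OF g that(1)]]])
    then show ?thesis by (simp add: has_integral_iff)
  qed
  have eq2: "pdy g (Complex x y0) = pdy g (Complex (x0 - 1) y0) + integral {x0 - 1..x} (\<lambda>t. pdy (pdx g) (Complex t y0))"
    if "x \<ge> x0 - 1" for x
  proof -
    have "((\<lambda>y. integral (cbox (x0 - 1) x) (\<lambda>t. pdx g (Complex t y))) has_vector_derivative
        integral (cbox (x0 - 1) x) (\<lambda>t. pdy (pdx g) (Complex t y0))) (at y0 within {0<..})"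
    proof (rule leibniz_rule_vector_derivative)
      fix y t :: real assume "y \<in> {0<..}"
      then show "((\<lambda>y. pdx g (Complex t y)) has_vector_derivative pdy (pdx g) (Complex t y)) (at y within {0<..})"
        using has_vector_derivative_at_within[OF vector_derivative_vertical(1)[OF diff[OF smooth_on_H_pdx[OF g]]]] by simp
      show "(\<lambda>t. pdx g (Complex t y)) integrable_on cbox (x0 - 1) x"
        using line[OF smooth_on_H_pdx[OF g]] \<open>y \<in> {0<..}\<close> by (intro integrable_continuous) simp
    next
      show "continuous_on ({0<..} \<times> cbox (x0 - 1) x) (\<lambda>(y, t). pdy (pdx g) (Complex t y))"
        using continuous_on_horizontal[OF smooth_on_H_continuous[OF smooth_on_H_pdy[OF smooth_on_H_pdx[OF g]]], of _ 0] by simp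
    qed (simp_all add: y0)
    moreover have "at y0 within {0<..} = at y0" by (rule at_within_open) (simp_all add: y0)
    ultimately have "((\<lambda>y. g (Complex (x0 - 1) y) + integral {x0 - 1..x} (\<lambda>t. pdx g (Complex t y))) has_vector_derivative
        pdy g (Complex (x0 - 1) y0) + integral {x0 - 1..x} (\<lambda>t. pdy (pdx g) (Complex t y0))) (at y0)"
      using has_vector_derivative_add[OF vector_derivative_vertical(1)[OF diff[OF g y0]]] by simp
    then have "((\<lambda>y. g (Complex x y)) has_vector_derivative
        pdy g (Complex (x0 - 1) y0) + integral {x0 - 1..x} (\<lambda>t. pdy (pdx g) (Complex t y0))) (at y0)"
      by (rule has_vector_derivative_transform_within_open[where S = "{0<..}"]) (simp_all add: y0 eq1[OF _ that, symmetric])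
    from vector_derivative_unique_at[OF this vector_derivative_vertical(1)[OF diff[OF g y0]]] show ?thesis by simp
  qed
  have "((\<lambda>x. integral {x0 - 1..x} (\<lambda>t. pdy (pdx g) (Complex t y0))) has_vector_derivative
      pdy (pdx g) (Complex x0 y0)) (at x0 within {x0 - 1..x0 + 1})"
    by (rule integral_has_vector_derivative[OF line[OF smooth_on_H_pdy[OF smooth_on_H_pdx[OF g]] y0]]) simp
  moreover have "at x0 within {x0 - 1..x0 + 1} = at x0" by (rule at_within_interior) simp
  ultimately have "((\<lambda>x. pdy g (Complex (x0 - 1) y0) + integral {x0 - 1..x} (\<lambda>t. pdy (pdx g) (Complex t y0))) has_vector_derivative
      0 + pdy (pdx g) (Complex x0 y0)) (at x0)"
    by (intro has_vector_derivative_add has_vector_derivative_const) simp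
  then have "((\<lambda>x. pdy g (Complex x y0)) has_vector_derivative 0 + pdy (pdx g) (Complex x0 y0)) (at x0)"
    by (rule has_vector_derivative_transform_within_open[where S = "{x0 - 1<..}"]) (simp_all add: eq2[symmetric])
  from vector_derivative_unique_at[OF this vector_derivative_vertical(2)[OF diff[OF smooth_on_H_pdy[OF g] y0]]]
  show ?thesis by (simp add: z_eq)
qed

lemma smooth_on_H_holomorphic:
  assumes "h holomorphic_on upper_half"
  shows "smooth_on_H h"
proof (rule smooth_on_H_coinduct[where P = "\<lambda>h. h holomorphic_on upper_half", OF assms])
  fix f assume f: "f holomorphic_on upper_half"
  have d: "deriv f holomorphic_on upper_half" by (rule holomorphic_deriv[OF f open_upper_half])
  show "(\<forall>z\<in>upper_half. f differentiable at z) \<and>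
         (\<exists>g. g holomorphic_on upper_half \<and> (\<forall>z\<in>upper_half. pdx f z = g z)) \<and>
         (\<exists>g. g holomorphic_on upper_half \<and> (\<forall>z\<in>upper_half. pdy f z = g z))"
  proof (intro conjI ballI)
    show "f differentiable at z" if "z \<in> upper_half" for z
      using holomorphic_on_imp_differentiable_at[OF f open_upper_half that] field_differentiable_imp_differentiable by blast
    show "\<exists>g. g holomorphic_on upper_half \<and> (\<forall>z\<in>upper_half. pdx f z = g z)"
      by (rule exI[of _ "deriv f"]) (simp add: pd_holomorphic(1)[OF f] d)
    show "\<exists>g. g holomorphic_on upper_half \<and> (\<forall>z\<in>upper_half. pdy f z = g z)"
      by (rule exI[of _ "\<lambda>z. \<i> * deriv f z"]) (simp add: pd_holomorphic(2)[OF f] holomorphic_on_mult[OF holomorphic_on_const d])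
  qed
qed

lemma fourier_coeff_cong:
  assumes "y > 0" "\<And>z. z \<in> upper_half \<Longrightarrow> f z = g z"
  shows "fourier_coeff f n y = fourier_coeff g n y"
  unfolding fourier_coeff_def using assms by simp

text \<open>By Cauchy-Riemann \<open>pdy h\<close> is \<i> times \<open>pdx h\<close>, so the n-th
  coefficient u satisfies u' = - 2 \<pi> n u, and its product with exp (2 \<pi> n y) is
  constant.\<close>

lemma fourier_coeff_holomorphic:
  assumes h: "h holomorphic_on upper_half" and per: "\<And>z. z \<in> upper_half \<Longrightarrow> h (z + 1) = h z"
  obtains a where "\<And>y. y > 0 \<Longrightarrow> fourier_coeff h n y = a * of_real (exp (- (2 * pi * of_int n) * y))"
proof -
  define c where "c = 2 * pi * real_of_int n"
  have s: "smooth_on_H h" by (rule smooth_on_H_holomorphic[OF h])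
  have D: "(fourier_coeff h n has_vector_derivative - (of_real c * fourier_coeff h n y)) (at y)" if "y > 0" for y
  proof -
    have "fourier_coeff (pdy h) n y = fourier_coeff (\<lambda>z. \<i> * pdx h z) n y"
      by (rule fourier_coeff_cong[OF that]) (simp add: pd_holomorphic[OF h])
    also have "\<dots> = \<i> * fourier_coeff (pdx h) n y"
      unfolding fourier_coeff_def by (simp add: mult.assoc)
    also have "\<dots> = - (of_real c * fourier_coeff h n y)"
      unfolding fourier_coeff_horizontal_derivative[OF s per that, of n, simplified] c_def
      by (simp add: mult_ac)
    finally show ?thesis using fourier_coeff_vertical_derivative[OF s that, of n] by simp
  qed
  have "\<exists>a. \<forall>y\<in>{0<..}. exp (c * y) *\<^sub>R fourier_coeff h n y = a"
  proof (rule has_derivative_zero_constant)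
    fix y :: real assume "y \<in> {0<..}"
    then have y: "y > 0" by simp
    have e: "((\<lambda>y. exp (c * y)) has_real_derivative c * exp (c * y)) (at y)"
      by (auto intro!: derivative_eq_intros)
    note has_vector_derivative_scaleR[OF e D[OF y]]
    moreover have "exp (c * y) *\<^sub>R (- (of_real c * fourier_coeff h n y)) + (c * exp (c * y)) *\<^sub>R fourier_coeff h n y = 0"
      by (simp add: scaleR_conv_of_real mult_ac)
    ultimately have "((\<lambda>y. exp (c * y) *\<^sub>R fourier_coeff h n y) has_vector_derivative 0) (at y)"
      by (simp only:)
    then show "((\<lambda>y. exp (c * y) *\<^sub>R fourier_coeff h n y) has_derivative (\<lambda>h. 0)) (at y within {0<..})"
      by (simp add: has_vector_derivative_def has_derivative_at_withinI)
  qed simp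
  then obtain a where a: "\<And>y. y > 0 \<Longrightarrow> exp (c * y) *\<^sub>R fourier_coeff h n y = a" by auto
  show thesis
  proof (rule that[of a])
    fix y :: real assume y: "y > 0"
    have "fourier_coeff h n y = exp (- c * y) *\<^sub>R (exp (c * y) *\<^sub>R fourier_coeff h n y)"
      by (simp only: scaleR_scaleR exp_add[symmetric]) simp
    then show "fourier_coeff h n y = a * of_real (exp (- (2 * pi * of_int n) * y))"
      unfolding a[OF y] by (simp add: c_def scaleR_conv_of_real)
  qed
qed

section \<open>Absolutely convergent Fourier series\<close>

lemma integral_cis1: "integral {0..1} (cis1 k) = (if k = 0 then 1 else 0)"
proof (cases "k = 0")
  case True
  have "cis1 0 = (\<lambda>x. 1)" by (rule ext) simp
  then show ?thesis using True by simp
next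
  case False
  have "((\<lambda>x. 2 * pi * \<i> * of_int k * cis1 k x) has_integral (cis1 k 1 - cis1 k 0)) {0..1}"
    by (rule fundamental_theorem_of_calculus[OF _ cis1_has_vector_derivative]) simp
  then have "((\<lambda>x. 2 * pi * \<i> * of_int k * cis1 k x) has_integral 0) {0..1}"
    using cis1_int[of k 1] by simp
  from has_integral_mult_right[OF this, of "1 / (2 * pi * \<i> * of_int k)"] False
  show ?thesis by (simp add: has_integral_iff)
qed

text \<open>Summable coefficients make the series converge uniformly to a continuous periodic
  function with the same coefficients as f, and \<open>fourier_uniqueness\<close> annihilates the
  difference.\<close>

lemma fourier_series:
  fixes f :: "real \<Rightarrow> complex" and c :: "int \<Rightarrow> complex"
  assumes cont: "continuous_on UNIV f" and per: "\<And>x. f (x + 1) = f x"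
    and c: "\<And>n. integral {0..1} (\<lambda>x. f x * cis1 (- n) x) = c n"
    and sum: "(\<lambda>n. norm (c n)) summable_on UNIV"
  shows "f x = (\<Sum>\<^sub>\<infinity>n. c n * cis1 n x)"
proof -
  define s where "s = (\<lambda>x. \<Sum>\<^sub>\<infinity>n. c n * cis1 n x)"
  have unif: "uniform_limit A (\<lambda>X x. \<Sum>n\<in>X. c n * cis1 n x) s (finite_subsets_at_top UNIV)" for A
    unfolding s_def by (rule Weierstrass_m_test_general[OF _ sum]) (simp add: norm_mult)
  have cs: "continuous_on A s" for A
    by (rule uniform_limit_theorem[OF _ unif]) (auto intro!: always_eventually continuous_intros)
  have ps: "s (x + 1) = s x" for x using cis1_add_int[of _ x 1] by (simp add: s_def)
  have coef: "integral {0..1} (\<lambda>x. s x * cis1 k x) = c (-k)" for k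
  proof -
    have "uniform_limit {0..1} (\<lambda>X x. (\<Sum>n\<in>X. c n * cis1 n x) * cis1 k x) (\<lambda>x. s x * cis1 k x) (finite_subsets_at_top UNIV)"
    proof (rule uniform_lim_mult[OF unif uniform_limit_const])
      show "bounded (s ` {0..1})" by (intro compact_imp_bounded compact_continuous_image cs) auto
      show "bounded (cis1 k ` {0..1})" by (intro compact_imp_bounded compact_continuous_image continuous_intros) auto
    qed
    then obtain I J where IJ: "\<And>X. ((\<lambda>x. (\<Sum>n\<in>X. c n * cis1 n x) * cis1 k x) has_integral I X) {0..1}"
        "((\<lambda>x. s x * cis1 k x) has_integral J) {0..1}" "(I \<longlongrightarrow> J) (finite_subsets_at_top UNIV)"
      by (rule uniform_limit_integral) (auto intro!: continuous_intros)
    \<comment> \<open>The formula covers every X: on an infinite X both sums are 0 by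
      convention.\<close>
    have I: "I X = (\<Sum>n\<in>X. c n * (if n = - k then 1 else 0))" for X
    proof -
      have "((\<lambda>x. c n * cis1 (n + k) x) has_integral (c n * (if n = - k then 1 else 0))) {0..1}" for n
        using integral_cis1[of "n + k"] integrable_continuous_real[OF continuous_on_cis1[of "{0..1}" "n + k"]]
        by (intro has_integral_mult_right) (auto simp: has_integral_iff eq_neg_iff_add_eq_0)
      then have "((\<lambda>x. \<Sum>n\<in>X. c n * cis1 (n + k) x) has_integral (\<Sum>n\<in>X. c n * (if n = - k then 1 else 0))) {0..1}" if "finite X"
        using that by (intro has_integral_sum) auto
      moreover have "(\<lambda>x. \<Sum>n\<in>X. c n * cis1 (n + k) x) = (\<lambda>x. (\<Sum>n\<in>X. c n * cis1 n x) * cis1 k x)"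
        by (simp add: cis1_add sum_distrib_right mult.assoc)
      ultimately show ?thesis using has_integral_unique[OF IJ(1)[of X]] has_integral_unique[OF IJ(1)[of X], of 0]
        by (cases "finite X") auto
    qed
    have "eventually (\<lambda>X. I X = c (-k)) (finite_subsets_at_top UNIV)"
      unfolding eventually_finite_subsets_at_top
      by (rule exI[of _ "{-k}"]) (auto simp: I if_distrib[of "\<lambda>t. _ * t"] cong: if_cong)
    then have "(I \<longlongrightarrow> c (-k)) (finite_subsets_at_top UNIV)" by (rule tendsto_eventually)
    from tendsto_unique[OF _ this IJ(3)] IJ(2) show ?thesis by (simp add: has_integral_iff)
  qed
  have int: "(\<lambda>x. f x * cis1 k x) integrable_on {0..1}" "(\<lambda>x. s x * cis1 k x) integrable_on {0..1}" for k
    by (auto intro!: integrable_continuous_real continuous_intros cs continuous_on_subset[OF cont])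
  have "f x - s x = 0"
  proof (rule fourier_uniqueness)
    show "continuous_on UNIV (\<lambda>x. f x - s x)" by (intro continuous_intros cont cs)
    show "f (x + 1) - s (x + 1) = f x - s x" for x by (simp add: per ps)
    show "integral {0..1} (\<lambda>x. (f x - s x) * cis1 k x) = 0" for k
      using c[of "-k"] coef[of k]
      by (simp add: left_diff_distrib Henstock_Kurzweil_Integration.integral_diff int)
  qed
  then show ?thesis by (simp add: s_def)
qed

lemma summable_exp_minus_abs_int:
  fixes b :: real
  assumes "b > 0"
  shows "(\<lambda>n::int. exp (- b * \<bar>of_int n\<bar>)) summable_on UNIV"
proof -
  have g: "summable (\<lambda>n::nat. exp (- b) ^ n)" using assms by (intro summable_geometric) simp
  have e: "exp (- b * real n) = exp (- b) ^ n" for n by (simp add: exp_of_nat_mult[symmetric] mult.commute)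
  have nat: "(\<lambda>n::nat. exp (- b * real n)) summable_on UNIV"
  proof (rule norm_summable_imp_summable_on)
    have "(\<lambda>n. norm (exp (- b * real n))) = (\<lambda>n. exp (- b) ^ n)"
      by (rule ext) (simp only: e[symmetric] real_norm_def abs_exp_cancel)
    then show "summable (\<lambda>n. norm (exp (- b * real n)))" using g by (simp only:)
  qed
  have "(\<lambda>n::int. exp (- b * \<bar>of_int n\<bar>)) summable_on (range int \<union> range (\<lambda>n. - int n))"
  proof (rule summable_on_union)
    show "(\<lambda>n::int. exp (- b * \<bar>of_int n\<bar>)) summable_on range int"
      using nat by (subst summable_on_reindex) (auto simp: o_def)
    show "(\<lambda>n::int. exp (- b * \<bar>of_int n\<bar>)) summable_on range (\<lambda>n. - int n)"
      using nat by (subst summable_on_reindex) (auto simp: o_def inj_on_def)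
  qed
  moreover have "range int \<union> range (\<lambda>n. - int n) = UNIV"
  proof (intro equalityI subsetI UNIV_I)
    fix n :: int show "n \<in> range int \<union> range (\<lambda>n. - int n)"
      by (cases n rule: int_cases2) auto
  qed
  ultimately show ?thesis by simp
qed

section \<open>Invariant holomorphic functions near the cusp\<close>

lemma translate_upper_half: "z \<in> upper_half \<Longrightarrow> z + of_int n \<in> upper_half"
  by (simp add: upper_half_def)

lemma periodic_int:
  assumes per: "\<And>z. z \<in> upper_half \<Longrightarrow> f (z + 1) = f z" and z: "z \<in> upper_half"
  shows "f (z + of_int n) = f z"
proof (induction n rule: int_induct[where k = 0])
  case (step1 i)
  then show ?case using per[OF translate_upper_half[OF z, of i]] by (simp add: add.assoc)
next
  case (step2 i)
  then show ?case using per[OF translate_upper_half[OF z, of "i - 1"]] by simp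
qed simp

lemma connected_upper_half: "connected upper_half"
  unfolding upper_half_def by (intro convex_connected convex_halfspace_Im_gt)

text \<open>As h - L tends to 0 at the cusp, its modulus has on a compact rectangle a maximum that
  is valid wherever Im \<ge> 4/5. A translation and one inversion carry the strip 1/2 < Im < 4/5
  into that region, so the maximum is valid on the whole open half-plane D and is attained inside
  it.\<close>

lemma holomorphic_invariant_constant:
  assumes h: "h holomorphic_on upper_half"
    and T: "\<And>z. z \<in> upper_half \<Longrightarrow> h (z + 1) = h z"
    and S: "\<And>z. z \<in> upper_half \<Longrightarrow> h (- 1 / z) = h z"
    and L: "\<And>e. e > 0 \<Longrightarrow> \<exists>Y. \<forall>z. Im z > Y \<longrightarrow> norm (h z - L) < e"
    and z: "z \<in> upper_half"
  shows "h z = L"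
proof (rule ccontr)
  assume ne: "h z \<noteq> L"
  define f where "f = (\<lambda>z. h z - L)"
  have f: "f holomorphic_on upper_half" unfolding f_def using h by (intro holomorphic_intros)
  \<comment> \<open>A point with |Re| \<le> 1/2 and Im between 1/2 and 4/5 reaches height 4/5 under
    inversion, because 4/5 is below sqrt 3 / 2. The gap between 1/2 and 4/5 makes D an open
    neighbourhood of the rectangle.\<close>
  define D where "D = {z. Im z > 1/2}"
  have D: "open D" "connected D" "D \<subseteq> upper_half"
    unfolding D_def upper_half_def
    by (rule open_halfspace_Im_gt, rule convex_connected[OF convex_halfspace_Im_gt], auto)
  \<comment> \<open>By the identity theorem f cannot vanish on all of Im > 4/5. The nonzero value
    there makes the maximum on the rectangle exceed all values near the cusp.\<close>
  obtain w where w: "Im w > 4/5" "f w \<noteq> 0"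
  proof (rule ccontr)
    assume "\<not> thesis"
    then have "\<And>w. Im w > 4/5 \<Longrightarrow> f w = 0" using that by blast
    moreover have "{z. Im z > 4/5} \<noteq> {}" by (auto intro!: exI[of _ "\<i>"])
    moreover have "{z. Im z > 4/5} \<subseteq> upper_half" by (auto simp: upper_half_def)
    ultimately have "f z = 0"
      using analytic_continuation_open[OF open_halfspace_Im_gt open_upper_half _ connected_upper_half _ f holomorphic_on_const, of "4/5" 0 z] z
      by blast
    then show False using ne by (simp add: f_def)
  qed
  obtain Y where Y: "\<And>z. Im z > Y \<Longrightarrow> norm (f z) < norm (f w)"
    using L[of "norm (f w)"] w(2) by (auto simp: f_def)
  define K where "K = cbox (Complex 0 (4/5)) (Complex 1 (max Y 1))"
  have KH: "K \<subseteq> upper_half" by (auto simp: K_def in_cbox_complex_iff upper_half_def)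
  have translate: "\<exists>v\<in>upper_half. Im v = Im u \<and> Re v \<in> {a..a+1} \<and> f v = f u"
    if "u \<in> upper_half" for u :: complex and a :: real
    using periodic_int[where f = h, OF T that, where n = "- \<lfloor>Re u - a\<rfloor>"] that translate_upper_half[OF that, of "- \<lfloor>Re u - a\<rfloor>"]
    by (intro bexI[of _ "u + of_int (- \<lfloor>Re u - a\<rfloor>)"]) (auto simp: f_def, linarith+)
  have toK: "\<exists>v\<in>K. f v = f u" if "Im u \<ge> 4/5" "Im u \<le> Y" for u
    using translate[of u 0] that by (auto simp: K_def in_cbox_complex_iff upper_half_def)
  have "Im w \<le> Y" using Y[of w] by force
  with toK[of w] w obtain w' where w': "w' \<in> K" "f w' = f w" by auto
  have "continuous_on K (\<lambda>z. norm (f z))"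
    using holomorphic_on_imp_continuous_on[OF f] KH by (intro continuous_intros) (auto intro: continuous_on_subset)
  with continuous_attains_sup[of K "\<lambda>z. norm (f z)"] w'(1)
  obtain \<xi> where xi: "\<xi> \<in> K" "\<And>v. v \<in> K \<Longrightarrow> norm (f v) \<le> norm (f \<xi>)"
    by (auto simp: K_def)
  have big: "norm (f u) \<le> norm (f \<xi>)" if "Im u \<ge> 4/5" for u
  proof (cases "Im u \<le> Y")
    case True
    with toK[OF that] xi(2) show ?thesis by metis
  next
    case False
    then show ?thesis using Y[of u] xi(2)[OF w'(1)] w'(2) by simp
  qed
  have max: "norm (f u) \<le> norm (f \<xi>)" if u: "u \<in> D" for u
  proof (cases "Im u \<ge> 4/5")
    case False
    obtain v where v: "v \<in> upper_half" "Im v = Im u" "Re v \<in> {-1/2..-1/2+1}" "f v = f u"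
      using translate[of u "-1/2"] u D(3) by blast
    have "\<bar>Re v\<bar> \<le> 1/2" using v(3) by auto
    then have "(Re v)^2 \<le> (1/2)^2" by (metis abs_ge_zero power2_abs power_mono)
    \<comment> \<open>On [1/2, 4/5] the square is bounded by its chord, which makes the required
      inequality linear in Im v.\<close>
    moreover have "(Im v - 1/2) * (Im v - 4/5) \<le> 0"
      using u False v(2) by (intro mult_nonneg_nonpos) (auto simp: D_def)
    then have "(Im v)^2 \<le> 13/10 * Im v - 2/5" by (simp add: field_simps power2_eq_square)
    ultimately have "4/5 * ((Re v)^2 + (Im v)^2) \<le> Im v"
      using False v(2) by (simp add: power2_eq_square)
    moreover have "(Re v)^2 + (Im v)^2 > 0" using v(1) by (auto simp: upper_half_def intro: add_nonneg_pos)
    ultimately have "Im (- 1 / v) \<ge> 4/5" by (simp add: Im_divide pos_le_divide_eq)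
    from big[OF this] show ?thesis using S[OF v(1)] v(4) by (simp add: f_def)
  qed (use big in auto)
  have "f constant_on D"
    using maximum_modulus_principle[OF holomorphic_on_subset[OF f D(3)] D(1,2,1) order_refl _ max] xi(1)
    by (auto simp: K_def in_cbox_complex_iff D_def)
  then obtain c where c: "\<And>u. u \<in> D \<Longrightarrow> f u = c" by (auto simp: constant_on_def)
  have "f w = c" using c[of w] w(1) by (simp add: D_def)
  moreover have "f (Complex 0 (max Y 1 + 1)) = c" using c[of "Complex 0 (max Y 1 + 1)"] by (simp add: D_def)
  moreover have "Y < max Y 1 + 1" by linarith
  ultimately show False using Y[of "Complex 0 (max Y 1 + 1)"] by simp
qed

text \<open>Without negative frequencies the expansion is a power series in exp (2 \<pi> \<i> z),
  and the limit is its constant coefficient. All coefficients are controlled by the values of h on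
  the single line Im z = 1.\<close>

lemma holomorphic_cusp_limit:
  assumes h: "h holomorphic_on upper_half" and per: "\<And>z. z \<in> upper_half \<Longrightarrow> h (z + 1) = h z"
    and neg: "\<And>n y. n < 0 \<Longrightarrow> y > 0 \<Longrightarrow> fourier_coeff h n y = 0"
  obtains L where "\<And>e. e > 0 \<Longrightarrow> \<exists>Y. \<forall>z. Im z > Y \<longrightarrow> norm (h z - L) < e"
proof -
  have "\<forall>n. \<exists>a. \<forall>y>0. fourier_coeff h n y = a * of_real (exp (- (2 * pi * of_int n) * y))"
    using fourier_coeff_holomorphic[OF h per] by metis
  then obtain a where a: "\<And>n y. y > 0 \<Longrightarrow> fourier_coeff h n y = a n * of_real (exp (- (2 * pi * of_int n) * y))"
    by metis
  have a0: "a n = 0" if "n < 0" for n using neg[OF that, of 1] a[of 1 n] by simp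
  have ch: "continuous_on upper_half h" by (rule holomorphic_on_imp_continuous_on[OF h])
  have line: "continuous_on A (\<lambda>x. h (Complex x y) * cis1 k x)" if "y > 0" for A y k
    by (rule continuous_on_horizontal_line[OF ch that])
  have "bounded ((\<lambda>x. h (Complex x 1)) ` {0..1})"
    using line[of 1 "{0..1}" 0] by (intro compact_imp_bounded compact_continuous_image) auto
  then obtain M where M: "M > 0" "\<And>x. x \<in> {0..1} \<Longrightarrow> norm (h (Complex x 1)) \<le> M"
    by (auto simp: bounded_pos)
  have aM: "norm (a n) * exp (- (2 * pi * of_int n)) \<le> M" for n
  proof -
    have "norm (fourier_coeff h n 1) \<le> M * (1 - 0)"
      unfolding fourier_coeff_def by (rule integral_bound) (auto simp: norm_mult M intro!: line)
    then show ?thesis by (simp add: a norm_mult)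
  qed
  define b where "b = (\<lambda>n::int. M * exp (- (2 * pi) * \<bar>of_int n\<bar>))"
  have b: "b summable_on UNIV" unfolding b_def
    by (intro summable_on_cmult_right summable_exp_minus_abs_int) simp
  \<comment> \<open>For n \<ge> 1 and y \<ge> 2 one has n (y - 1) \<ge> (y - 2) + n. The decay
    gained from height 1 to height y thus splits into a factor that tends to 0 in y and one that is
    summable in n.\<close>
  have bnd: "norm (a n * of_real (exp (- (2 * pi * of_int n) * y))) \<le> exp (- (2 * pi) * (y - 2)) * b n"
    if "n \<noteq> 0" "y \<ge> 2" for n y
  proof (cases "n < 0")
    case True
    then show ?thesis using M by (simp add: a0 b_def)
  next
    case False
    with that have n: "real_of_int n \<ge> 1" by linarith
    have "norm (a n * of_real (exp (- (2 * pi * of_int n) * y)))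
        = (norm (a n) * exp (- (2 * pi * of_int n))) * exp (- (2 * pi) * (of_int n * (y - 1)))"
      by (simp add: norm_mult mult.assoc algebra_simps flip: exp_add)
    also have "\<dots> \<le> M * exp (- (2 * pi) * ((y - 2) + of_int n))"
    proof (intro mult_mono aM)
      have "(of_int n - 1) * (y - 2) \<ge> 0" using n that by simp
      then have "(y - 2) + of_int n \<le> of_int n * (y - 1)" by (simp add: algebra_simps)
      then show "exp (- (2 * pi) * (of_int n * (y - 1))) \<le> exp (- (2 * pi) * ((y - 2) + of_int n))" by simp
    qed (use M in auto)
    also have "\<dots> = exp (- (2 * pi) * (y - 2)) * b n"
      using n by (simp add: b_def algebra_simps flip: exp_add)
    finally show ?thesis .
  qed
  have bnd1: "norm (a n * of_real (exp (- (2 * pi * of_int n) * y))) \<le> norm (a 0) * exp (- 1 * \<bar>of_int n\<bar>) + b n"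
    if "y \<ge> 2" for n y
  proof (cases "n = 0")
    case True
    then show ?thesis using M by (simp add: b_def)
  next
    case False
    have "exp (- (2 * pi) * (y - 2)) * b n \<le> 1 * b n" using that M by (intro mult_right_mono) (auto simp: b_def)
    then show ?thesis using bnd[OF False that] by (smt (verit) mult_nonneg_nonneg norm_ge_zero exp_ge_zero)
  qed
  define B where "B = infsum b UNIV"
  have est: "norm (h z - a 0) \<le> exp (- (2 * pi) * (Im z - 2)) * B" if z: "Im z \<ge> 2" for z
  proof -
    define y where "y = Im z"
    define c where "c = (\<lambda>n. a n * of_real (exp (- (2 * pi * of_int n) * y)))"
    have y: "y \<ge> 2" using z by (simp add: y_def)
    have sumc: "(\<lambda>n. norm (c n)) summable_on UNIV"
    proof (rule summable_on_comparison_test)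
      show "(\<lambda>n. norm (a 0) * exp (- 1 * \<bar>of_int n\<bar>) + b n) summable_on UNIV"
        by (intro summable_on_add b summable_on_cmult_right summable_exp_minus_abs_int) simp
    qed (use bnd1[OF y] in \<open>auto simp: c_def\<close>)
    have hsum: "h (Complex x y) = (\<Sum>\<^sub>\<infinity>n. c n * cis1 n x)" for x
    proof (rule fourier_series[OF _ _ _ sumc])
      show "continuous_on UNIV (\<lambda>x. h (Complex x y))" using line[of y UNIV 0] y by simp
      show "h (Complex (x + 1) y) = h (Complex x y)" for x
        using per[of "Complex x y"] y plus_complex.ctr[of "Complex x y" 1] by simp
      show "integral {0..1} (\<lambda>x. h (Complex x y) * cis1 (- n) x) = c n" for n
        using a[of y n] y by (simp add: c_def fourier_coeff_def)
    qed
    have "(\<lambda>n. c n * cis1 n (Re z)) summable_on UNIV"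
      by (rule abs_summable_summable) (use sumc in \<open>simp add: norm_mult\<close>)
    then have hs: "((\<lambda>n. c n * cis1 n (Re z)) has_sum h z) UNIV"
      using has_sum_infsum hsum[of "Re z"] by (simp add: y_def)
    have h0: "((\<lambda>n. - (if n = 0 then a 0 else 0)) has_sum - a 0) (UNIV::int set)"
      by (rule has_sum_finite_neutralI[of "{0}"]) auto
    have "((\<lambda>n. c n * cis1 n (Re z) - (if n = 0 then a 0 else 0)) has_sum (h z - a 0)) UNIV"
      using has_sum_add[OF hs h0] by simp
    moreover have "((\<lambda>n. exp (- (2 * pi) * (y - 2)) * b n) has_sum (exp (- (2 * pi) * (y - 2)) * B)) UNIV"
      unfolding B_def by (intro has_sum_cmult_right has_sum_infsum b)
    ultimately show ?thesis unfolding y_def[symmetric]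
    proof (rule norm_infsum_le)
      show "norm (c n * cis1 n (Re z) - (if n = 0 then a 0 else 0)) \<le> exp (- (2 * pi) * (y - 2)) * b n" for n
        using bnd[of n y] y M by (cases "n = 0") (auto simp: norm_mult c_def b_def)
    qed
  qed
  show thesis
  proof (rule that[of "a 0"])
    fix e :: real assume e: "e > 0"
    have "((\<lambda>y. exp (- (2 * pi) * (y - 2)) * B) \<longlongrightarrow> 0) at_top" by real_asymp
    from order_tendstoD(2)[OF this e] obtain Y where Y: "\<And>y. y \<ge> Y \<Longrightarrow> exp (- (2 * pi) * (y - 2)) * B < e"
      by (auto simp: eventually_at_top_linorder)
    show "\<exists>Y. \<forall>z. Im z > Y \<longrightarrow> norm (h z - a 0) < e"
    proof (intro exI[of _ "max Y 2"] allI impI)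
      fix z assume "Im z > max Y 2"
      then show "norm (h z - a 0) < e"
        using le_less_trans[OF est[of z] Y[of "Im z"]] by simp
    qed
  qed
qed

lemma fourier_coeff_moderate_growth:
  assumes f: "smooth_on_H f" and g: "moderate_growth f"
  obtains \<alpha> C Y where "\<And>y. y > Y \<Longrightarrow> norm (fourier_coeff f n y) \<le> C * y powr \<alpha>" "Y > 0"
proof -
  obtain \<alpha> C Y where *: "\<And>z. Im z \<ge> Y \<Longrightarrow> cmod (f z) \<le> C * Im z powr \<alpha>"
    using g unfolding moderate_growth_def by blast
  show thesis
  proof (rule that[of "max Y 1"])
    fix y :: real assume y: "y > max Y 1"
    have "norm (fourier_coeff f n y) \<le> (C * y powr \<alpha>) * (1 - 0)"
      unfolding fourier_coeff_def
      by (rule integral_bound) (use y *[of "Complex _ y"] in \<open>auto simp: norm_mult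
         intro!: continuous_on_horizontal_line smooth_on_H_continuous f\<close>)
    then show "norm (fourier_coeff f n y) \<le> C * y powr \<alpha>" by simp
  qed simp
qed

lemma fourier_coeff_exponential_part:
  assumes f: "smooth_on_H f" and per: "\<And>z. z \<in> upper_half \<Longrightarrow> f (z + 1) = f z"
    and growth: "moderate_growth f" and n: "n \<noteq> 0"
    and eq: "\<And>y. y > 0 \<Longrightarrow> fourier_coeff ((hyp_laplacian 0 ^^ m) f) n y =
      A * of_real (exp (2 * pi * \<bar>of_int n\<bar> * y)) + B * of_real (exp (- (2 * pi * \<bar>of_int n\<bar>) * y))"
  shows "A = 0"
proof (rule ccontr)
  assume A: "A \<noteq> 0"
  define c where "c = 2 * pi * \<bar>real_of_int n\<bar>"
  have c: "c > 0" using n by (simp add: c_def)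
  \<comment> \<open>The rotation that makes A positive. The differential equations have real
    coefficients, so they pass to u, the real part of the rotated coefficient, to which the
    real-valued \<open>exp_growth_transfer\<close> applies.\<close>
  define \<omega> where "\<omega> = cnj A / of_real (norm A)"
  have om: "\<omega> * A = of_real (norm A)" "norm \<omega> = 1"
    using A complex_norm_square[of A] by (auto simp: \<omega>_def norm_divide power2_eq_square mult.commute divide_eq_eq)
  define u where "u = (\<lambda>f y. Re (\<omega> * fourier_coeff f n y))"
  define P where "P = (\<lambda>j. \<exists>\<tau> b. (\<tau> = 1 \<or> \<tau> = -1) \<and> b > 0 \<and>
    eventually (\<lambda>y. \<tau> * u ((hyp_laplacian 0 ^^ j) f) y \<ge> exp (b * y)) at_top)"
  have "P m"
  proof -
    have "eventually (\<lambda>y. norm A * exp (c * y) - norm B * exp (- c * y) \<ge> exp (c / 2 * y)) at_top"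
    proof -
      have "eventually (\<lambda>y. norm A * exp (c * y) \<ge> exp (c / 2 * y) + 1) at_top"
        using A c by real_asymp
      moreover have "((\<lambda>y. norm B * exp (- c * y)) \<longlongrightarrow> 0) at_top" using c by real_asymp
      from order_tendstoD(2)[OF this, of 1] have "eventually (\<lambda>y. norm B * exp (- c * y) < 1) at_top" by simp
      ultimately show ?thesis by eventually_elim simp
    qed
    then have "eventually (\<lambda>y. 1 * u ((hyp_laplacian 0 ^^ m) f) y \<ge> exp (c / 2 * y)) at_top"
      using eventually_gt_at_top[of 0]
    proof eventually_elim
      case (elim y)
      have "Re (\<omega> * B) \<ge> - norm B" using abs_Re_le_cmod[of "\<omega> * B"] om by (simp add: norm_mult)
      then have "- norm B * exp (- c * y) \<le> Re (\<omega> * B) * exp (- c * y)" by (intro mult_right_mono) auto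
      moreover have "u ((hyp_laplacian 0 ^^ m) f) y = Re ((\<omega> * A) * of_real (exp (c * y)) + (\<omega> * B) * of_real (exp (- c * y)))"
        unfolding u_def eq[OF elim(2)] c_def by (simp add: distrib_left mult.assoc)
      ultimately show ?case using elim(1) unfolding om(1) by simp
    qed
    then show ?thesis unfolding P_def using c by (intro exI[of _ 1] exI[of _ "c/2"]) auto
  qed
  have step: "P j" if "P (Suc j)" for j
  proof -
    define g where "g = (hyp_laplacian 0 ^^ j) f"
    have g: "smooth_on_H g" unfolding g_def by (rule smooth_on_H_laplacian_pow[OF f])
    have gper: "g (z + 1) = g z" if "z \<in> upper_half" for z
      unfolding g_def using that
    proof (induction j arbitrary: z)
      case (Suc j)
      then show ?case using laplacian_translate[OF smooth_on_H_laplacian_pow[OF f], of j] by simp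
    qed (use per in simp)
    have bl: "bounded_linear (\<lambda>z. Re (\<omega> * z))"
      by (intro bounded_linear_compose[OF bounded_linear_Re] bounded_linear_mult_right)
    have du: "(u h has_real_derivative u (pdy h) y) (at y)" if "smooth_on_H h" "y > 0" for h y
      using bounded_linear.has_vector_derivative[OF bl fourier_coeff_vertical_derivative[OF that, of n]]
      unfolding u_def has_real_derivative_iff_has_vector_derivative .
    have ode: "y\<^sup>2 * (u (pdy (pdy g)) y - c\<^sup>2 * u g y) = u (hyp_laplacian 0 g) y" if "y > 0" for y
    proof -
      have "(2 * pi * real_of_int n)^2 = c^2" by (simp add: c_def power_mult_distrib)
      moreover have "fourier_coeff (hyp_laplacian 0 g) n y = of_real (y^2) *
          (fourier_coeff (pdy (pdy g)) n y - of_real ((2 * pi * of_int n)^2) * fourier_coeff g n y)"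
        by (rule fourier_coeff_laplacian[OF g gper that])
      moreover have "Re (\<omega> * (of_real a * (p - of_real b * q))) = a * (Re (\<omega> * p) - b * Re (\<omega> * q))" for a b p q
        by (simp add: algebra_simps)
      ultimately show ?thesis unfolding u_def by (simp only:)
    qed
    from that obtain \<tau> b where tb: "\<tau> = 1 \<or> \<tau> = -1" "b > 0"
       "eventually (\<lambda>y. \<tau> * u (hyp_laplacian 0 g) y \<ge> exp (b * y)) at_top"
      unfolding P_def g_def funpow.simps o_apply by blast
    have "\<exists>\<tau> b. (\<tau> = 1 \<or> \<tau> = -1) \<and> b > 0 \<and> eventually (\<lambda>y. \<tau> * u g y \<ge> exp (b * y)) at_top"
      by (rule exp_growth_transfer[where Y = 0 and u' = "u (pdy g)" and u'' = "u (pdy (pdy g))"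
         and v = "u (hyp_laplacian 0 g)" and c = c and b = b and \<sigma> = \<tau>])
        (use c tb in \<open>simp_all add: du g smooth_on_H_pdy ode\<close>)
    then show ?thesis unfolding P_def g_def .
  qed
  \<comment> \<open>Descent from m to 0 by induction on the number i of Laplacians removed;
    truncated subtraction makes the steps beyond m trivial.\<close>
  have "P (m - i)" for i
  proof (induction i)
    case (Suc i)
    show ?case
    proof (cases "i < m")
      case True
      then have "Suc (m - Suc i) = m - i" by simp
      then show ?thesis using step[of "m - Suc i"] Suc by metis
    next
      case False
      then have "m - Suc i = m - i" by simp
      then show ?thesis using Suc by metis
    qed
  qed (use \<open>P m\<close> in simp)
  from this[of m] have "P 0" by simp
  then obtain \<tau> b where tb: "\<tau> = 1 \<or> \<tau> = -1" "b > 0" "eventually (\<lambda>y. \<tau> * u f y \<ge> exp (b * y)) at_top"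
    unfolding P_def funpow.simps id_apply by blast
  obtain \<alpha> C Y where bnd: "\<And>y. y > Y \<Longrightarrow> norm (fourier_coeff f n y) \<le> C * y powr \<alpha>" "Y > 0"
    by (rule fourier_coeff_moderate_growth[OF f growth, of n]) (rule that)
  have "eventually (\<lambda>y. \<bar>C\<bar> * y powr \<bar>\<alpha>\<bar> < exp (b * y)) at_top"
  proof -
    have "((\<lambda>y. y powr a / exp (b * y)) \<longlongrightarrow> 0) at_top" if "a \<ge> 0" for a
      using tb(2) that by real_asymp
    from tendsto_mult_left[OF this[of "\<bar>\<alpha>\<bar>"], of "\<bar>C\<bar>"]
    have "((\<lambda>y. \<bar>C\<bar> * (y powr \<bar>\<alpha>\<bar> / exp (b * y))) \<longlongrightarrow> 0) at_top" by simp
    from order_tendstoD(2)[OF this zero_less_one] show ?thesis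
      by eventually_elim (simp add: divide_less_eq)
  qed
  then have "eventually (\<lambda>y::real. False) at_top"
    using tb(3) eventually_gt_at_top[of "max Y 1"]
  proof eventually_elim
    case (elim y)
    have "\<tau> * u f y \<le> \<bar>u f y\<bar>" using tb(1) by auto
    also have "\<dots> \<le> norm (fourier_coeff f n y)"
      using abs_Re_le_cmod[of "\<omega> * fourier_coeff f n y"] by (simp add: u_def norm_mult om)
    also have "\<dots> \<le> C * y powr \<alpha>" using bnd(1)[of y] elim by simp
    also have "\<dots> \<le> \<bar>C\<bar> * y powr \<bar>\<alpha>\<bar>" using elim by (intro mult_mono powr_mono) auto
    finally show False using elim by linarith
  qed
  then show False by simp
qed

text \<open>\<phi> is the derivative of g by z in Wirtinger's sense, and harmonicity of g is its
  holomorphy. A primitive h changes by a constant under each generator, because \<phi> transforms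
  like a form of weight 2, and both constants vanish at elliptic fixed points. The remainder g - h
  has z-derivative 0, hence is antiholomorphic.\<close>

lemma holomorphic_add_anti_decomposition:
  assumes g: "smooth_on_H g" and harm: "\<And>z. z \<in> upper_half \<Longrightarrow> hyp_laplacian 0 g z = 0"
    and T: "\<And>z. z \<in> upper_half \<Longrightarrow> g (z + 1) = g z"
    and S: "\<And>z. z \<in> upper_half \<Longrightarrow> g (- 1 / z) = g z"
  obtains h k where "h holomorphic_on upper_half" "k holomorphic_on upper_half"
    "\<And>z. g z = h z + cnj (k z)"
    "\<And>z. z \<in> upper_half \<Longrightarrow> h (z + 1) = h z" "\<And>z. z \<in> upper_half \<Longrightarrow> h (- 1 / z) = h z"
    "\<And>z. z \<in> upper_half \<Longrightarrow> k (z + 1) = k z" "\<And>z. z \<in> upper_half \<Longrightarrow> k (- 1 / z) = k z"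
proof -
  have convH: "convex upper_half" unfolding upper_half_def by (rule convex_halfspace_Im_gt)
  define \<phi> where "\<phi> = (\<lambda>z. (1/2) * pdx g z + (- \<i> / 2) * pdy g z)"
  have gx: "smooth_on_H (pdx g)" and gy: "smooth_on_H (pdy g)"
    using g smooth_on_H_pdx smooth_on_H_pdy by auto
  have sphi: "smooth_on_H \<phi>" unfolding \<phi>_def by (rule smooth_on_H_lincomb[OF gx gy])
  have phi: "\<phi> holomorphic_on upper_half"
    unfolding holomorphic_on_open[OF open_upper_half]
  proof (intro ballI)
    fix z assume z: "z \<in> upper_half"
    have "pdx (pdx g) z + pdy (pdy g) z = 0"
      using harm[OF z] z by (auto simp: hyp_laplacian_def upper_half_def)
    then have lap: "pdy (pdy g) z = - pdx (pdx g) z" by (simp add: add_eq_0_iff)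
    note D = has_derivative_add[OF has_derivative_mult_right[OF has_derivative_pd[OF smooth_on_H_differentiable[OF gx z]], of "1/2"]
      has_derivative_mult_right[OF has_derivative_pd[OF smooth_on_H_differentiable[OF gy z]], of "- \<i> / 2"]]
    have "(\<phi> has_derivative (\<lambda>v. ((1/2) * pdx (pdx g) z + (- \<i> / 2) * pdx (pdy g) z) * v)) (at z)"
      unfolding \<phi>_def
    proof (rule has_derivative_eq_rhs[OF D], rule ext)
      fix v
      have v: "v = of_real (Re v) + \<i> * of_real (Im v)" by (simp add: complex_eq_iff)
      show "1 / 2 * (complex_of_real (Re v) * pdx (pdx g) z + complex_of_real (Im v) * pdy (pdx g) z) +
           - \<i> / 2 * (complex_of_real (Re v) * pdx (pdy g) z + complex_of_real (Im v) * pdy (pdy g) z) =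
           (1 / 2 * pdx (pdx g) z + - \<i> / 2 * pdx (pdy g) z) * v"
        unfolding lap pd_commute[OF g z]
        by (subst (5) v) (simp add: field_simps)
    qed
    then show "\<exists>f'. (\<phi> has_field_derivative f') (at z)"
      unfolding has_field_derivative_def by blast
  qed
  obtain h where h': "\<And>z. z \<in> upper_half \<Longrightarrow> (h has_field_derivative \<phi> z) (at z within upper_half)"
    using holomorphic_convex_primitive'[OF convH open_upper_half phi] by blast
  have hd: "(h has_field_derivative \<phi> z) (at z)" if "z \<in> upper_half" for z
    using h'[OF that] at_within_open[OF that open_upper_half] by simp
  have h: "h holomorphic_on upper_half"
    unfolding holomorphic_on_open[OF open_upper_half] using hd by blast
  have trans1: "z + 1 \<in> upper_half" if "z \<in> upper_half" for z
    using that by (simp add: upper_half_def)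
  have "\<exists>\<alpha>. \<forall>z\<in>upper_half. h (z + 1) - h z = \<alpha>"
  proof (rule has_field_derivative_zero_constant[OF convH])
    fix z assume z: "z \<in> upper_half"
    have "((\<lambda>z. h (z + 1) - h z) has_field_derivative (\<phi> (z + 1) - \<phi> z)) (at z)"
      using DERIV_shift[of h "\<phi> (z + 1)" z 1] hd[OF trans1[OF z]] hd[OF z] by (intro DERIV_diff) auto
    then show "((\<lambda>z. h (z + 1) - h z) has_field_derivative 0) (at z within upper_half)"
      using pd_translate[OF g T z] by (simp add: \<phi>_def has_field_derivative_at_within)
  qed
  then obtain \<alpha> where al: "\<And>z. z \<in> upper_half \<Longrightarrow> h (z + 1) - h z = \<alpha>" by blast
  have "\<exists>\<beta>. \<forall>z\<in>upper_half. h (- 1 / z) - h z = \<beta>"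
  proof (rule has_field_derivative_zero_constant[OF convH])
    fix z assume z: "z \<in> upper_half"
    note z' = inversion_upper_half[OF z]
    have "((\<lambda>z. - 1 / z) has_field_derivative 1 / z^2) (at z)"
      using z'(1) by (auto intro!: derivative_eq_intros simp: power2_eq_square)
    from DERIV_chain2[OF hd[OF z'(2)] this]
    have "((\<lambda>z. h (- 1 / z) - h z) has_field_derivative (\<phi> (- 1 / z) * (1 / z^2) - \<phi> z)) (at z)"
      by (intro DERIV_diff hd[OF z])
    moreover have "\<phi> (- 1 / z) * (1 / z^2) = \<phi> z"
    proof -
      have q: "1 / z^2 = of_real (Re (1 / z^2)) + \<i> * of_real (Im (1 / z^2))" by (simp add: complex_eq_iff)
      have "\<phi> z = (of_real (Re (1 / z^2)) + \<i> * of_real (Im (1 / z^2))) * \<phi> (- 1 / z)"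
      proof -
        have e1: "pdx g z = of_real (Re (1/z^2)) * pdx g (-1/z) + of_real (Im (1/z^2)) * pdy g (-1/z)"
          by (rule pd_inversion(1)[OF g S z])
        have e2: "pdy g z = - of_real (Im (1/z^2)) * pdx g (-1/z) + of_real (Re (1/z^2)) * pdy g (-1/z)"
          by (rule pd_inversion(2)[OF g S z])
        show ?thesis unfolding \<phi>_def e1 e2 by (simp add: field_simps)
      qed
      then show ?thesis unfolding q[symmetric] by (simp add: mult.commute)
    qed
    ultimately show "((\<lambda>z. h (- 1 / z) - h z) has_field_derivative 0) (at z within upper_half)"
      by (simp add: has_field_derivative_at_within)
  qed
  then obtain \<beta> where be: "\<And>z. z \<in> upper_half \<Longrightarrow> h (- 1 / z) - h z = \<beta>" by blast
  \<comment> \<open>The inversion fixes \<i>.\<close>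
  have "\<beta> = 0" using be[of \<i>] by (simp add: upper_half_def)
  \<comment> \<open>The map z to -1/(z+1) fixes a primitive cube root of unity.\<close>
  moreover have "\<alpha> = 0"
  proof -
    define \<rho> where "\<rho> = Complex (-1/2) (sqrt 3 / 2)"
    have r: "\<rho> \<in> upper_half" by (simp add: \<rho>_def upper_half_def)
    have "\<rho> * (\<rho> + 1) = -1" by (simp add: \<rho>_def complex_eq_iff algebra_simps)
    moreover have "\<rho> + 1 \<noteq> 0" by (simp add: \<rho>_def complex_eq_iff)
    ultimately have "- 1 / (\<rho> + 1) = \<rho>" by (simp add: field_simps)
    then have "h \<rho> - h (\<rho> + 1) = \<beta>" using be[OF trans1[OF r]] by simp
    then show ?thesis using al[OF r] \<open>\<beta> = 0\<close> by simp
  qed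
  ultimately have hT: "h (z + 1) = h z" and hS: "h (- 1 / z) = h z" if "z \<in> upper_half" for z
    using al[OF that] be[OF that] by simp_all
  define k where "k = (\<lambda>z. cnj (g z - h z))"
  have k: "k holomorphic_on upper_half"
    unfolding holomorphic_on_open[OF open_upper_half]
  proof (intro ballI)
    fix z assume z: "z \<in> upper_half"
    note D = has_derivative_cnj[OF has_derivative_diff[OF has_derivative_pd[OF smooth_on_H_differentiable[OF g z]]
      hd[OF z, unfolded has_field_derivative_def]]]
    have "(k has_derivative (\<lambda>v. cnj ((1/2) * pdx g z + (\<i> / 2) * pdy g z) * v)) (at z)"
      unfolding k_def
    proof (rule has_derivative_eq_rhs[OF D], rule ext)
      fix v
      have "complex_of_real (Re v) * pdx g z + complex_of_real (Im v) * pdy g z - \<phi> z * v =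
        ((1/2) * pdx g z + (\<i> / 2) * pdy g z) * cnj v"
        unfolding \<phi>_def by (simp add: complex_eq_iff field_simps)
      then show "cnj (complex_of_real (Re v) * pdx g z + complex_of_real (Im v) * pdy g z - \<phi> z * v) =
        cnj ((1/2) * pdx g z + (\<i> / 2) * pdy g z) * v" by simp
    qed
    then show "\<exists>f'. (k has_field_derivative f') (at z)"
      unfolding has_field_derivative_def by blast
  qed
  show thesis
    by (rule that[OF h k _ hT hS]) (simp_all add: k_def hT T hS[simplified] S[simplified])
qed

theorem laplacian_pow_constant:
  assumes f: "smooth_on_H f" and growth: "moderate_growth f"
    and T: "\<And>z. z \<in> upper_half \<Longrightarrow> f (z + 1) = f z"
    and S: "\<And>z. z \<in> upper_half \<Longrightarrow> f (- 1 / z) = f z"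
    and zero: "\<And>z. z \<in> upper_half \<Longrightarrow> (hyp_laplacian 0 ^^ Suc m) f z = 0"
  obtains c where "\<And>z. z \<in> upper_half \<Longrightarrow> (hyp_laplacian 0 ^^ m) f z = c"
proof -
  define g where "g = (hyp_laplacian 0 ^^ m) f"
  have g: "smooth_on_H g" unfolding g_def by (rule smooth_on_H_laplacian_pow[OF f])
  have gz: "hyp_laplacian 0 g z = 0" if "z \<in> upper_half" for z
    using zero[OF that] by (simp add: g_def)
  have gT: "g (z + 1) = g z" if "z \<in> upper_half" for z
    unfolding g_def by (rule laplacian_pow_invariant(1)[OF f T S that])
  have gS: "g (- 1 / z) = g z" if "z \<in> upper_half" for z
    unfolding g_def by (rule laplacian_pow_invariant(2)[OF f T S that])
  obtain h k where h: "h holomorphic_on upper_half" and k: "k holomorphic_on upper_half"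
    and gh: "\<And>z. g z = h z + cnj (k z)"
    and hT: "\<And>z. z \<in> upper_half \<Longrightarrow> h (z + 1) = h z" and hS: "\<And>z. z \<in> upper_half \<Longrightarrow> h (- 1 / z) = h z"
    and kT: "\<And>z. z \<in> upper_half \<Longrightarrow> k (z + 1) = k z" and kS: "\<And>z. z \<in> upper_half \<Longrightarrow> k (- 1 / z) = k z"
    by (rule holomorphic_add_anti_decomposition[OF g gz gT gS]; (rule that)?; assumption)
  \<comment> \<open>Conjugation reverses frequencies: k enters the n-th coefficient of g through its
    (-n)-th.\<close>
  have coef: "fourier_coeff g n y = fourier_coeff h n y + cnj (fourier_coeff k (- n) y)" if "y > 0" for n y
  proof -
    note ih = integrable_horizontal[OF holomorphic_on_imp_continuous_on[OF h] that]
    note ik = integrable_horizontal[OF holomorphic_on_imp_continuous_on[OF k] that, of n]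
    have "fourier_coeff g n y = integral {0..1} (\<lambda>x. h (Complex x y) * cis1 (- n) x + cnj (k (Complex x y) * cis1 n x))"
      by (simp add: fourier_coeff_def gh distrib_right cis1_minus)
    also have "\<dots> = fourier_coeff h n y + integral {0..1} (\<lambda>x. cnj (k (Complex x y) * cis1 n x))"
      unfolding fourier_coeff_def
      by (rule Henstock_Kurzweil_Integration.integral_add[OF ih])
        (simp only: integrable_on_cnj_iff ik)
    finally show ?thesis by (simp only: integral_cnj[symmetric] fourier_coeff_def minus_minus)
  qed
  have neg: "fourier_coeff h n y = 0 \<and> fourier_coeff k n y = 0" if n: "n < 0" and y: "y > 0" for n y
  proof -
    obtain a1 where a1: "\<And>y. y > 0 \<Longrightarrow> fourier_coeff h n y = a1 * of_real (exp (- (2 * pi * of_int n) * y))"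
      by (rule fourier_coeff_holomorphic[OF h, where n = n], erule hT, rule that)
    obtain a2 where a2: "\<And>y. y > 0 \<Longrightarrow> fourier_coeff h (-n) y = a2 * of_real (exp (- (2 * pi * of_int (-n)) * y))"
      by (rule fourier_coeff_holomorphic[OF h, where n = "-n"], erule hT, rule that)
    obtain b1 where b1: "\<And>y. y > 0 \<Longrightarrow> fourier_coeff k n y = b1 * of_real (exp (- (2 * pi * of_int n) * y))"
      by (rule fourier_coeff_holomorphic[OF k, where n = n], erule kT, rule that)
    obtain b2 where b2: "\<And>y. y > 0 \<Longrightarrow> fourier_coeff k (-n) y = b2 * of_real (exp (- (2 * pi * of_int (-n)) * y))"
      by (rule fourier_coeff_holomorphic[OF k, where n = "-n"], erule kT, rule that)
    \<comment> \<open>For n < 0, a1 multiplies the growing exponential in the coefficient of g at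
      frequency n, and the conjugate of b1 the growing one at frequency -n.\<close>
    have "a1 = 0"
      by (rule fourier_coeff_exponential_part[OF f T growth, of n m _ "cnj b2"])
        (use n in \<open>simp_all add: g_def[symmetric] coef a1 b2\<close>)
    moreover have "cnj b1 = 0"
      by (rule fourier_coeff_exponential_part[OF f T growth, of "-n" m _ a2])
        (use n in \<open>simp_all add: g_def[symmetric] coef a2 b1\<close>)
    ultimately show ?thesis using a1 b1 y by simp
  qed
  obtain L where L: "\<And>e. e > 0 \<Longrightarrow> \<exists>Y. \<forall>z. Im z > Y \<longrightarrow> norm (h z - L) < e"
    by (rule holomorphic_cusp_limit[OF h hT]) (use neg in auto)
  obtain K where K: "\<And>e. e > 0 \<Longrightarrow> \<exists>Y. \<forall>z. Im z > Y \<longrightarrow> norm (k z - K) < e"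
    by (rule holomorphic_cusp_limit[OF k kT]) (use neg in auto)
  have "g z = L + cnj K" if z: "z \<in> upper_half" for z
  proof -
    have "h z = L" by (rule holomorphic_invariant_constant[OF h hT hS L z])
    moreover have "k z = K" by (rule holomorphic_invariant_constant[OF k kT kS K z])
    ultimately show ?thesis unfolding gh by simp
  qed
  then show thesis by (rule that[of "L + cnj K", folded g_def])
qed

section \<open>Functions holomorphic in three variables\<close>

text \<open>The coordinates \<open>x\<close>, \<open>y\<close> of the upper half-plane are complexified together with the parameter
  \<open>s\<close>. All partial derivatives are then controlled by Cauchy's estimates, so that a locally dominated
  sum or integral may be differentiated termwise to any order.\<close>
type_synonym c3 = "complex \<times> complex \<times> complex"

text \<open>The coordinate embeddings form a set, so that each fact about partial derivatives is
  proved once for all three directions.\<close>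

definition axes :: "(complex \<Rightarrow> c3) set" where
  "axes = {\<lambda>t. (t, 0, 0), \<lambda>t. (0, t, 0), \<lambda>t. (0, 0, t)}"

lemma axes_add: "A \<in> axes \<Longrightarrow> A (s + t) = A s + A t"
  and axes_0: "A \<in> axes \<Longrightarrow> A 0 = 0"
  and axes_norm: "A \<in> axes \<Longrightarrow> norm (A t) = norm t"
  by (auto simp: axes_def norm_prod_def zero_prod_def)

lemma axes_continuous: "A \<in> axes \<Longrightarrow> continuous_on S f \<Longrightarrow> continuous_on S (\<lambda>x. A (f x))"
  by (auto simp: axes_def intro!: continuous_intros)

text \<open>Separate holomorphy with joint continuity, on open sets the same as joint holomorphy by
  Osgood's lemma. Continuity is built in because Cauchy integrals that depend on parameters require
  it.\<close>

definition holomorphic3_on :: "(c3 \<Rightarrow> complex) \<Rightarrow> c3 set \<Rightarrow> bool" (infixl "(holomorphic3'_on)" 50) where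
  "u holomorphic3_on S \<longleftrightarrow>
     continuous_on S u \<and> (\<forall>A\<in>axes. \<forall>p\<in>S. (\<lambda>t. u (p + A t)) field_differentiable (at 0))"

definition pderiv3 :: "(complex \<Rightarrow> c3) \<Rightarrow> (c3 \<Rightarrow> complex) \<Rightarrow> c3 \<Rightarrow> complex" where
  "pderiv3 A u p = deriv (\<lambda>t. u (p + A t)) 0"

lemma holomorphic3_on_subset: "u holomorphic3_on S \<Longrightarrow> T \<subseteq> S \<Longrightarrow> u holomorphic3_on T"
  unfolding holomorphic3_on_def by (auto intro: continuous_on_subset)

lemma pderiv3_slice:
  assumes u: "u holomorphic3_on S" and A: "A \<in> axes" and p: "p + A t \<in> S"
  shows "((\<lambda>t. u (p + A t)) has_field_derivative pderiv3 A u (p + A t)) (at t)"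
proof -
  have "(\<lambda>s. u (p + A t + A s)) field_differentiable (at 0)"
    using u A p unfolding holomorphic3_on_def by blast
  then have "((\<lambda>s. u (p + A t + A s)) has_field_derivative pderiv3 A u (p + A t)) (at 0)"
    unfolding pderiv3_def by (simp add: DERIV_deriv_iff_field_differentiable)
  then have "((\<lambda>s. u (p + A (s + t))) has_field_derivative pderiv3 A u (p + A t)) (at 0)"
    by (simp add: axes_add[OF A] add_ac)
  then show ?thesis using DERIV_shift[of "\<lambda>t. u (p + A t)" "pderiv3 A u (p + A t)" 0 t] by simp
qed

lemma pderiv3_eqI:
  assumes "((\<lambda>t. u (p + A t)) has_field_derivative D) (at 0)"
  shows "pderiv3 A u p = D"
  unfolding pderiv3_def by (rule DERIV_imp_deriv[OF assms])

text \<open>Cauchy's formula for the first derivative on a circle of radius r, written over the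
  angle so that theorems on real parameter integrals apply.\<close>

lemma has_integral_pderiv3:
  assumes u: "u holomorphic3_on S" and A: "A \<in> axes" and r: "r > 0"
    and sub: "\<And>t. norm t \<le> r \<Longrightarrow> p + A t \<in> S"
  shows "((\<lambda>\<theta>. u (p + A (of_real r * cis \<theta>)) / (2 * pi * (of_real r * cis \<theta>))) has_integral pderiv3 A u p) {0..2*pi}"
proof -
  let ?f = "\<lambda>t. u (p + A t)"
  have cont: "continuous_on (cball 0 r) ?f"
    by (rule continuous_on_compose2[of S u]) (use u sub in \<open>auto simp: holomorphic3_on_def intro!: continuous_intros axes_continuous[OF A]\<close>)
  have hol: "?f holomorphic_on ball 0 r"
    unfolding holomorphic_on_open[OF open_ball]
  proof
    fix t :: complex assume "t \<in> ball 0 r"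
    then have "norm t \<le> r" by simp
    from pderiv3_slice[OF u A sub[OF this]] show "\<exists>f'. (?f has_field_derivative f') (at t)" by (rule exI)
  qed
  have "((\<lambda>t. ?f t / (t - 0) ^ Suc 1) has_contour_integral ((2 * pi * \<i>) / fact 1 * (deriv ^^ 1) ?f 0)) (circlepath 0 r)"
    by (rule Cauchy_has_contour_integral_higher_derivative_circlepath[OF cont hol]) (use r in simp)
  then have "((\<lambda>t. ?f t / t ^ 2) has_contour_integral (2 * pi * \<i> * pderiv3 A u p)) (part_circlepath 0 r 0 (2 * pi))"
    by (simp add: pderiv3_def circlepath_def numeral_2_eq_2)
  then have "((\<lambda>t. ?f (0 + r * cis t) / (0 + r * cis t) ^ 2 * r * \<i> * cis t) has_integral (2 * pi * \<i> * pderiv3 A u p)) {0..2*pi}"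
    by (subst (asm) has_contour_integral_part_circlepath_iff) simp_all
  from has_integral_mult_right[OF this, of "1 / (2 * pi * \<i>)"] r
  show ?thesis by (simp add: field_simps power2_eq_square)
qed

lemma norm_pderiv3_le:
  assumes u: "u holomorphic3_on S" and A: "A \<in> axes" and r: "r > 0"
    and sub: "\<And>t. norm t \<le> r \<Longrightarrow> p + A t \<in> S" and B: "\<And>t. norm t \<le> r \<Longrightarrow> norm (u (p + A t)) \<le> B"
  shows "norm (pderiv3 A u p) \<le> B / r"
proof -
  have B0: "B \<ge> 0" by (rule order_trans[OF norm_ge_zero B[of 0]]) (use r in simp)
  have "norm (pderiv3 A u p) \<le> B / (2 * pi * r) * measure lborel (cbox 0 (2 * pi))"
  proof (rule has_integral_bound[of _ "\<lambda>\<theta>. u (p + A (of_real r * cis \<theta>)) / (2 * pi * (of_real r * cis \<theta>))"])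
    show "((\<lambda>\<theta>. u (p + A (of_real r * cis \<theta>)) / (2 * pi * (of_real r * cis \<theta>))) has_integral pderiv3 A u p) (cbox 0 (2 * pi))"
      unfolding cbox_interval by (rule has_integral_pderiv3[OF u A r sub])
    show "norm (u (p + A (of_real r * cis \<theta>)) / (2 * pi * (of_real r * cis \<theta>))) \<le> B / (2 * pi * r)" for \<theta>
      using r B[of "of_real r * cis \<theta>"] by (simp add: norm_divide norm_mult divide_right_mono)
  qed (use B0 r in simp)
  then show ?thesis using r by simp
qed

lemma axes_ball:
  assumes "A \<in> axes" "q \<in> ball p r" "norm t \<le> s"
  shows "q + A t \<in> ball p (r + s)"
  using assms(2,3) axes_norm[OF assms(1), of t] norm_triangle_ineq4[of "p - q" "A t"]
  by (simp add: dist_norm algebra_simps)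

lemma axes_in:
  assumes "A \<in> axes" "ball p (r + s) \<subseteq> S" "q \<in> ball p r" "norm t \<le> s"
  shows "q + A t \<in> S"
  using axes_ball[OF assms(1,3,4)] assms(2) by blast

text \<open>The radius r + r leaves room to move the centre by less than r and still draw a circle
  of radius r around it.\<close>

lemma open_double_ball:
  fixes S :: "'a::metric_space set"
  assumes "open S" "p \<in> S"
  obtains r where "r > 0" "ball p (r + r) \<subseteq> S"
proof -
  obtain e where "e > 0" "ball p e \<subseteq> S" using openE[OF assms] by blast
  then show thesis by (intro that[of "e / 2"]) auto
qed

text \<open>The A-derivative is a Cauchy integral; differentiating under it in direction B gives the
  Cauchy integral of the B-derivative. This shows at once that the class is closed under
  differentiation and that the derivatives commute.\<close>

lemma holomorphic3_on_pderiv3: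
  assumes u: "u holomorphic3_on S" and S: "open S" and A: "A \<in> axes"
  shows "pderiv3 A u holomorphic3_on S"
    and "\<And>B p. B \<in> axes \<Longrightarrow> p \<in> S \<Longrightarrow> pderiv3 B (pderiv3 A u) p = pderiv3 A (pderiv3 B u) p"
proof -
  have cu: "continuous_on S u" using u by (simp add: holomorphic3_on_def)
  have cont: "continuous_on S (pderiv3 A u)" if "A \<in> axes" for A
  proof (rule continuous_at_imp_continuous_on, rule ballI)
    fix p assume "p \<in> S"
    obtain r where r: "r > 0" "ball p (r + r) \<subseteq> S"
      by (rule open_double_ball[OF S \<open>p \<in> S\<close>])
    have "continuous_on (ball p r \<times> cbox 0 (2*pi)) (\<lambda>(q, \<theta>). u (q + A (of_real r * cis \<theta>)) / (2 * pi * (of_real r * cis \<theta>)))"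
      unfolding case_prod_unfold
    proof (intro continuous_intros continuous_on_compose2[OF cu] axes_continuous[OF that])
      show "(\<lambda>x. fst x + A (complex_of_real r * cis (snd x))) ` (ball p r \<times> cbox 0 (2 * pi)) \<subseteq> S"
        using axes_ball[OF that, of _ p r _ r] r by (auto simp: norm_mult)
    qed (use r in auto)
    from integral_continuous_on_param[OF this]
    have "continuous_on (ball p r) (pderiv3 A u)"
    proof (rule continuous_on_eq)
      fix q assume q: "q \<in> ball p r"
      have "((\<lambda>\<theta>. u (q + A (of_real r * cis \<theta>)) / (2 * pi * (of_real r * cis \<theta>))) has_integral pderiv3 A u q) {0..2*pi}"
        by (rule has_integral_pderiv3[OF u that r(1)]) (rule axes_in[OF that r(2) q])
      then show "integral (cbox 0 (2*pi)) (\<lambda>\<theta>. u (q + A (of_real r * cis \<theta>)) / (2 * pi * (of_real r * cis \<theta>))) = pderiv3 A u q"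
        by (simp add: has_integral_iff)
    qed
    then show "isCont (pderiv3 A u) p" using r(1) by (simp add: continuous_on_eq_continuous_at)
  qed
  have deriv: "((\<lambda>t. pderiv3 A u (p + B t)) has_field_derivative
      integral {0..2*pi} (\<lambda>\<theta>. pderiv3 B u (p + A (of_real r * cis \<theta>)) / (2 * pi * (of_real r * cis \<theta>)))) (at 0)"
    if A: "A \<in> axes" and B: "B \<in> axes" and r: "r > 0" "ball p (r + r) \<subseteq> S" for A B p r
  proof -
    define c where "c = (\<lambda>\<theta>. complex_of_real r * cis \<theta>)"
    have c: "norm (c \<theta>) = r" "c \<theta> \<noteq> 0" for \<theta> using r by (auto simp: c_def norm_mult)
    have cc: "continuous_on X (\<lambda>x. c (f x))" if "continuous_on X f" for f :: "complex \<times> real \<Rightarrow> real" and X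
      unfolding c_def by (intro continuous_intros that)
    have Bt: "p + B t \<in> ball p r" if "t \<in> ball 0 r" for t
      using that axes_norm[OF B, of t] by (simp add: dist_norm)
    have inS: "p + B t + A (c \<theta>) \<in> S" if "t \<in> ball 0 r" for t \<theta>
      using axes_ball[OF A Bt[OF that], of "c \<theta>" r] r c by auto
    have repr: "((\<lambda>\<theta>. u (p + B t + A (c \<theta>)) / (2 * pi * c \<theta>)) has_integral pderiv3 A u (p + B t)) {0..2*pi}" if t: "t \<in> ball 0 r" for t
      unfolding c_def by (rule has_integral_pderiv3[OF u A r(1)]) (rule axes_in[OF A r(2) Bt[OF t]])
    have "((\<lambda>t. integral (cbox 0 (2*pi)) (\<lambda>\<theta>. u (p + B t + A (c \<theta>)) / (2 * pi * c \<theta>))) has_field_derivative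
        integral (cbox 0 (2*pi)) (\<lambda>\<theta>. pderiv3 B u (p + B 0 + A (c \<theta>)) / (2 * pi * c \<theta>))) (at 0 within ball 0 r)"
    proof (rule leibniz_rule_field_derivative[where fx = "\<lambda>t \<theta>. pderiv3 B u (p + B t + A (c \<theta>)) / (2 * pi * c \<theta>)"])
      fix t :: complex and \<theta> :: real assume t: "t \<in> ball 0 r"
      have "((\<lambda>t. u ((p + A (c \<theta>)) + B t)) has_field_derivative pderiv3 B u ((p + A (c \<theta>)) + B t)) (at t)"
        by (rule pderiv3_slice[OF u B]) (use inS[OF t] in \<open>simp add: add_ac\<close>)
      moreover have "p + A (c \<theta>) + B t = p + B t + A (c \<theta>)" for t by (simp add: add_ac)
      ultimately have "((\<lambda>t. u (p + B t + A (c \<theta>))) has_field_derivative pderiv3 B u (p + B t + A (c \<theta>))) (at t)"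
        by (simp only:)
      from has_field_derivative_at_within[OF DERIV_cdivide[OF this]]
      show "((\<lambda>t. u (p + B t + A (c \<theta>)) / (2 * pi * c \<theta>)) has_field_derivative
          pderiv3 B u (p + B t + A (c \<theta>)) / (2 * pi * c \<theta>)) (at t within ball 0 r)" .
      show "(\<lambda>\<theta>. u (p + B t + A (c \<theta>)) / (2 * pi * c \<theta>)) integrable_on cbox 0 (2 * pi)"
        using has_integral_integrable[OF repr[OF t]] by simp
    next
      show "continuous_on (ball 0 r \<times> cbox 0 (2 * pi)) (\<lambda>(t, \<theta>). pderiv3 B u (p + B t + A (c \<theta>)) / (2 * pi * c \<theta>))"
        unfolding case_prod_unfold
        by (intro continuous_intros continuous_on_compose2[OF cont[OF B]] axes_continuous[OF A] axes_continuous[OF B] cc)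
          (use inS c in auto)
    qed (use r in auto)
    moreover have "at 0 within ball 0 r = at (0::complex)" by (rule at_within_open) (use r in auto)
    ultimately have *: "((\<lambda>t. integral (cbox 0 (2*pi)) (\<lambda>\<theta>. u (p + B t + A (c \<theta>)) / (2 * pi * c \<theta>))) has_field_derivative
        integral (cbox 0 (2*pi)) (\<lambda>\<theta>. pderiv3 B u (p + A (c \<theta>)) / (2 * pi * c \<theta>))) (at 0)"
      using axes_0[OF B] by simp
    have "((\<lambda>t. pderiv3 A u (p + B t)) has_field_derivative
        integral (cbox 0 (2*pi)) (\<lambda>\<theta>. pderiv3 B u (p + A (c \<theta>)) / (2 * pi * c \<theta>))) (at 0)"
      by (rule has_field_derivative_transform_within_open[OF *, where S = "ball 0 r"])
        (use r repr in \<open>simp_all add: has_integral_iff\<close>)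
    then show ?thesis by (simp add: c_def)
  qed
  have hol: "pderiv3 A u holomorphic3_on S" if A: "A \<in> axes" for A
    unfolding holomorphic3_on_def
  proof (intro conjI ballI cont[OF A])
    fix B p assume B: "B \<in> axes" and "p \<in> S"
    obtain r where r: "r > 0" "ball p (r + r) \<subseteq> S"
      by (rule open_double_ball[OF S \<open>p \<in> S\<close>])
    from deriv[OF A B r] show "(\<lambda>t. pderiv3 A u (p + B t)) field_differentiable at 0"
      unfolding field_differentiable_def by blast
  qed
  show "pderiv3 A u holomorphic3_on S" by (rule hol[OF A])
  fix B p assume B: "B \<in> axes" and p: "p \<in> S"
  obtain r where r: "r > 0" "ball p (r + r) \<subseteq> S"
    by (rule open_double_ball[OF S \<open>p \<in> S\<close>])
  have "((\<lambda>\<theta>. pderiv3 B u (p + A (of_real r * cis \<theta>)) / (2 * pi * (of_real r * cis \<theta>))) has_integral pderiv3 A (pderiv3 B u) p) {0..2*pi}"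
    by (rule has_integral_pderiv3[OF hol[OF B] A r(1)]) (use r axes_ball[OF A, of p p r _ r] in auto)
  moreover have "pderiv3 B (pderiv3 A u) p = integral {0..2*pi} (\<lambda>\<theta>. pderiv3 B u (p + A (of_real r * cis \<theta>)) / (2 * pi * (of_real r * cis \<theta>)))"
    by (rule pderiv3_eqI[OF deriv[OF A B r]])
  ultimately show "pderiv3 B (pderiv3 A u) p = pderiv3 A (pderiv3 B u) p" by (simp add: has_integral_iff)
qed

text \<open>Only the functions themselves are dominated: by Cauchy's estimate a bound g on a ball
  gives the bound g / r for difference quotients on a ball of half the radius r, and dominated
  convergence does the rest. The measure is arbitrary, so that integrals over t and lattice sums, as
  integrals for the counting measure, are treated alike.\<close>

lemma
  fixes f :: "'a \<Rightarrow> c3 \<Rightarrow> complex"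
  assumes S: "open S" and hol: "\<And>t. t \<in> space M \<Longrightarrow> f t holomorphic3_on S"
    and meas: "\<And>p. p \<in> S \<Longrightarrow> (\<lambda>t. f t p) \<in> borel_measurable M"
    and dom: "\<And>p. p \<in> S \<Longrightarrow> \<exists>r>0. \<exists>g. ball p r \<subseteq> S \<and> integrable M g \<and>
      (\<forall>q\<in>ball p r. \<forall>t\<in>space M. norm (f t q) \<le> g t)"
  shows holomorphic3_on_integral: "(\<lambda>p. \<integral>t. f t p \<partial>M) holomorphic3_on S"
    and pderiv3_integral: "\<And>A p. A \<in> axes \<Longrightarrow> p \<in> S \<Longrightarrow>
      pderiv3 A (\<lambda>p. \<integral>t. f t p \<partial>M) p = (\<integral>t. pderiv3 A (f t) p \<partial>M)"
proof -
  define I where "I = (\<lambda>p. \<integral>t. f t p \<partial>M)"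
  have cont: "continuous_on S I"
  proof (rule continuous_at_imp_continuous_on, rule ballI)
    fix p assume p: "p \<in> S"
    from dom[OF p] obtain r g where r: "r > 0" "ball p r \<subseteq> S" "integrable M g"
      and g: "\<And>q t. q \<in> ball p r \<Longrightarrow> t \<in> space M \<Longrightarrow> norm (f t q) \<le> g t" by blast
    have "continuous (at p within ball p r) I"
      unfolding continuous_within_sequentially
    proof (intro allI impI)
      fix x assume x: "(\<forall>n. x n \<in> ball p r) \<and> x \<longlonglongrightarrow> p"
      have "(\<lambda>n. \<integral>t. f t (x n) \<partial>M) \<longlonglongrightarrow> (\<integral>t. f t p \<partial>M)"
      proof (rule integral_dominated_convergence[OF meas[OF p] _ r(3)])
        show "(\<lambda>t. f t (x n)) \<in> borel_measurable M" for n using x r(2) by (intro meas) auto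
        show "AE t in M. (\<lambda>n. f t (x n)) \<longlonglongrightarrow> f t p"
        proof (rule AE_I2)
          fix t assume "t \<in> space M"
          then have "continuous_on S (f t)" using hol by (simp add: holomorphic3_on_def)
          then show "(\<lambda>n. f t (x n)) \<longlonglongrightarrow> f t p"
            by (rule continuous_on_tendsto_compose) (use x p r(2) in \<open>auto intro!: always_eventually\<close>)
        qed
        show "AE t in M. norm (f t (x n)) \<le> g t" for n using x g by (intro AE_I2) auto
      qed
      then show "(I \<circ> x) \<longlonglongrightarrow> I p" by (simp add: I_def o_def)
    qed
    then show "isCont I p" using at_within_open[of p "ball p r"] r(1) by simp
  qed
  have deriv: "((\<lambda>h. I (p + A h)) has_field_derivative (\<integral>t. pderiv3 A (f t) p \<partial>M)) (at 0)"
    if A: "A \<in> axes" and p: "p \<in> S" for A p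
  proof -
    from dom[OF p] obtain r' g where r': "r' > 0" "ball p r' \<subseteq> S" "integrable M g"
      and g': "\<And>q t. q \<in> ball p r' \<Longrightarrow> t \<in> space M \<Longrightarrow> norm (f t q) \<le> g t" by blast
    define r where "r = r' / 2"
    have r: "r > 0" "ball p (r + r) \<subseteq> S" using r' by (auto simp: r_def)
    have g: "norm (f t q) \<le> g t" if "q \<in> ball p (r + r)" "t \<in> space M" for q t
      using g'[of q t] that by (simp add: r_def)
    have pA: "p + A h \<in> ball p r" if "h \<in> ball 0 r" for h
      using that axes_norm[OF A, of h] by (simp add: dist_norm)
    have pAS: "p + A h \<in> S" "p + A h \<in> ball p (r + r)" if "h \<in> ball 0 r" for h
      using pA[OF that] r by auto
    have lip: "norm (f t (p + A h) - f t p) \<le> g t / r * norm h" if t: "t \<in> space M" and h: "h \<in> ball 0 r" for t h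
    proof -
      have "norm (f t (p + A h) - f t (p + A 0)) \<le> g t / r * norm (h - 0)"
      proof (rule field_differentiable_bound[OF convex_ball[of 0 r]])
        fix z :: complex assume z: "z \<in> ball 0 r"
        show "((\<lambda>z. f t (p + A z)) has_field_derivative pderiv3 A (f t) (p + A z)) (at z within ball 0 r)"
          by (rule has_field_derivative_at_within[OF pderiv3_slice[OF hol[OF t] A pAS(1)[OF z]]])
        show "norm (pderiv3 A (f t) (p + A z)) \<le> g t / r"
          by (rule norm_pderiv3_le[OF hol[OF t] A r(1)])
            (use axes_ball[OF A pA[OF z], of _ r] r g[OF _ t] in auto)
      qed (use h r in auto)
      then show ?thesis using axes_0[OF A] by simp
    qed
    have int: "integrable M (\<lambda>t. f t q)" if "q \<in> ball p (r + r)" for q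
      by (rule Bochner_Integration.integrable_bound[OF r'(3) meas]) (use that r g in \<open>auto intro!: AE_I2 order_trans[OF g]\<close>)
    have lim: "(\<lambda>n. (f t (p + A (X n)) - f t p) / X n) \<longlonglongrightarrow> pderiv3 A (f t) p"
      if t: "t \<in> space M" and X: "\<And>n. X n \<in> ball 0 r - {0}" "X \<longlonglongrightarrow> 0" for t X
    proof -
      have "((\<lambda>h. f t (p + A h)) has_field_derivative pderiv3 A (f t) (p + A 0)) (at 0)"
        by (rule pderiv3_slice[OF hol[OF t] A]) (use p axes_0[OF A] in simp)
      then have "((\<lambda>h. (f t (p + A h) - f t p) / h) \<longlongrightarrow> pderiv3 A (f t) p) (at 0 within UNIV)"
        using axes_0[OF A] unfolding has_field_derivative_iff by simp
      then show ?thesis unfolding tendsto_at_iff_sequentially o_def using X by auto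
    qed
    have "((\<lambda>h. (I (p + A h) - I (p + A 0)) / (h - 0)) \<longlongrightarrow> (\<integral>t. pderiv3 A (f t) p \<partial>M)) (at 0 within ball 0 r)"
      unfolding tendsto_at_iff_sequentially
    proof (intro allI impI)
      fix X :: "nat \<Rightarrow> complex" assume X: "\<forall>n. X n \<in> ball 0 r - {0}" "X \<longlonglongrightarrow> 0"
      have X1: "X n \<in> ball 0 r - {0}" for n using X by blast
      note limX = lim[OF _ X1 X(2)]
      have m: "(\<lambda>t. (f t (p + A (X n)) - f t p) / X n) \<in> borel_measurable M" for n
        using X pAS(1)[of "X n"] p by (intro borel_measurable_divide borel_measurable_diff meas) auto
      have "(\<lambda>n. \<integral>t. (f t (p + A (X n)) - f t p) / X n \<partial>M) \<longlonglongrightarrow> (\<integral>t. pderiv3 A (f t) p \<partial>M)"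
      proof (rule integral_dominated_convergence[where w = "\<lambda>t. g t / r"])
        \<comment> \<open>The derivative is measurable in t as a pointwise limit of difference
          quotients.\<close>
        show "(\<lambda>t. pderiv3 A (f t) p) \<in> borel_measurable M"
          by (rule borel_measurable_LIMSEQ_metric[OF m limX])
        show "integrable M (\<lambda>t. g t / r)" using r'(3) by simp
        show "AE t in M. (\<lambda>n. (f t (p + A (X n)) - f t p) / X n) \<longlonglongrightarrow> pderiv3 A (f t) p"
          by (intro AE_I2 limX)
        show "AE t in M. norm ((f t (p + A (X n)) - f t p) / X n) \<le> g t / r" for n
        proof (rule AE_I2)
          fix t assume "t \<in> space M"
          from lip[OF this, of "X n"] X show "norm ((f t (p + A (X n)) - f t p) / X n) \<le> g t / r"
            by (auto simp: norm_divide divide_le_eq)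
        qed
      qed (rule m)
      moreover have "(\<integral>t. (f t (p + A (X n)) - f t p) / X n \<partial>M) = (I (p + A (X n)) - I p) / X n" for n
      proof -
        have "X n \<in> ball 0 r" using X by blast
        then show ?thesis unfolding I_def using int[OF pAS(2)] int[of p] r
          by simp
      qed
      ultimately have "(\<lambda>n. (I (p + A (X n)) - I p) / X n) \<longlonglongrightarrow> (\<integral>t. pderiv3 A (f t) p \<partial>M)"
        by (simp only:)
      then show "((\<lambda>h. (I (p + A h) - I (p + A 0)) / (h - 0)) \<circ> X) \<longlonglongrightarrow> (\<integral>t. pderiv3 A (f t) p \<partial>M)"
        using axes_0[OF A] by (simp add: o_def)
    qed
    then show ?thesis unfolding has_field_derivative_iff
      using at_within_open[of "0::complex" "ball 0 r"] r by simp
  qed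
  show "(\<lambda>p. \<integral>t. f t p \<partial>M) holomorphic3_on S"
    unfolding I_def[symmetric] holomorphic3_on_def field_differentiable_def using cont deriv by blast
  show "pderiv3 A (\<lambda>p. \<integral>t. f t p \<partial>M) p = (\<integral>t. pderiv3 A (f t) p \<partial>M)" if "A \<in> axes" "p \<in> S" for A p
    unfolding I_def[symmetric] by (rule pderiv3_eqI[OF deriv[OF that]])
qed

section \<open>Closure properties of holomorphic functions of three variables\<close>

lemma pderiv3_DERIV:
  assumes "u holomorphic3_on S" "A \<in> axes" "p \<in> S"
  shows "((\<lambda>t. u (p + A t)) has_field_derivative pderiv3 A u p) (at 0)"
  using pderiv3_slice[OF assms(1,2), of p 0] assms(3) axes_0[OF assms(2)] by simp

lemma holomorphic3_onI:
  assumes "continuous_on S u"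
    "\<And>A p. A \<in> axes \<Longrightarrow> p \<in> S \<Longrightarrow> \<exists>D. ((\<lambda>t. u (p + A t)) has_field_derivative D) (at 0)"
  shows "u holomorphic3_on S"
  using assms unfolding holomorphic3_on_def field_differentiable_def by blast

lemma holomorphic3_on_const: "(\<lambda>p. c) holomorphic3_on S"
  by (rule holomorphic3_onI) (auto intro!: continuous_intros DERIV_const exI)

lemma holomorphic3_on_coord:
  "fst holomorphic3_on S" "(\<lambda>p. fst (snd p)) holomorphic3_on S" "(\<lambda>p. snd (snd p)) holomorphic3_on S"
proof -
  have id: "\<exists>D. ((\<lambda>t. c + t) has_field_derivative D) (at 0)" "\<exists>D. ((\<lambda>t. c) has_field_derivative D) (at 0)" for c :: complex
    by ((rule exI[of _ 1], auto intro!: derivative_eq_intros)[1]) (rule exI, rule DERIV_const)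
  show "fst holomorphic3_on S" "(\<lambda>p. fst (snd p)) holomorphic3_on S" "(\<lambda>p. snd (snd p)) holomorphic3_on S"
    by (rule holomorphic3_onI; auto simp: axes_def id intro!: continuous_intros)+
qed

lemma holomorphic3_on_add:
  assumes "u holomorphic3_on S" "v holomorphic3_on S"
  shows "(\<lambda>p. u p + v p) holomorphic3_on S"
proof (rule holomorphic3_onI)
  show "continuous_on S (\<lambda>p. u p + v p)"
    using assms by (auto simp: holomorphic3_on_def intro!: continuous_intros)
qed (rule exI, rule DERIV_add[OF pderiv3_DERIV[OF assms(1)] pderiv3_DERIV[OF assms(2)]])

lemma holomorphic3_on_mult:
  assumes "u holomorphic3_on S" "v holomorphic3_on S"
  shows "(\<lambda>p. u p * v p) holomorphic3_on S"
proof (rule holomorphic3_onI)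
  show "continuous_on S (\<lambda>p. u p * v p)"
    using assms by (auto simp: holomorphic3_on_def intro!: continuous_intros)
qed (rule exI, rule DERIV_mult[OF pderiv3_DERIV[OF assms(1)] pderiv3_DERIV[OF assms(2)]])

lemma holomorphic3_on_compose:
  assumes u: "u holomorphic3_on S" and g: "g holomorphic_on T" "open T" and sub: "\<And>p. p \<in> S \<Longrightarrow> u p \<in> T"
  shows "(\<lambda>p. g (u p)) holomorphic3_on S"
proof (rule holomorphic3_onI)
  show "continuous_on S (\<lambda>p. g (u p))"
    by (rule continuous_on_compose2[OF holomorphic_on_imp_continuous_on[OF g(1)]])
      (use u sub in \<open>auto simp: holomorphic3_on_def\<close>)
  fix A p assume A: "A \<in> axes" and p: "p \<in> S"
  have "(g has_field_derivative deriv g (u p)) (at (u (p + A 0)))"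
    using holomorphic_derivI[OF g sub[OF p]] axes_0[OF A] by simp
  from DERIV_chain2[OF this pderiv3_DERIV[OF u A p]]
  show "\<exists>D. ((\<lambda>t. g (u (p + A t))) has_field_derivative D) (at 0)" by blast
qed

section \<open>Restriction to the real points over the half-plane\<close>

definition real_slice :: "complex \<Rightarrow> (c3 \<Rightarrow> complex) \<Rightarrow> complex \<Rightarrow> complex" where
  "real_slice s u z = u (of_real (Re z), of_real (Im z), s)"

definition axis_x :: "complex \<Rightarrow> c3" where "axis_x = (\<lambda>t. (t, 0, 0))"
definition axis_y :: "complex \<Rightarrow> c3" where "axis_y = (\<lambda>t. (0, t, 0))"
definition axis_s :: "complex \<Rightarrow> c3" where "axis_s = (\<lambda>t. (0, 0, t))"

lemma axes_axis: "axis_x \<in> axes" "axis_y \<in> axes" "axis_s \<in> axes"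
  by (auto simp: axes_def axis_x_def axis_y_def axis_s_def)

text \<open>Existence of the partial derivatives and continuity of the one in y give total
  differentiability, on a small open rectangle around (Re z, Im z).\<close>

lemma has_derivative_real_slice:
  assumes u: "u holomorphic3_on S" and S: "open S" and z: "(of_real (Re z), of_real (Im z), s) \<in> S"
  shows "(real_slice s u has_derivative (\<lambda>v. of_real (Re v) * real_slice s (pderiv3 axis_x u) z
     + of_real (Im v) * real_slice s (pderiv3 axis_y u) z)) (at z)"
proof -
  define x0 y0 where "x0 = Re z" and "y0 = Im z"
  obtain r where r: "r > 0" "ball (of_real x0, of_real y0, s) (r + r) \<subseteq> S"
    using open_double_ball[OF S z] unfolding x0_def y0_def by blast
  define X where "X = {x0 - r<..<x0 + r}"
  define Y where "Y = {y0 - r<..<y0 + r}"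
  have inS: "(of_real x, of_real y, s) \<in> S" if "x \<in> X" "y \<in> Y" for x y
  proof -
    have a: "(complex_of_real x0, complex_of_real y0, s) + axis_x (of_real (x - x0)) \<in> ball (of_real x0, of_real y0, s) r"
      using that(1) axes_norm[OF axes_axis(1), of "of_real (x - x0)"] by (auto simp: dist_norm X_def abs_less_iff simp flip: of_real_diff)
    have "((complex_of_real x0, complex_of_real y0, s) + axis_x (of_real (x - x0))) + axis_y (of_real (y - y0)) \<in> S"
      by (rule axes_in[OF axes_axis(2) r(2) a]) (use that(2) in \<open>auto simp: Y_def simp flip: of_real_diff\<close>)
    then show ?thesis by (simp add: axis_x_def axis_y_def)
  qed
  have x0: "x0 \<in> X" and y0: "y0 \<in> Y" using r by (auto simp: X_def Y_def)
  let ?f = "\<lambda>x y. u (of_real x, of_real y, s)"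
  let ?dx = "pderiv3 axis_x u (of_real x0, of_real y0, s)"
  let ?dy = "\<lambda>x y. pderiv3 axis_y u (of_real x, of_real y, s)"
  have "((\<lambda>(x, y). ?f x y) has_derivative (\<lambda>(tx, ty). tx *\<^sub>R ?dx + blinfun_scaleR_left (?dy x0 y0) ty)) (at (x0, y0) within X \<times> Y)"
  proof (rule has_derivative_partialsI[where fy = "\<lambda>x y. blinfun_scaleR_left (?dy x y)"])
    have "((\<lambda>t. u ((0, of_real y0, s) + axis_x t)) has_field_derivative ?dx) (at (of_real x0))"
      using pderiv3_slice[OF u axes_axis(1), of "(0, of_real y0, s)" "of_real x0"] inS[OF x0 y0] by (simp add: axis_x_def)
    from has_vector_derivative_real_field[OF this]
    show "((\<lambda>x. ?f x y0) has_derivative (\<lambda>tx. tx *\<^sub>R ?dx)) (at x0 within X)"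
      by (simp add: axis_x_def has_vector_derivative_def)
    fix x y assume xy: "x \<in> X" "y \<in> Y"
    have "((\<lambda>t. u ((of_real x, 0, s) + axis_y t)) has_field_derivative ?dy x y) (at (of_real y))"
      using pderiv3_slice[OF u axes_axis(2), of "(of_real x, 0, s)" "of_real y"] inS[OF xy] by (simp add: axis_y_def)
    from has_vector_derivative_real_field[OF this]
    show "((\<lambda>y. ?f x y) has_derivative blinfun_apply (blinfun_scaleR_left (?dy x y))) (at y within Y)"
      by (simp add: axis_y_def has_vector_derivative_def)
  next
    have "continuous_on (X \<times> Y) (\<lambda>p. pderiv3 axis_y u (of_real (fst p), of_real (snd p), s))"
      by (rule continuous_on_compose2[of S "pderiv3 axis_y u"])
        (use holomorphic3_on_pderiv3(1)[OF u S axes_axis(2)] inS in \<open>auto simp: holomorphic3_on_def intro!: continuous_intros\<close>)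
    then have "continuous_on (X \<times> Y) (\<lambda>p. blinfun_scaleR_left (?dy (fst p) (snd p)))"
      by (intro continuous_intros)
    then show "continuous (at (x0, y0) within X \<times> Y) (\<lambda>(x, y). blinfun_scaleR_left (?dy x y))"
      using x0 y0 by (simp add: continuous_on_eq_continuous_within case_prod_unfold)
  qed (use y0 in \<open>auto simp: Y_def\<close>)
  moreover have "at (x0, y0) within X \<times> Y = at (x0, y0)"
    by (rule at_within_open) (use x0 y0 in \<open>auto simp: X_def Y_def intro: open_Times\<close>)
  ultimately have D: "((\<lambda>(x, y). ?f x y) has_derivative (\<lambda>(tx, ty). tx *\<^sub>R ?dx + ty *\<^sub>R ?dy x0 y0)) (at (Re z, Im z))"
    by (simp add: x0_def y0_def)
  have "((\<lambda>z. (Re z, Im z)) has_derivative (\<lambda>v. (Re v, Im v))) (at z)"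
    by (intro has_derivative_Pair has_derivative_Re has_derivative_Im has_derivative_ident)
  from has_derivative_compose[OF this D] show ?thesis
    by (simp add: real_slice_def[abs_def] scaleR_conv_of_real x0_def y0_def)
qed

lemma pd_real_slice:
  assumes "u holomorphic3_on S" "open S" "(of_real (Re z), of_real (Im z), s) \<in> S"
  shows "pdx (real_slice s u) z = real_slice s (pderiv3 axis_x u) z"
    "pdy (real_slice s u) z = real_slice s (pderiv3 axis_y u) z"
  using pd_eqI[OF has_derivative_real_slice[OF assms]] by simp_all

text \<open>On real slices \<open>pdx\<close> and \<open>pdy\<close> act as
  \<open>pderiv3 axis_x\<close> and \<open>pderiv3 axis_y\<close>, so the slices form a class closed
  under differentiation.\<close>

lemma smooth_on_H_real_slice:
  assumes u: "u holomorphic3_on S" and S: "open S"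
    and H: "\<And>z. z \<in> upper_half \<Longrightarrow> (of_real (Re z), of_real (Im z), s) \<in> S"
  shows "smooth_on_H (real_slice s u)"
proof (rule smooth_on_H_coinduct[where P = "\<lambda>f. \<exists>u. u holomorphic3_on S \<and> f = real_slice s u"])
  show "\<exists>u'. u' holomorphic3_on S \<and> real_slice s u = real_slice s u'" using u by (intro exI[of _ u]) simp
  fix f assume "\<exists>u. u holomorphic3_on S \<and> f = real_slice s u"
  then obtain u where u: "u holomorphic3_on S" and f: "f = real_slice s u" by (elim exE conjE)
  note pd = holomorphic3_on_pderiv3(1)[OF u S]
  show "(\<forall>z\<in>upper_half. f differentiable at z) \<and>
         (\<exists>g. (\<exists>u. u holomorphic3_on S \<and> g = real_slice s u) \<and> (\<forall>z\<in>upper_half. pdx f z = g z)) \<and>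
         (\<exists>g. (\<exists>u. u holomorphic3_on S \<and> g = real_slice s u) \<and> (\<forall>z\<in>upper_half. pdy f z = g z))"
  proof (intro conjI ballI)
    fix z assume z: "z \<in> upper_half"
    show "f differentiable at z"
      unfolding f differentiable_def by (rule exI) (rule has_derivative_real_slice[OF u S H[OF z]])
  next
    show "\<exists>g. (\<exists>u. u holomorphic3_on S \<and> g = real_slice s u) \<and> (\<forall>z\<in>upper_half. pdx f z = g z)"
      by (rule exI[of _ "real_slice s (pderiv3 axis_x u)"], rule conjI, rule exI, rule conjI, rule pd[OF axes_axis(1)])
        (auto simp: f pd_real_slice[OF u S H])
    show "\<exists>g. (\<exists>u. u holomorphic3_on S \<and> g = real_slice s u) \<and> (\<forall>z\<in>upper_half. pdy f z = g z)"
      by (rule exI[of _ "real_slice s (pderiv3 axis_y u)"], rule conjI, rule exI, rule conjI, rule pd[OF axes_axis(2)])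
        (auto simp: f pd_real_slice[OF u S H])
  qed
qed

lemma laplacian_real_slice:
  assumes u: "u holomorphic3_on S" and S: "open S"
    and H: "\<And>z. z \<in> upper_half \<Longrightarrow> (of_real (Re z), of_real (Im z), s) \<in> S" and z: "z \<in> upper_half"
  shows "hyp_laplacian 0 (real_slice s u) z = of_real (Im z) ^ 2 *
    (real_slice s (pderiv3 axis_x (pderiv3 axis_x u)) z + real_slice s (pderiv3 axis_y (pderiv3 axis_y u)) z)"
proof -
  have "pdx (pdx (real_slice s u)) z = pdx (real_slice s (pderiv3 axis_x u)) z"
    by (rule pd_cong(1)[OF _ z]) (rule pd_real_slice(1)[OF u S H])
  moreover have "pdy (pdy (real_slice s u)) z = pdy (real_slice s (pderiv3 axis_y u)) z"
    by (rule pd_cong(2)[OF _ z]) (rule pd_real_slice(2)[OF u S H])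
  ultimately show ?thesis
    using pd_real_slice[OF holomorphic3_on_pderiv3(1)[OF u S axes_axis(1)] S H[OF z]]
      pd_real_slice[OF holomorphic3_on_pderiv3(1)[OF u S axes_axis(2)] S H[OF z]]
    by (simp add: hyp_laplacian_def)
qed

section \<open>Poisson summation and the theta transformation\<close>

text \<open>The characteristic function of the standard normal distribution, with the variable
  rescaled by c = sqrt (2 \<pi> a).\<close>

lemma gaussian_fourier_transform:
  fixes a :: real and k :: int
  assumes a: "a > 0"
  defines "g \<equiv> \<lambda>x. of_real (exp (- pi * a * x^2)) * cis1 k x"
  shows "integrable lborel g" "(\<integral>x. g x \<partial>lborel) = of_real (exp (- pi * (of_int k)^2 / a) / sqrt a)"
proof -
  define c where "c = sqrt (2 * pi * a)"
  define t where "t = 2 * pi * of_int k / c"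
  have c: "c > 0" "c^2 = 2 * pi * a" using a by (auto simp: c_def)
  let ?h = "\<lambda>x. std_normal_density x *\<^sub>R iexp (t * x)"
  have gh: "?h (0 + c * x) = (1 / sqrt (2 * pi)) *\<^sub>R g x" for x
  proof -
    have "std_normal_density (c * x) = (1 / sqrt (2 * pi)) * exp (- pi * a * x^2)"
      unfolding std_normal_density_def power_mult_distrib c(2) by simp
    moreover have arg: "t * (0 + c * x) = 2 * pi * of_int k * x" using c by (simp add: t_def)
    moreover have "iexp (2 * pi * of_int k * x) = cis1 k x" by (simp add: cis1_def cis_conv_exp)
    ultimately show ?thesis unfolding arg by (simp add: g_def scaleR_conv_of_real)
  qed
  have h: "integrable lborel ?h"
  proof (rule Bochner_Integration.integrable_bound[where f = std_normal_density])
    show "integrable lborel std_normal_density" by simp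
  qed (auto simp: normal_density_nonneg)
  have "integrable lborel (\<lambda>x. ?h (0 + c * x))"
    by (rule lborel_integrable_real_affine[OF h]) (use c in simp)
  then have "integrable lborel (\<lambda>x. sqrt (2 * pi) *\<^sub>R ((1 / sqrt (2 * pi)) *\<^sub>R g x))"
    unfolding gh by (rule integrable_scaleR_right)
  then show "integrable lborel g" by simp
  have "complex_of_real (exp (- (t^2) / 2)) = (\<integral>x. iexp (t * x) \<partial>std_normal_distribution)"
    using fun_cong[OF char_std_normal_distribution, of t] by (simp add: char_def)
  also have "\<dots> = (\<integral>x. ?h x \<partial>lborel)"
    by (subst integral_density) (auto simp: normal_density_nonneg)
  also have "\<dots> = c *\<^sub>R (\<integral>x. ?h (0 + c * x) \<partial>lborel)"
    using lborel_integral_real_affine[of c ?h 0] c by simp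
  also have "\<dots> = (c / sqrt (2 * pi)) *\<^sub>R (\<integral>x. g x \<partial>lborel)"
    unfolding gh by simp
  also have "c / sqrt (2 * pi) = sqrt a" by (simp add: c_def real_sqrt_mult)
  finally have "sqrt a *\<^sub>R (\<integral>x. g x \<partial>lborel) = of_real (exp (- (t^2) / 2))" ..
  moreover have "- (t^2) / 2 = - pi * (of_int k)^2 / a"
    using a c by (simp add: t_def power_divide power_mult_distrib power2_eq_square field_simps)
  ultimately show "(\<integral>x. g x \<partial>lborel) = of_real (exp (- pi * (of_int k)^2 / a) / sqrt a)"
    using a by (simp add: scaleR_conv_of_real field_simps)
qed

lemma abs_le_square_int: "\<bar>real_of_int n\<bar> \<le> (real_of_int n)^2"
proof -
  have "\<bar>n\<bar> * 1 \<le> \<bar>n\<bar> * \<bar>n\<bar>" if "n \<noteq> 0" using that by (intro mult_left_mono) auto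
  then have "\<bar>n\<bar> \<le> \<bar>n\<bar> * \<bar>n\<bar>" by (cases "n = 0") auto
  then have "real_of_int \<bar>n\<bar> \<le> real_of_int (\<bar>n\<bar> * \<bar>n\<bar>)" by (simp only: of_int_le_iff)
  then show ?thesis by (simp add: power2_eq_square abs_mult_self)
qed

text \<open>From (n + x)^2 + x^2 \<ge> n^2 / 2 and n^2 \<ge> |n|. The bound is uniform in x and
  geometric in |n|.\<close>

lemma gaussian_translate_bound:
  fixes a x R :: real and n :: int
  assumes "a > 0" "\<bar>x\<bar> \<le> R"
  shows "exp (- pi * a * (of_int n + x)^2) \<le> exp (pi * a * R^2) * exp (- (pi * a / 2) * \<bar>of_int n\<bar>)"
proof -
  have "x^2 \<le> R^2" using assms(2) by (metis abs_ge_zero power2_abs power_mono)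
  moreover have "(of_int n + x)^2 + x^2 \<ge> (of_int n)^2 / 2"
    using zero_le_power2[of "of_int n + 2 * x"] by (simp add: power2_eq_square algebra_simps)
  moreover have "\<bar>real_of_int n\<bar> \<le> (real_of_int n)^2" by (rule abs_le_square_int)
  ultimately have "\<bar>real_of_int n\<bar> / 2 - R^2 \<le> (of_int n + x)^2" by simp
  then have "pi * a * (\<bar>real_of_int n\<bar> / 2 - R^2) \<le> pi * a * (of_int n + x)^2"
    using assms(1) by (intro mult_left_mono) auto
  then show ?thesis by (simp add: algebra_simps flip: exp_add)
qed

text \<open>The periodised Gaussian is continuous, and its k-th Fourier coefficient unfolds to the
  Fourier transform of the Gaussian on the whole line. These coefficients are summable, so
  \<open>fourier_series\<close> applies.\<close>

lemma gaussian_poisson_summation: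
  fixes a x :: real
  assumes a: "a > 0"
  shows "(\<Sum>\<^sub>\<infinity>n::int. complex_of_real (exp (- pi * a * (of_int n + x)^2)))
    = (\<Sum>\<^sub>\<infinity>k. of_real (exp (- pi * (of_int k)^2 / a) / sqrt a) * cis1 k x)"
proof -
  define G where "G = (\<lambda>x. complex_of_real (exp (- pi * a * x^2)))"
  define f where "f = (\<lambda>x. \<Sum>\<^sub>\<infinity>n::int. G (of_int n + x))"
  have G: "continuous_on A (\<lambda>x. G (h x))" if "continuous_on A h" for A and h :: "real \<Rightarrow> real"
    unfolding G_def by (intro continuous_intros that)
  have sumM: "(\<lambda>n. exp (pi * a * R^2) * exp (- (pi * a / 2) * \<bar>of_int n :: real\<bar>)) summable_on (UNIV :: int set)" for R
    using a by (intro summable_on_cmult_right summable_exp_minus_abs_int) simp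
  have unif: "uniform_limit {-R..R} (\<lambda>X x. \<Sum>n\<in>X. G (of_int n + x)) f (finite_subsets_at_top UNIV)" for R
    unfolding f_def
    by (rule Weierstrass_m_test_general[OF _ sumM[of R]]) (use gaussian_translate_bound[OF a] in \<open>auto simp: G_def\<close>)
  have cf: "continuous_on {-R..R} f" for R
    by (rule uniform_limit_theorem[OF _ unif]) (auto intro!: always_eventually continuous_intros G)
  have cfU: "continuous_on UNIV f"
  proof (rule continuous_at_imp_continuous_on, rule ballI)
    fix x :: real
    have "x \<in> interior {- (\<bar>x\<bar> + 1)..\<bar>x\<bar> + 1}" by (simp add: abs_less_iff) linarith
    with cf[of "\<bar>x\<bar> + 1"] show "isCont f x" using continuous_on_interior by blast
  qed
  have per: "f (x + 1) = f x" for x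
  proof -
    have "f (x + 1) = (\<Sum>\<^sub>\<infinity>n::int. G (of_int (n + 1) + x))" by (simp add: f_def add_ac)
    also have "\<dots> = f x" unfolding f_def
      by (rule infsum_reindex_bij_witness[where j = "\<lambda>n. n + 1" and i = "\<lambda>n. n - 1"]) auto
    finally show ?thesis .
  qed
  have coef: "integral {0..1} (\<lambda>x. f x * cis1 (- k) x) = of_real (exp (- pi * (of_int k)^2 / a) / sqrt a)" for k
  proof -
    define g where "g = (\<lambda>x. G x * cis1 (- k) x)"
    have gshift: "g (x + of_int n) = G (of_int n + x) * cis1 (- k) x" for n x
      using cis1_add_int[of "-k" x n] by (simp add: g_def add.commute)
    have gc: "continuous_on A (\<lambda>x. g (h x))" if "continuous_on A h" for A and h :: "real \<Rightarrow> real"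
      unfolding g_def by (intro continuous_intros G that continuous_on_compose2[OF continuous_on_cis1[of UNIV]]) auto
    have gi: "g integrable_on {c..d}" for c d
      by (intro integrable_continuous_real gc continuous_intros)
    have "uniform_limit {0..1} (\<lambda>X x. (\<Sum>n\<in>X. G (of_int n + x)) * cis1 (-k) x) (\<lambda>x. f x * cis1 (-k) x) (finite_subsets_at_top UNIV)"
    proof (rule uniform_lim_mult[OF uniform_limit_on_subset[OF unif[of 1]] uniform_limit_const])
      show "bounded (f ` {0..1})"
        by (intro compact_imp_bounded compact_continuous_image continuous_on_subset[OF cfU]) auto
      show "bounded (cis1 (-k) ` {0..1})" by (intro compact_imp_bounded compact_continuous_image continuous_intros) auto
    qed auto
    then obtain I J where IJ: "\<And>X. ((\<lambda>x. (\<Sum>n\<in>X. G (of_int n + x)) * cis1 (-k) x) has_integral I X) {0..1}"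
        "((\<lambda>x. f x * cis1 (-k) x) has_integral J) {0..1}" "(I \<longlongrightarrow> J) (finite_subsets_at_top UNIV)"
      by (rule uniform_limit_integral) (auto intro!: continuous_intros G)
    have piece: "((\<lambda>x. G (of_int n + x) * cis1 (-k) x) has_integral integral {of_int n..of_int n + 1} g) {0..1}" for n
    proof -
      have "(g has_integral integral {of_int n..of_int n + 1} g) {of_int n..of_int n + 1}"
        using gi by (rule integrable_integral)
      from has_integral_shift_real_ivl[OF this, of "of_int n"]
      have "((\<lambda>x. g (x + of_int n)) has_integral integral {of_int n..of_int n + 1} g) {0..1}" by simp
      then show ?thesis by (simp only: gshift)
    qed
    \<comment> \<open>The sum over -N \<le> n < N glues unit intervals into [-N, N]. Convergence
      along all finite sets is already known, so this one exhausting sequence identifies the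
      limit.\<close>
    have I: "I {- int N..<int N} = integral {- real N..real N} g" for N
    proof (induction N)
      case 0
      show ?case using IJ(1)[of "{}"] by (simp add: has_integral_iff)
    next
      case (Suc N)
      have I_sum: "I X = (\<Sum>n\<in>X. integral {of_int n..of_int n + 1} g)" if "finite X" for X
      proof (rule has_integral_unique[OF IJ(1)])
        show "((\<lambda>x. (\<Sum>n\<in>X. G (of_int n + x)) * cis1 (- k) x) has_integral (\<Sum>n\<in>X. integral {of_int n..of_int n + 1} g)) {0..1}"
          unfolding sum_distrib_right by (intro has_integral_sum that piece)
      qed
      have "{- int (Suc N)..<int (Suc N)} = insert (- int (Suc N)) (insert (int N) {- int N..<int N})" by auto
      then have "I {- int (Suc N)..<int (Suc N)} = integral {- real (Suc N)..- real (Suc N) + 1} g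
          + (integral {real N..real N + 1} g + I {- int N..<int N})"
        by (simp add: I_sum)
      also have "\<dots> = integral {- real (Suc N)..- real N} g + (integral {- real N..real N} g + integral {real N..real (Suc N)} g)"
        by (simp add: Suc add_ac)
      also have "integral {- real N..real N} g + integral {real N..real (Suc N)} g = integral {- real N..real (Suc N)} g"
        by (rule Henstock_Kurzweil_Integration.integral_combine[OF _ _ gi]) auto
      also have "integral {- real (Suc N)..- real N} g + \<dots> = integral {- real (Suc N)..real (Suc N)} g"
        by (rule Henstock_Kurzweil_Integration.integral_combine[OF _ _ gi]) auto
      finally show ?case .
    qed
    have filt: "filterlim (\<lambda>N. {- int N..<int N}) (finite_subsets_at_top UNIV) sequentially"
      unfolding filterlim_finite_subsets_at_top
    proof (intro allI impI)
      fix X :: "int set" assume X: "finite X \<and> X \<subseteq> UNIV"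
      define B where "B = Max (insert 0 (abs ` X))"
      have B: "\<bar>n\<bar> \<le> B" if "n \<in> X" for n
        unfolding B_def by (rule Max_ge) (use X that in auto)
      show "\<forall>\<^sub>F N in sequentially. finite {- int N..<int N} \<and> X \<subseteq> {- int N..<int N} \<and> {- int N..<int N} \<subseteq> UNIV"
        using eventually_ge_at_top[of "nat (B + 1)"]
        by eventually_elim (use B in \<open>fastforce\<close>)
    qed
    have "(\<lambda>N. I {- int N..<int N}) \<longlonglongrightarrow> J"
      by (rule filterlim_compose[OF IJ(3) filt])
    moreover have "(\<lambda>N. I {- int N..<int N}) \<longlonglongrightarrow> (\<integral>x. g x \<partial>lborel)"
    proof -
      have int: "integrable lborel g"
        using gaussian_fourier_transform(1)[OF a, of "-k"] by (simp add: g_def G_def)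
      have "(\<lambda>N. \<integral>x. indicator {- real N..real N} x *\<^sub>R g x \<partial>lborel) \<longlonglongrightarrow> (\<integral>x. g x \<partial>lborel)"
      proof (rule integral_dominated_convergence[OF _ _ integrable_norm[OF int]])
        show "AE x in lborel. (\<lambda>N. indicator {- real N..real N} x *\<^sub>R g x) \<longlonglongrightarrow> g x"
        proof (rule AE_I2)
          fix x :: real
          have "eventually (\<lambda>N. indicator {- real N..real N} x *\<^sub>R g x = g x) sequentially"
            using eventually_ge_at_top[of "nat \<lceil>\<bar>x\<bar>\<rceil>"]
          proof eventually_elim
            case (elim N)
            then have "\<bar>x\<bar> \<le> real N" by linarith
            then show ?case by (auto simp: abs_le_iff indicator_def)
          qed
          then show "(\<lambda>N. indicator {- real N..real N} x *\<^sub>R g x) \<longlonglongrightarrow> g x" by (rule tendsto_eventually)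
        qed
      qed (use int in \<open>auto simp: indicator_def\<close>)
      moreover have "(\<integral>x. indicator {- real N..real N} x *\<^sub>R g x \<partial>lborel) = integral {- real N..real N} g" for N
      proof -
        have "set_integrable lborel {- real N..real N} g"
          by (rule set_integrable_subset[of _ UNIV]) (use int in \<open>auto simp: set_integrable_def\<close>)
        from set_borel_integral_eq_integral(2)[OF this] show ?thesis by (simp add: set_lebesgue_integral_def)
      qed
      ultimately show ?thesis unfolding I by simp
    qed
    ultimately have "J = (\<integral>x. g x \<partial>lborel)" by (rule LIMSEQ_unique)
    also have "\<dots> = of_real (exp (- pi * (of_int k)^2 / a) / sqrt a)"
      using gaussian_fourier_transform(2)[OF a, of "-k"] by (simp add: g_def G_def)
    finally show ?thesis using IJ(2) by (simp add: has_integral_iff)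
  qed
  have "f x = (\<Sum>\<^sub>\<infinity>k. of_real (exp (- pi * (of_int k)^2 / a) / sqrt a) * cis1 k x)"
  proof (rule fourier_series[OF cfU per coef])
    have "(\<lambda>k. exp (pi * (1 / a) * 0^2) * exp (- (pi * (1 / a) / 2) * \<bar>of_int k :: real\<bar>) * (1 / sqrt a)) summable_on (UNIV :: int set)"
      using a by (intro summable_on_cmult_left summable_on_cmult_right summable_exp_minus_abs_int) simp
    then show "(\<lambda>k. norm (complex_of_real (exp (- pi * (of_int k)^2 / a) / sqrt a))) summable_on (UNIV :: int set)"
    proof (rule summable_on_comparison_test)
      fix k :: int
      show "norm (complex_of_real (exp (- pi * (of_int k)^2 / a) / sqrt a))
         \<le> exp (pi * (1 / a) * 0^2) * exp (- (pi * (1 / a) / 2) * \<bar>of_int k :: real\<bar>) * (1 / sqrt a)"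
        using gaussian_translate_bound[of "1 / a" 0 0 k] a
        by (simp add: norm_divide divide_right_mono)
    qed simp
  qed
  then show ?thesis by (simp add: f_def G_def)
qed

section \<open>The form |m z + n|^2 / Im z and its theta series\<close>

lemma summable_on_int_prod:
  fixes f g :: "int \<Rightarrow> real"
  assumes f: "f summable_on UNIV" "\<And>n. f n \<ge> 0" and g: "g summable_on UNIV" "\<And>n. g n \<ge> 0"
  shows "(\<lambda>p. f (fst p) * g (snd p)) summable_on UNIV"
proof -
  have "(\<lambda>p. f (fst p) * g (snd p)) summable_on Sigma UNIV (\<lambda>_. UNIV)"
  proof (rule summable_on_SigmaI)
    show "((\<lambda>y. f (fst (x, y)) * g (snd (x, y))) has_sum f x * infsum g UNIV) UNIV" for x
      using has_sum_cmult_right[OF has_sum_infsum[OF g(1)], of "f x"] by simp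
    show "(\<lambda>x. f x * infsum g UNIV) summable_on UNIV" by (rule summable_on_cmult_left[OF f(1)])
  qed (use f g in simp)
  then show ?thesis by simp
qed

lemma summable_exp_sum_squares:
  fixes b :: real
  assumes "b > 0"
  shows "(\<lambda>p::int \<times> int. exp (- b * ((of_int (fst p))^2 + (of_int (snd p))^2))) summable_on UNIV"
proof -
  have "(\<lambda>n::int. exp (- b * (of_int n)^2)) summable_on UNIV"
    by (rule summable_on_comparison_test[OF summable_exp_minus_abs_int[OF assms]])
      (use assms abs_le_square_int in auto)
  note * = summable_on_int_prod[OF this _ this]
  have "exp (- b * (x + y)) = exp (- b * x) * exp (- b * y)" for x y
    by (simp add: distrib_left flip: exp_add)
  then show ?thesis using * by simp
qed

text \<open>For the symmetric matrix S of the form, Cayley-Hamilton reads (tr S) S - (det S) I =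
  S^2, so the difference of the two sides is the squared length of S applied to (m, n).\<close>

lemma form_lower_bound:
  fixes a b c m n :: real
  shows "(a + c) * (a * m^2 + 2 * b * m * n + c * n^2) \<ge> (a * c - b^2) * (m^2 + n^2)"
proof -
  have "(a + c) * (a * m^2 + 2 * b * m * n + c * n^2) - (a * c - b^2) * (m^2 + n^2)
     = (a * m + b * n)^2 + (b * m + c * n)^2"
    by (simp add: power2_eq_square algebra_simps)
  then show ?thesis by (smt (verit) zero_le_power2)
qed

text \<open>This is |m z + n|^2 / Im z, a quadratic form of determinant 1 whose power with exponent
  -s is the general term of \<open>E0\<close>.\<close>

definition form_value :: "complex \<Rightarrow> int \<times> int \<Rightarrow> real" where
  "form_value z p = ((of_int (fst p) * Re z + of_int (snd p))^2 + (of_int (fst p) * Im z)^2) / Im z"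

text \<open>\<open>form_lower_bound\<close> for the form multiplied by Im z, which has determinant
  (Im z)^2.\<close>

lemma form_value_ge:
  assumes "Im z > 0"
  shows "form_value z p \<ge> Im z / ((Re z)^2 + (Im z)^2 + 1) * ((of_int (fst p))^2 + (of_int (snd p))^2)"
proof -
  define x y m n where "x = Re z" and "y = Im z" and "m = real_of_int (fst p)" and "n = real_of_int (snd p)"
  have y: "y > 0" using assms by (simp add: y_def)
  have D: "x^2 + y^2 + 1 > 0" by (smt (verit) zero_le_power2)
  have "((x^2 + y^2) + 1) * ((x^2 + y^2) * m^2 + 2 * x * m * n + 1 * n^2) \<ge> ((x^2 + y^2) * 1 - x^2) * (m^2 + n^2)"
    by (rule form_lower_bound)
  then have "(x^2 + y^2 + 1) * ((m * x + n)^2 + (m * y)^2) \<ge> y^2 * (m^2 + n^2)"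
    by (simp add: power2_eq_square algebra_simps)
  then have "y^2 * (m^2 + n^2) / (x^2 + y^2 + 1) \<le> (m * x + n)^2 + (m * y)^2"
    using D by (simp add: divide_le_eq mult.commute)
  then have "y^2 * (m^2 + n^2) / (x^2 + y^2 + 1) / y \<le> ((m * x + n)^2 + (m * y)^2) / y"
    using y by (intro divide_right_mono) auto
  then show ?thesis using y
    unfolding form_value_def x_def[symmetric] y_def[symmetric] m_def[symmetric] n_def[symmetric]
    by (simp add: power2_eq_square)
qed

lemma summable_theta:
  assumes z: "Im z > 0" and t: "t > 0"
  shows "(\<lambda>p. exp (- pi * t * form_value z p)) summable_on UNIV"
proof (rule summable_on_comparison_test)
  define c where "c = Im z / ((Re z)^2 + (Im z)^2 + 1)"
  have c: "c > 0" unfolding c_def using z by (intro divide_pos_pos) (auto intro: add_nonneg_pos)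
  show "(\<lambda>p::int \<times> int. exp (- (pi * t * c) * ((of_int (fst p))^2 + (of_int (snd p))^2))) summable_on UNIV"
    by (rule summable_exp_sum_squares) (use c t in simp)
  show "exp (- pi * t * form_value z p) \<le> exp (- (pi * t * c) * ((of_int (fst p))^2 + (of_int (snd p))^2))" for p
    using mult_left_mono[OF form_value_ge[OF z, of p], of "pi * t"] t by (simp add: c_def mult.assoc)
qed simp

text \<open>Poisson summation in n alone turns the theta series into a sum over (m, k) in which
  replacing t by 1/t amounts to exchanging m and k; the oscillating factor depends on the product m
  k only.\<close>

lemma theta_transformation:
  assumes z: "Im z > 0" and t: "t > 0"
  shows "(\<Sum>\<^sub>\<infinity>p. complex_of_real (exp (- pi * (1 / t) * form_value z p)))
     = of_real t * (\<Sum>\<^sub>\<infinity>p. complex_of_real (exp (- pi * t * form_value z p)))"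
proof -
  define x y where "x = Re z" and "y = Im z"
  have y: "y > 0" using z by (simp add: y_def)
  define s where "s = (\<lambda>t (p :: int \<times> int). complex_of_real (exp (- pi * t * y * (of_int (fst p))^2 - pi * y / t * (of_int (snd p))^2))
      * cis1 (snd p) (of_int (fst p) * x))"
  have T: "(\<Sum>\<^sub>\<infinity>p. complex_of_real (exp (- pi * t * form_value z p))) = of_real (1 / sqrt (t / y)) * (\<Sum>\<^sub>\<infinity>p. s t p)"
    if t: "t > 0" for t
  proof -
    have sumT: "(\<lambda>p. complex_of_real (exp (- pi * t * form_value z p))) summable_on Sigma UNIV (\<lambda>_. UNIV)"
      using summable_theta[OF z t] by (simp add: summable_on_of_real)
    have sums: "s t summable_on Sigma UNIV (\<lambda>_. UNIV)"
    proof (rule abs_summable_summable, rule summable_on_comparison_test)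
      define b where "b = pi * y * min t (1 / t)"
      have b: "b > 0" using t y by (simp add: b_def)
      have b1: "b \<le> pi * t * y" using y mult_left_mono[of "min t (1 / t)" t "pi * y"] by (simp add: b_def mult_ac)
      have b2: "b \<le> pi * y / t" using y mult_left_mono[of "min t (1 / t)" "1 / t" "pi * y"] by (simp add: b_def)
      show "(\<lambda>p::int \<times> int. exp (- b * ((of_int (fst p))^2 + (of_int (snd p))^2))) summable_on Sigma UNIV (\<lambda>_. UNIV)"
        using summable_exp_sum_squares[OF b] by simp
      show "norm (s t p) \<le> exp (- b * ((of_int (fst p))^2 + (of_int (snd p))^2))" for p
        using mult_right_mono[OF b1, of "(of_int (fst p))^2"] mult_right_mono[OF b2, of "(of_int (snd p))^2"]
        by (simp add: s_def norm_mult algebra_simps)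
    qed simp
    have "(\<Sum>\<^sub>\<infinity>p. complex_of_real (exp (- pi * t * form_value z p)))
        = (\<Sum>\<^sub>\<infinity>m. \<Sum>\<^sub>\<infinity>n. complex_of_real (exp (- pi * t * form_value z (m, n))))"
      using infsum_Sigma_banach[OF sumT] by simp
    also have "\<dots> = (\<Sum>\<^sub>\<infinity>m. \<Sum>\<^sub>\<infinity>k. of_real (1 / sqrt (t / y)) * s t (m, k))"
    proof (rule infsum_cong)
      fix m :: int
      have e: "complex_of_real (exp (- pi * t * form_value z (m, n))) =
          of_real (exp (- pi * t * y * (of_int m)^2)) * of_real (exp (- pi * (t / y) * (of_int n + of_int m * x)^2))" for n
        using y by (simp add: form_value_def x_def[symmetric] y_def[symmetric] power2_eq_square field_simps
            flip: of_real_mult exp_add)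
      have "(\<Sum>\<^sub>\<infinity>n. complex_of_real (exp (- pi * t * form_value z (m, n)))) =
         of_real (exp (- pi * t * y * (of_int m)^2)) * (\<Sum>\<^sub>\<infinity>n::int. complex_of_real (exp (- pi * (t / y) * (of_int n + of_int m * x)^2)))"
        unfolding e by (rule infsum_cmult_right')
      also have "(\<Sum>\<^sub>\<infinity>n::int. complex_of_real (exp (- pi * (t / y) * (of_int n + of_int m * x)^2)))
          = (\<Sum>\<^sub>\<infinity>k. of_real (exp (- pi * (of_int k)^2 / (t / y)) / sqrt (t / y)) * cis1 k (of_int m * x))"
        by (rule gaussian_poisson_summation) (use t y in simp)
      also have "of_real (exp (- pi * t * y * (of_int m)^2)) * \<dots> =
        (\<Sum>\<^sub>\<infinity>k. of_real (exp (- pi * t * y * (of_int m)^2)) * (of_real (exp (- pi * (of_int k)^2 / (t / y)) / sqrt (t / y)) * cis1 k (of_int m * x)))"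
        by (rule infsum_cmult_right'[symmetric])
      also have "\<dots> = (\<Sum>\<^sub>\<infinity>k. of_real (1 / sqrt (t / y)) * s t (m, k))"
      proof (rule infsum_cong)
        fix k :: int
        have "exp (- pi * t * y * (of_int m)^2 - pi * y / t * (of_int k)^2) = exp (- pi * t * y * (of_int m)^2) * exp (- pi * (of_int k)^2 / (t / y))"
          by (simp add: mult_ac flip: exp_add)
        then show "of_real (exp (- pi * t * y * (of_int m)^2)) * (of_real (exp (- pi * (of_int k)^2 / (t / y)) / sqrt (t / y)) * cis1 k (of_int m * x))
           = of_real (1 / sqrt (t / y)) * s t (m, k)"
          by (simp add: s_def mult_ac)
      qed
      finally show "(\<Sum>\<^sub>\<infinity>n. complex_of_real (exp (- pi * t * form_value z (m, n)))) = (\<Sum>\<^sub>\<infinity>k. of_real (1 / sqrt (t / y)) * s t (m, k))" .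
    qed
    also have "\<dots> = (\<Sum>\<^sub>\<infinity>p. of_real (1 / sqrt (t / y)) * s t p)"
      using infsum_Sigma_banach[OF summable_on_cmult_right[OF sums, of "of_real (1 / sqrt (t / y))"]] by simp
    also have "\<dots> = of_real (1 / sqrt (t / y)) * (\<Sum>\<^sub>\<infinity>p. s t p)" by (rule infsum_cmult_right')
    finally show ?thesis .
  qed
  have "(\<Sum>\<^sub>\<infinity>p. s (1 / t) p) = (\<Sum>\<^sub>\<infinity>p. s t p)"
  proof (rule infsum_reindex_bij_witness[where i = prod.swap and j = prod.swap])
    show "s t (prod.swap p) = s (1 / t) p" for p
      by (simp add: s_def cis1_def prod.swap_def algebra_simps)
  qed auto
  moreover have "1 / sqrt ((1 / t) / y) = t * (1 / sqrt (t / y))"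
  proof -
    have "sqrt t * sqrt t = t" using t by simp
    then show ?thesis using t y by (simp add: real_sqrt_divide real_sqrt_mult field_simps)
  qed
  ultimately show ?thesis using T[OF t] T[of "1 / t"] t by simp
qed

section \<open>The Mellin transform of the theta series\<close>

lemma powr_le_exp:
  fixes a b :: real
  assumes b: "b > 0"
  obtains C where "C > 0" "\<And>u. u \<ge> 1 \<Longrightarrow> u powr a \<le> C * exp (b * u)"
proof -
  have "((\<lambda>u. u powr c / exp (b * u)) \<longlongrightarrow> 0) at_top" if "c \<ge> 0" for c
    using b that by real_asymp
  from order_tendstoD(2)[OF this[of "\<bar>a\<bar>"], of 1] obtain U where U: "\<And>u. u \<ge> U \<Longrightarrow> u powr \<bar>a\<bar> / exp (b * u) < 1"
    by (auto simp: eventually_at_top_linorder)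
  define C where "C = 1 + max U 1 powr \<bar>a\<bar>"
  show thesis
  proof (rule that[of C])
    show "C > 0" unfolding C_def by (intro add_pos_nonneg) auto
    fix u :: real assume u: "u \<ge> 1"
    have "u powr a \<le> u powr \<bar>a\<bar>" using u by (intro powr_mono) auto
    also have "\<dots> \<le> C * exp (b * u)"
    proof (cases "u \<ge> U")
      case True
      then have "u powr \<bar>a\<bar> \<le> 1 * exp (b * u)" using U[of u] by (simp add: divide_less_eq)
      also have "\<dots> \<le> C * exp (b * u)" by (intro mult_right_mono) (auto simp: C_def)
      finally show ?thesis .
    next
      case False
      then have "u powr \<bar>a\<bar> \<le> max U 1 powr \<bar>a\<bar>" using u by (intro powr_mono2) auto
      also have "\<dots> \<le> C * 1" by (simp add: C_def)
      also have "\<dots> \<le> C * exp (b * u)" using b u \<open>C > 0\<close> by (intro mult_left_mono) auto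
      finally show ?thesis .
    qed
    finally show "u powr a \<le> C * exp (b * u)" .
  qed
qed

text \<open>The passage from gauge integrals to Bochner integrals. Absolute integrability refers to
  the completed measure; Borel measurability of the integrand brings it back to
  \<open>lborel\<close>.\<close>

lemma has_bochner_integral_lborelI:
  fixes f :: "real \<Rightarrow> complex"
  assumes "f absolutely_integrable_on S" "(f has_integral I) S" "(\<lambda>t. indicator S t *\<^sub>R f t) \<in> borel_measurable borel"
  shows "has_bochner_integral lborel (\<lambda>t. indicator S t *\<^sub>R f t) I"
proof -
  have i: "integrable lborel (\<lambda>t. indicator S t *\<^sub>R f t)"
    using assms(1,3) integrable_completion[of "\<lambda>t. indicator S t *\<^sub>R f t" lborel] by (simp add: set_integrable_def)
  then have "((\<lambda>t. indicator S t *\<^sub>R f t) has_integral (\<integral>t. indicator S t *\<^sub>R f t \<partial>lborel)) UNIV"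
    by (rule has_integral_integral_lborel)
  moreover have "((\<lambda>t. indicator S t *\<^sub>R f t) has_integral I) UNIV"
  proof -
    have "(\<lambda>t. indicator S t *\<^sub>R f t) = (\<lambda>t. if t \<in> S then f t else 0)" by (auto simp: indicator_def)
    then show ?thesis using has_integral_restrict_UNIV[of S f I] assms(2) by simp
  qed
  ultimately show ?thesis using i has_integral_unique by (auto simp: has_bochner_integral_iff)
qed

text \<open>Euler's integral with w t substituted for t.\<close>

lemma gamma_integral_scaled:
  fixes w :: real and s :: complex
  assumes w: "w > 0" and s: "Re s > 0"
  shows "has_bochner_integral lborel (\<lambda>t. indicator {0<..} t *\<^sub>R (of_real t powr (s - 1) * of_real (exp (- w * t))))
     (Gamma s * of_real w powr (- s))"
proof -
  let ?f = "\<lambda>t. of_real t powr (s - 1) / of_real (exp t) :: complex"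
  have h: "has_bochner_integral lborel (\<lambda>t. indicator {0<..} t *\<^sub>R ?f t) (Gamma s)"
    by (rule has_bochner_integral_lborelI[OF absolutely_integrable_Gamma_integral'[OF s] Gamma_integral_complex'[OF s]]) measurable
  have "has_bochner_integral lborel (\<lambda>t. indicator {0<..} (0 + w * t) *\<^sub>R ?f (0 + w * t)) (Gamma s /\<^sub>R \<bar>w\<bar>)"
    using h w by (subst (asm) lborel_has_bochner_integral_real_affine_iff[of w _ _ 0]) auto
  from has_bochner_integral_mult_right[OF this, of "of_real w powr (1 - s)"]
  have "has_bochner_integral lborel (\<lambda>t. of_real w powr (1 - s) * (indicator {0<..} (0 + w * t) *\<^sub>R ?f (0 + w * t)))
      (of_real w powr (1 - s) * (Gamma s /\<^sub>R \<bar>w\<bar>))" by simp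
  moreover have "of_real w powr (1 - s) * (indicator {0<..} (0 + w * t) *\<^sub>R ?f (0 + w * t))
     = indicator {0<..} t *\<^sub>R (of_real t powr (s - 1) * of_real (exp (- w * t)))" for t
  proof (cases "t > 0")
    case True
    have "complex_of_real (w * t) powr (s - 1) = of_real w powr (s - 1) * of_real t powr (s - 1)"
      using w True by (simp add: powr_times_real)
    moreover have "of_real w powr (1 - s) * of_real w powr (s - 1) = (1 :: complex)"
      using w by (simp flip: powr_add)
    ultimately show ?thesis using True w
      by (simp add: exp_minus field_simps zero_less_mult_iff flip: of_real_inverse)
  next
    case False
    then show ?thesis using w by (simp add: zero_less_mult_iff)
  qed
  moreover have "of_real w powr (1 - s) * (Gamma s /\<^sub>R \<bar>w\<bar>) = Gamma s * of_real w powr (- s)"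
    using w by (simp add: powr_diff powr_minus scaleR_conv_of_real field_simps)
  ultimately show ?thesis by simp
qed

section \<open>Exchange of lattice sums and integrals\<close>

lemma infsum_count_space:
  fixes f :: "'a \<Rightarrow> complex"
  assumes "(\<lambda>p. norm (f p)) summable_on X"
  shows "integrable (count_space X) f" "(\<integral>p. f p \<partial>count_space X) = (\<Sum>\<^sub>\<infinity>p\<in>X. f p)"
proof -
  have "Infinite_Set_Sum.abs_summable_on f X" using assms abs_summable_equivalent[of f X] by simp
  then show "integrable (count_space X) f" "(\<integral>p. f p \<partial>count_space X) = (\<Sum>\<^sub>\<infinity>p\<in>X. f p)"
    using infsetsum_infsum[of f X] by (simp_all add: Infinite_Set_Sum.abs_summable_on_def infsetsum_def)
qed

lemma integrable_count_space_real:
  fixes f :: "'a \<Rightarrow> real"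
  assumes "f summable_on X" "\<And>p. p \<in> X \<Longrightarrow> f p \<ge> 0"
  shows "integrable (count_space X) f"
proof -
  have "(\<lambda>p. norm (f p)) summable_on X" using assms by (simp cong: summable_on_cong)
  then have "Infinite_Set_Sum.abs_summable_on f X" using abs_summable_equivalent[of f X] by simp
  then show ?thesis by (simp add: Infinite_Set_Sum.abs_summable_on_def)
qed

text \<open>Fubini for the product of the counting measure with \<open>lborel\<close>; countability
  of X makes the counting measure sigma-finite.\<close>

lemma infsum_integral_swap:
  fixes f :: "'a \<Rightarrow> real \<Rightarrow> complex"
  assumes X: "countable X" and int: "\<And>p. p \<in> X \<Longrightarrow> integrable lborel (f p)"
    and sum: "(\<lambda>p. \<integral>t. norm (f p t) \<partial>lborel) summable_on X"
    and pt: "\<And>t. (\<lambda>p. norm (f p t)) summable_on X"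
  shows "(\<Sum>\<^sub>\<infinity>p\<in>X. \<integral>t. f p t \<partial>lborel) = (\<integral>t. (\<Sum>\<^sub>\<infinity>p\<in>X. f p t) \<partial>lborel)"
    "integrable lborel (\<lambda>t. \<Sum>\<^sub>\<infinity>p\<in>X. f p t)"
proof -
  interpret C: sigma_finite_measure "count_space X" by (rule sigma_finite_measure_count_space_countable[OF X])
  interpret P: pair_sigma_finite "count_space X" "lborel :: real measure" ..
  have m: "case_prod f \<in> borel_measurable (count_space X \<Otimes>\<^sub>M lborel)"
    by (rule measurable_pair_measure_countable1[OF X]) (use int in auto)
  have I: "integrable (count_space X \<Otimes>\<^sub>M lborel) (case_prod f)"
    by (rule P.Fubini_integrable[OF m]) (use int integrable_count_space_real[OF sum] in \<open>auto simp: AE_count_space\<close>)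
  have "(\<lambda>p. norm (\<integral>t. f p t \<partial>lborel)) summable_on X"
    by (rule summable_on_comparison_test[OF sum]) (auto intro: integral_norm_bound)
  from infsum_count_space(2)[OF this] P.Fubini_integral[OF I]
  show "(\<Sum>\<^sub>\<infinity>p\<in>X. \<integral>t. f p t \<partial>lborel) = (\<integral>t. (\<Sum>\<^sub>\<infinity>p\<in>X. f p t) \<partial>lborel)"
    by (simp add: infsum_count_space(2)[OF pt])
  show "integrable lborel (\<lambda>t. \<Sum>\<^sub>\<infinity>p\<in>X. f p t)"
    using P.integrable_snd[OF I] by (simp add: infsum_count_space(2)[OF pt])
qed

definition nonzero_pairs :: "(int \<times> int) set" where "nonzero_pairs = UNIV - {(0, 0)}"

definition square_norm :: "int \<times> int \<Rightarrow> real" where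
  "square_norm p = (of_int (fst p))^2 + (of_int (snd p))^2"

lemma square_norm_ge_1: "p \<in> nonzero_pairs \<Longrightarrow> square_norm p \<ge> 1"
proof -
  assume p: "p \<in> nonzero_pairs"
  obtain m n where mn: "p = (m, n)" by (cases p)
  have "m^2 + n^2 > 0" using p by (auto simp: mn nonzero_pairs_def sum_power2_gt_zero_iff)
  then have "real_of_int (m^2 + n^2) \<ge> 1" by linarith
  then show ?thesis by (simp add: square_norm_def mn)
qed

lemma summable_max_powr:
  fixes \<sigma> :: real
  assumes "\<sigma> > 1"
  shows "(\<lambda>n::int. max 1 \<bar>of_int n\<bar> powr (- \<sigma>)) summable_on UNIV"
proof -
  have "summable (\<lambda>n::nat. max 1 (real n) powr (- \<sigma>))"
  proof (rule summable_cong[THEN iffD2])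
    show "\<forall>\<^sub>F n in sequentially. max 1 (real n) powr (- \<sigma>) = real n powr (- \<sigma>)"
      using eventually_ge_at_top[of 1] by eventually_elim simp
    show "summable (\<lambda>n. real n powr (- \<sigma>))" using assms by (simp add: summable_real_powr_iff)
  qed
  then have nat: "(\<lambda>n::nat. max 1 (real n) powr (- \<sigma>)) summable_on UNIV"
    by (intro norm_summable_imp_summable_on) simp
  have "(\<lambda>n::int. max 1 \<bar>of_int n\<bar> powr (- \<sigma>)) summable_on (range int \<union> range (\<lambda>n. - int n))"
  proof (rule summable_on_union)
    show "(\<lambda>n::int. max 1 \<bar>of_int n\<bar> powr (- \<sigma>)) summable_on range int"
      using nat by (subst summable_on_reindex) (auto simp: o_def)
    show "(\<lambda>n::int. max 1 \<bar>of_int n\<bar> powr (- \<sigma>)) summable_on range (\<lambda>n. - int n)"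
      using nat by (subst summable_on_reindex) (auto simp: o_def inj_on_def)
  qed
  moreover have "range int \<union> range (\<lambda>n. - int n) = UNIV"
  proof (intro equalityI subsetI UNIV_I)
    fix n :: int show "n \<in> range int \<union> range (\<lambda>n. - int n)"
      by (cases n rule: int_cases2) auto
  qed
  ultimately show ?thesis by simp
qed

text \<open>Away from the origin, max 1 |m| times max 1 |n| is at most m^2 + n^2, so the lattice sum
  is dominated by a product of two one-dimensional sums.\<close>

lemma summable_square_norm_powr:
  fixes \<sigma> :: real
  assumes \<sigma>: "\<sigma> > 1"
  shows "(\<lambda>p. square_norm p powr (- \<sigma>)) summable_on nonzero_pairs"
proof -
  let ?h = "\<lambda>n::int. max 1 \<bar>of_int n :: real\<bar>"
  have "(\<lambda>p. ?h (fst p) powr (- \<sigma>) * ?h (snd p) powr (- \<sigma>)) summable_on UNIV"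
    by (rule summable_on_int_prod[OF summable_max_powr[OF \<sigma>] _ summable_max_powr[OF \<sigma>]]) simp_all
  then have "(\<lambda>p. ?h (fst p) powr (- \<sigma>) * ?h (snd p) powr (- \<sigma>)) summable_on nonzero_pairs"
    by (rule summable_on_subset_banach) simp
  then show ?thesis
  proof (rule summable_on_comparison_test)
    fix p assume p: "p \<in> nonzero_pairs"
    have "?h (fst p) * ?h (snd p) \<le> square_norm p"
    proof -
      define a b where "a = \<bar>real_of_int (fst p)\<bar>" and "b = \<bar>real_of_int (snd p)\<bar>"
      have N: "square_norm p = a^2 + b^2" by (simp add: square_norm_def a_def b_def)
      have "k = 0 \<or> \<bar>real_of_int k\<bar> \<ge> 1" for k :: int by linarith
      from this[of "fst p"] this[of "snd p"]
      have a: "a = 0 \<or> a \<ge> 1" and b: "b = 0 \<or> b \<ge> 1" unfolding a_def b_def by auto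
      have "a^2 + b^2 \<ge> 2 * a * b" using zero_le_power2[of "a - b"] by (simp add: power2_diff)
      moreover have "a * b \<ge> 0" by (simp add: a_def b_def)
      moreover have "a \<le> a^2" "b \<le> b^2" using a b by (auto simp: power2_eq_square)
      moreover have "a^2 + b^2 \<ge> 1" using square_norm_ge_1[OF p] by (simp add: N)
      ultimately have "max 1 a * max 1 b \<le> a^2 + b^2"
        using a b by (elim disjE) (auto simp: max_def)
      then show ?thesis by (simp add: N a_def b_def)
    qed
    then have "square_norm p powr (- \<sigma>) \<le> (?h (fst p) * ?h (snd p)) powr (- \<sigma>)"
      using \<sigma> by (intro powr_mono2') (auto intro!: mult_pos_pos)
    also have "\<dots> = ?h (fst p) powr (- \<sigma>) * ?h (snd p) powr (- \<sigma>)" by (simp add: powr_mult)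
    finally show "square_norm p powr (- \<sigma>) \<le> ?h (fst p) powr (- \<sigma>) * ?h (snd p) powr (- \<sigma>)" .
  qed simp
qed

lemma has_bochner_integral_powr_unit:
  fixes s :: complex
  assumes "Re s > 0"
  shows "has_bochner_integral lborel (\<lambda>t. indicator {0..1} t *\<^sub>R (of_real t powr (s - 1))) (1 / s)"
proof (rule has_bochner_integral_lborelI)
  show I: "((\<lambda>t. complex_of_real t powr (s - 1)) has_integral 1 / s) {0..1}"
  proof -
    have "((\<lambda>t. complex_of_real t powr (s - 1)) has_integral
            (of_real 1 powr s / s - of_real 0 powr s / s)) {0..1}" using assms
      by (intro fundamental_theorem_of_calculus_interior)
         (auto intro!: continuous_intros derivative_eq_intros has_vector_derivative_real_field)
    then show ?thesis by simp
  qed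
  show "(\<lambda>t. complex_of_real t powr (s - 1)) absolutely_integrable_on {0..1}"
  proof (rule absolutely_integrable_integrable_bound)
    show "(\<lambda>t. complex_of_real t powr (s - 1)) integrable_on {0..1}" using I by blast
    show "(\<lambda>t. t powr (Re s - 1)) integrable_on {0..1}"
      using has_integral_powr_from_0[of "Re s - 1" 1] assms by auto
    show "norm (complex_of_real t powr (s - 1)) \<le> t powr (Re s - 1)" if "t \<in> {0..1}" for t
      using that norm_powr_real_powr[of "of_real t" "s - 1"] by simp
  qed
qed measurable

section \<open>The quadratic form at complex points\<close>

definition form_a :: "c3 \<Rightarrow> real" where "form_a p = Re (((fst p)^2 + (fst (snd p))^2) / fst (snd p))"
definition form_b :: "c3 \<Rightarrow> real" where "form_b p = Re (fst p / fst (snd p))"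
definition form_c :: "c3 \<Rightarrow> real" where "form_c p = Re (1 / fst (snd p))"

text \<open>At a complexified point the form \<open>form3\<close> has real part \<open>a m\<^sup>2 + 2 b m n + c n\<^sup>2\<close>; the domain asks it
  to be positive definite, and \<open>form_min\<close>, the determinant over the trace, bounds its smaller
  eigenvalue from below.\<close>
definition form_domain :: "c3 set" where
  "form_domain = {p. fst (snd p) \<noteq> 0 \<and> form_a p + form_c p > 0 \<and> form_a p * form_c p - (form_b p)^2 > 0}"

definition form_min :: "c3 \<Rightarrow> real" where
  "form_min p = (form_a p * form_c p - (form_b p)^2) / (form_a p + form_c p)"

text \<open>\<open>form_value\<close> continued to complex x and y: the squared modulus is replaced
  by the polynomial (m x + n)^2 + (m y)^2. The inverse of y is a factor so that the closure lemma
  for products applies.\<close>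

definition form3 :: "int \<times> int \<Rightarrow> c3 \<Rightarrow> complex" where
  "form3 k p = ((of_int (fst k) * fst p + of_int (snd k))^2 + (of_int (fst k) * fst (snd p))^2) * inverse (fst (snd p))"

lemma continuous_on_form_abc:
  assumes "\<And>p. p \<in> S \<Longrightarrow> fst (snd p) \<noteq> 0"
  shows "continuous_on S form_a" "continuous_on S form_b" "continuous_on S form_c"
  unfolding form_a_def[abs_def] form_b_def[abs_def] form_c_def[abs_def]
  using assms by (auto intro!: continuous_intros)

lemma open_form_domain: "open form_domain"
proof -
  let ?S = "{p :: c3. fst (snd p) \<noteq> 0}"
  have S: "open ?S" by (intro open_Collect_neq continuous_intros)
  note c = continuous_on_form_abc[of ?S, simplified]
  have "open (?S \<inter> (\<lambda>p. form_a p + form_c p) -` {0<..})"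
    by (intro continuous_open_preimage S continuous_intros c)
  moreover have "open (?S \<inter> (\<lambda>p. form_a p * form_c p - (form_b p)^2) -` {0<..})"
    by (intro continuous_open_preimage S continuous_intros c)
  ultimately have "open ((?S \<inter> (\<lambda>p. form_a p + form_c p) -` {0<..}) \<inter> (?S \<inter> (\<lambda>p. form_a p * form_c p - (form_b p)^2) -` {0<..}))"
    by (rule open_Int)
  moreover have "(?S \<inter> (\<lambda>p. form_a p + form_c p) -` {0<..}) \<inter> (?S \<inter> (\<lambda>p. form_a p * form_c p - (form_b p)^2) -` {0<..}) = form_domain"
    by (auto simp: form_domain_def)
  ultimately show ?thesis by simp
qed

lemma form_min_pos: "p \<in> form_domain \<Longrightarrow> form_min p > 0"
  by (auto simp: form_domain_def form_min_def)

text \<open>As m and n are real, the real part is the real form with coefficients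
  \<open>form_a\<close>, \<open>form_b\<close>, \<open>form_c\<close>, to which
  \<open>form_lower_bound\<close> applies.\<close>

lemma Re_form3_ge:
  assumes p: "p \<in> form_domain"
  shows "Re (form3 k p) \<ge> form_min p * square_norm k"
proof -
  obtain x y s where P: "p = (x, y, s)" by (cases p)
  define m n where "m = real_of_int (fst k)" and "n = real_of_int (snd k)"
  have y: "y \<noteq> 0" using p by (simp add: form_domain_def P)
  have "form3 k p = ((x^2 + y^2) / y) * of_real (m^2) + (x / y) * of_real (2 * m * n) + (1 / y) * of_real (n^2)"
    using y by (simp add: form3_def P m_def n_def power2_eq_square field_simps)
  moreover have "Re (u * of_real a + v * of_real b + w * of_real c) = Re u * a + Re v * b + Re w * c" for u v w a b c
    by simp
  ultimately have "Re (form3 k p) = form_a p * m^2 + form_b p * (2 * m * n) + form_c p * n^2"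
    unfolding form_a_def form_b_def form_c_def P fst_conv snd_conv by (simp only:)
  then have "(form_a p + form_c p) * Re (form3 k p) \<ge> (form_a p * form_c p - (form_b p)^2) * square_norm k"
    using form_lower_bound[of "form_a p" "form_c p" "form_b p" m n] by (simp add: square_norm_def m_def n_def mult_ac)
  then show ?thesis using p by (simp add: form_domain_def form_min_def field_simps)
qed

lemma holomorphic3_on_y_inverse: "(\<lambda>p. inverse (fst (snd p))) holomorphic3_on form_domain"
  by (rule holomorphic3_on_compose[where T = "- {0}" and g = inverse, OF holomorphic3_on_coord(2)])
    (auto simp: form_domain_def intro!: holomorphic_intros)

lemma holomorphic3_on_form3: "form3 k holomorphic3_on form_domain"
  unfolding form3_def[abs_def] power2_eq_square
  by (intro holomorphic3_on_mult holomorphic3_on_add holomorphic3_on_const holomorphic3_on_coord holomorphic3_on_y_inverse)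

lemma real_point_form:
  assumes "Im z > 0"
  shows "(of_real (Re z), of_real (Im z), s) \<in> form_domain"
    "form3 k (of_real (Re z), of_real (Im z), s) = of_real (form_value z k)"
proof -
  let ?p = "(complex_of_real (Re z), complex_of_real (Im z), s)"
  have abc: "form_a ?p = ((Re z)^2 + (Im z)^2) / Im z" "form_b ?p = Re z / Im z" "form_c ?p = 1 / Im z"
    by (simp_all add: form_a_def form_b_def form_c_def flip: of_real_power of_real_add of_real_divide)
  have "((Re z)^2 + (Im z)^2) / Im z + 1 / Im z > 0"
    using assms by (intro add_nonneg_pos) auto
  moreover have "((Re z)^2 + (Im z)^2) / Im z * (1 / Im z) - (Re z / Im z)^2 = 1"
    using assms by (simp add: power2_eq_square field_simps)
  ultimately show "?p \<in> form_domain" using assms unfolding form_domain_def by (simp add: abc)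
  show "form3 k ?p = of_real (form_value z k)"
    by (simp add: form3_def form_value_def divide_inverse)
qed

text \<open>\<open>form_min\<close> is continuous and positive, so on a small ball one \<kappa>
  bounds it from below while s stays bounded. The dominating functions for the Mellin kernel and for
  the Eisenstein terms are built from these constants.\<close>

lemma form_domain_local:
  assumes p: "p \<in> form_domain"
  obtains r \<kappa> R where "r > 0" "\<kappa> > 0" "R > 0" "ball p r \<subseteq> form_domain"
    "\<And>q. q \<in> ball p r \<Longrightarrow> \<kappa> \<le> form_min q" "\<And>q. q \<in> ball p r \<Longrightarrow> norm (snd (snd q)) \<le> R"
proof -
  obtain r1 where r1: "r1 > 0" "ball p r1 \<subseteq> form_domain" using openE[OF open_form_domain p] by blast
  have "continuous_on form_domain form_min"
    unfolding form_min_def[abs_def]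
    by (intro continuous_intros continuous_on_form_abc) (auto simp: form_domain_def)
  then have "isCont form_min p" using open_form_domain p by (simp add: continuous_on_eq_continuous_at)
  then obtain d where d: "d > 0" "\<And>q. dist q p < d \<Longrightarrow> dist (form_min q) (form_min p) < form_min p / 2"
    using form_min_pos[OF p] unfolding continuous_at_eps_delta by (meson half_gt_zero)
  show thesis
  proof (rule that[of "min r1 d" "form_min p / 2" "norm (snd (snd p)) + min r1 d"])
    show "min r1 d > 0" "form_min p / 2 > 0" "ball p (min r1 d) \<subseteq> form_domain"
      using r1 d form_min_pos[OF p] by auto
    show "norm (snd (snd p)) + min r1 d > 0" using r1 d by (intro add_nonneg_pos) auto
    fix q assume q: "q \<in> ball p (min r1 d)"
    then have "dist (form_min q) (form_min p) < form_min p / 2"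
      by (intro d(2)) (simp add: dist_commute)
    then show "form_min p / 2 \<le> form_min q"
      unfolding dist_real_def by linarith
    have "norm (snd (snd q) - snd (snd p)) \<le> norm (q - p)"
    proof -
      have "norm (snd v) \<le> norm v" for v :: "complex \<times> complex" by (cases v) (simp add: norm_snd_le)
      moreover have "norm (snd v) \<le> norm v" for v :: c3 by (cases v) (simp add: norm_snd_le)
      ultimately have "norm (snd (snd (q - p))) \<le> norm (q - p)" by (rule order_trans)
      then show ?thesis by simp
    qed
    then show "norm (snd (snd q)) \<le> norm (snd (snd p)) + min r1 d"
    proof -
      have "norm (q - p) < min r1 d" using q unfolding mem_ball dist_norm norm_minus_commute[of p q] .
      moreover have "norm (snd (snd q) - snd (snd p)) \<le> norm (q - p)" by fact
      ultimately show ?thesis using norm_triangle_sub[of "snd (snd q)" "snd (snd p)"] by linarith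
    qed
  qed
qed

text \<open>The inner half of the Mellin integral is taken after the theta transformation, with
  \<open>t\<close> replaced by \<open>1 / t\<close> in the exponential instead of by a change of variables.\<close>
definition mellin_kernel :: "int \<times> int \<Rightarrow> real \<Rightarrow> c3 \<Rightarrow> complex" where
  "mellin_kernel k t p =
     (if t \<ge> 1 then exp (- of_real (pi * t) * form3 k p) * exp ((snd (snd p) - 1) * of_real (ln t))
      else if t > 0 then exp (- of_real (pi * (1 / t)) * form3 k p) * exp ((snd (snd p) - 2) * of_real (ln t)) else 0)"

lemma holomorphic3_on_mellin_kernel: "mellin_kernel k t holomorphic3_on form_domain"
proof -
  have e: "(\<lambda>p. exp (c * form3 k p) * exp ((snd (snd p) + d) * e)) holomorphic3_on form_domain" for c d e
  proof (rule holomorphic3_on_mult)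
    have "(\<lambda>p. c * form3 k p) holomorphic3_on form_domain"
      by (intro holomorphic3_on_mult holomorphic3_on_const holomorphic3_on_form3)
    then show "(\<lambda>p. exp (c * form3 k p)) holomorphic3_on form_domain"
      by (rule holomorphic3_on_compose[where T = UNIV and g = exp]) (auto intro!: holomorphic_intros)
    have "(\<lambda>p. (snd (snd p) + d) * e) holomorphic3_on form_domain"
      by (intro holomorphic3_on_mult holomorphic3_on_const holomorphic3_on_coord holomorphic3_on_add)
    then show "(\<lambda>p. exp ((snd (snd p) + d) * e)) holomorphic3_on form_domain"
      by (rule holomorphic3_on_compose[where T = UNIV and g = exp]) (auto intro!: holomorphic_intros)
  qed
  show ?thesis
    using e[of "- of_real (pi * t)" "-1"] e[of "- of_real (pi * (1 / t))" "-2"] holomorphic3_on_const[of 0]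
    unfolding mellin_kernel_def[abs_def]
    by (cases "t \<ge> 1"; cases "t > 0") simp_all
qed

text \<open>With T = max t (1/t) both halves of the kernel have one shape: for t < 1 the exponential
  already contains 1/t, and the power of t has the size of T to the exponent 2 - Re s. The exponent
  R + 2 covers both halves.\<close>

lemma norm_mellin_kernel_le:
  assumes t: "t > 0" and s: "norm (snd (snd p)) \<le> R" and q: "Re (form3 k p) \<ge> w"
  shows "norm (mellin_kernel k t p) \<le> exp (- pi * w * max t (1 / t)) * max t (1 / t) powr (R + 2)"
proof -
  define T where "T = max t (1 / t)"
  have T: "T \<ge> 1" using t by (cases "t \<ge> 1") (auto simp: T_def le_max_iff_disj)
  have Re: "\<bar>Re (snd (snd p))\<bar> \<le> R" using s abs_Re_le_cmod order_trans by blast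
  have lnT: "ln T \<ge> 0" using T by simp
  have ex: "norm (exp (- of_real (pi * T) * form3 k p)) \<le> exp (- pi * w * T)"
    using mult_left_mono[OF q, of "pi * T"] T by (simp add: mult_ac)
  have "norm (mellin_kernel k t p) \<le> exp (- pi * w * T) * exp ((R + 2) * ln T)"
  proof (cases "t \<ge> 1")
    case True
    then have "1 / t \<le> 1" by simp
    then have Tt: "T = t" unfolding T_def by (rule max_absorb1[OF order_trans]) (rule True)
    have "norm (exp ((snd (snd p) - 1) * of_real (ln t))) \<le> exp ((R + 2) * ln T)"
      using Re lnT mult_right_mono[of "Re (snd (snd p)) - 1" "R + 2" "ln T"] by (simp add: Tt)
    with ex show ?thesis using True unfolding Tt[symmetric] mellin_kernel_def
      by (simp add: norm_mult Tt mult_mono del: norm_exp_eq_Re)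
  next
    case False
    then have "1 \<le> 1 / t" using t by simp
    then have Tt: "T = 1 / t" using False by (simp add: T_def)
    have lnt: "ln t = - ln T" using t by (simp add: Tt ln_div)
    have "norm (exp ((snd (snd p) - 2) * of_real (ln t))) \<le> exp ((R + 2) * ln T)"
      using Re lnT mult_right_mono[of "2 - Re (snd (snd p))" "R + 2" "ln T"] by (simp add: lnt algebra_simps)
    with ex show ?thesis using False t unfolding mellin_kernel_def
      by (simp add: norm_mult Tt mult_mono del: norm_exp_eq_Re)
  qed
  then show ?thesis using T by (simp add: T_def powr_def)
qed

lemma mellin_kernel_measurable: "(\<lambda>t. mellin_kernel k t p) \<in> borel_measurable lborel"
  unfolding mellin_kernel_def by measurable

lemma integrable_exp_decay:
  fixes \<beta> :: real
  assumes "\<beta> > 0"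
  shows "integrable lborel (\<lambda>t. indicator {0<..} t * exp (- \<beta> * t))"
proof -
  have "integrable lborel (\<lambda>t. norm (indicator {0<..} t *\<^sub>R (of_real t powr ((1 :: complex) - 1) * of_real (exp (- \<beta> * t)))))"
    using gamma_integral_scaled[OF assms, of 1] by (intro integrable_norm) (auto simp: has_bochner_integral_iff)
  moreover have "norm (indicator {0<..} t *\<^sub>R (of_real t powr ((1 :: complex) - 1) * of_real (exp (- \<beta> * t))))
     = indicator {0<..} t * exp (- \<beta> * t)" for t
    by (cases "t > 0") (simp_all add: norm_mult)
  ultimately show ?thesis by (simp only:)
qed

lemma mellin_kernel_dominated:
  assumes "\<kappa> > 0"
  obtains C where "C > 0"
    "\<And>k t p. k \<in> nonzero_pairs \<Longrightarrow> norm (snd (snd p)) \<le> R \<Longrightarrow> Re (form3 k p) \<ge> \<kappa> * square_norm k \<Longrightarrow>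
      norm (mellin_kernel k t p) \<le> C * exp (- (pi * \<kappa> / 2) * square_norm k) * (indicator {0<..} t * exp (- (pi * \<kappa> / 4) * t))"
proof -
  have b: "pi * \<kappa> / 4 > 0" using assms by simp
  obtain C where C: "C > 0" "\<And>u. u \<ge> 1 \<Longrightarrow> u powr (R + 2) \<le> C * exp (pi * \<kappa> / 4 * u)"
    by (rule powr_le_exp[OF b, of "R + 2"]) (rule that)
  show thesis
  proof (rule that[OF C(1)])
    fix k t p assume k: "k \<in> nonzero_pairs" and s: "norm (snd (snd p)) \<le> R"
      and q: "Re (form3 k p) \<ge> \<kappa> * square_norm k"
    show "norm (mellin_kernel k t p) \<le> C * exp (- (pi * \<kappa> / 2) * square_norm k) * (indicator {0<..} t * exp (- (pi * \<kappa> / 4) * t))"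
    proof (cases "t > 0")
      case False
      then show ?thesis by (simp add: mellin_kernel_def)
    next
      case True
      define T N where "T = max t (1 / t)" and "N = square_norm k"
      have T: "T \<ge> 1" "T \<ge> t" using True by (cases "t \<ge> 1"; simp add: T_def le_max_iff_disj)+
      have N: "N \<ge> 1" unfolding N_def by (rule square_norm_ge_1[OF k])
      \<comment> \<open>For N, T \<ge> 1 the product N T is at least (N + T) / 2, which separates
        the lattice variable from t. Of the share of T, one half absorbs the power of T and the
        other remains as decay in t.\<close>
      have "(N - 1) * T + (T - 1) * N \<ge> 0" using T N by (intro add_nonneg_nonneg mult_nonneg_nonneg) auto
      then have NT: "N * T \<ge> (N + T) / 2" by (simp add: algebra_simps)
      have "pi * \<kappa> * ((N + T) / 2) \<le> pi * \<kappa> * (N * T)"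
        using NT assms by (intro mult_left_mono) simp_all
      moreover have "pi * \<kappa> * ((N + T) / 2) = pi * \<kappa> / 2 * N + (pi * \<kappa> / 4 * T + pi * \<kappa> / 4 * T)"
        by (simp add: field_simps)
      moreover have "- pi * (\<kappa> * N) * T = - (pi * \<kappa> * (N * T))" by simp
      ultimately have e: "- pi * (\<kappa> * N) * T + pi * \<kappa> / 4 * T \<le> - (pi * \<kappa> / 2) * N - pi * \<kappa> / 4 * T"
        by linarith
      have "pi * \<kappa> / 4 * t \<le> pi * \<kappa> / 4 * T" using T b by (intro mult_left_mono) auto
      with e have e: "- pi * (\<kappa> * N) * T + pi * \<kappa> / 4 * T \<le> - (pi * \<kappa> / 2) * N - pi * \<kappa> / 4 * t" by linarith
      have "norm (mellin_kernel k t p) \<le> exp (- pi * (\<kappa> * N) * T) * T powr (R + 2)"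
        unfolding T_def N_def by (rule norm_mellin_kernel_le[OF True s q])
      also have "\<dots> \<le> exp (- pi * (\<kappa> * N) * T) * (C * exp (pi * \<kappa> / 4 * T))"
        by (intro mult_left_mono C(2) T) simp
      also have "\<dots> = C * exp (- pi * (\<kappa> * N) * T + pi * \<kappa> / 4 * T)" unfolding exp_add by (simp only: mult_ac)
      also have "\<dots> \<le> C * exp (- (pi * \<kappa> / 2) * N - pi * \<kappa> / 4 * t)"
        using C(1) e by (intro mult_left_mono) auto
      also have "\<dots> = C * exp (- (pi * \<kappa> / 2) * N) * exp (- (pi * \<kappa> / 4) * t)"
        by (simp only: mult.assoc exp_add[symmetric] diff_conv_add_uminus minus_mult_left)
      finally show ?thesis using True by (simp add: N_def)
    qed
  qed
qed

definition mellin :: "int \<times> int \<Rightarrow> c3 \<Rightarrow> complex" where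
  "mellin k p = (\<integral>t. mellin_kernel k t p \<partial>lborel)"

text \<open>One ball around p serves the kernel, its integral and the integral of its norm. The rate
  b = \<pi> \<kappa> / 4 is the weaker of the two decay rates and is used for both
  variables.\<close>

lemma mellin_local_bound:
  assumes p: "p \<in> form_domain"
  obtains r C b where "r > 0" "ball p r \<subseteq> form_domain" "C > 0" "b > 0"
    "\<And>k q t. k \<in> nonzero_pairs \<Longrightarrow> q \<in> ball p r \<Longrightarrow>
       norm (mellin_kernel k t q) \<le> C * exp (- b * square_norm k) * (indicator {0<..} t * exp (- b * t))"
    "\<And>k q. k \<in> nonzero_pairs \<Longrightarrow> q \<in> ball p r \<Longrightarrow> norm (mellin k q) \<le> C / b * exp (- b * square_norm k)"
    "\<And>k q. k \<in> nonzero_pairs \<Longrightarrow> q \<in> ball p r \<Longrightarrow> (\<integral>t. norm (mellin_kernel k t q) \<partial>lborel) \<le> C / b * exp (- b * square_norm k)"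
proof -
  obtain r \<kappa> R where r: "r > 0" "\<kappa> > 0" "R > 0" "ball p r \<subseteq> form_domain"
    "\<And>q. q \<in> ball p r \<Longrightarrow> \<kappa> \<le> form_min q" "\<And>q. q \<in> ball p r \<Longrightarrow> norm (snd (snd q)) \<le> R"
    by (rule form_domain_local[OF p]) (rule that)
  obtain C where C: "C > 0"
    "\<And>k t p. k \<in> nonzero_pairs \<Longrightarrow> norm (snd (snd p)) \<le> R \<Longrightarrow> Re (form3 k p) \<ge> \<kappa> * square_norm k \<Longrightarrow>
      norm (mellin_kernel k t p) \<le> C * exp (- (pi * \<kappa> / 2) * square_norm k) * (indicator {0<..} t * exp (- (pi * \<kappa> / 4) * t))"
    by (rule mellin_kernel_dominated[OF r(2), of R]) (rule that)
  define b where "b = pi * \<kappa> / 4"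
  have b: "b > 0" using r by (simp add: b_def)
  have ker: "norm (mellin_kernel k t q) \<le> C * exp (- b * square_norm k) * (indicator {0<..} t * exp (- b * t))"
    if k: "k \<in> nonzero_pairs" and q: "q \<in> ball p r" for k q t
  proof -
    have N: "square_norm k \<ge> 1" by (rule square_norm_ge_1[OF k])
    have "\<kappa> * square_norm k \<le> form_min q * square_norm k" using r(5)[OF q] N by (intro mult_right_mono) auto
    also have "\<dots> \<le> Re (form3 k q)" using Re_form3_ge r(4) q by blast
    finally have "norm (mellin_kernel k t q) \<le> C * exp (- (pi * \<kappa> / 2) * square_norm k) * (indicator {0<..} t * exp (- (pi * \<kappa> / 4) * t))"
      by (rule C(2)[OF k r(6)[OF q]])
    also have "\<dots> \<le> C * exp (- b * square_norm k) * (indicator {0<..} t * exp (- b * t))"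
      unfolding b_def using C(1) r(2) N by (intro mult_right_mono mult_left_mono) (auto simp: indicator_def)
    finally show ?thesis .
  qed
  have expint: "(\<integral>t. indicator {0<..} t * exp (- b * t) \<partial>lborel) = 1 / b"
  proof -
    have "has_bochner_integral lborel (\<lambda>t. indicator {0<..} t *\<^sub>R (of_real t powr ((1 :: complex) - 1) * of_real (exp (- b * t)))) (Gamma 1 * of_real b powr (- 1))"
      by (rule gamma_integral_scaled[OF b]) simp
    moreover have "indicator {0<..} t *\<^sub>R (of_real t powr ((1 :: complex) - 1) * of_real (exp (- b * t))) = of_real (indicator {0<..} t * exp (- b * t))" for t
      by (cases "t > 0") simp_all
    moreover have "Gamma 1 * complex_of_real b powr (- 1) = of_real (1 / b)"
      using b by (simp add: powr_minus divide_inverse)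
    ultimately have "has_bochner_integral lborel (\<lambda>t. complex_of_real (indicator {0<..} t * exp (- b * t))) (of_real (1 / b))"
      by (simp only:)
    then have "complex_of_real (\<integral>t. indicator {0<..} t * exp (- b * t) \<partial>lborel) = of_real (1 / b)"
      using has_bochner_integral_integral_eq integral_complex_of_real by metis
    then show ?thesis by (simp only: of_real_eq_iff)
  qed
  have nint: "(\<integral>t. norm (mellin_kernel k t q) \<partial>lborel) \<le> C / b * exp (- b * square_norm k)"
    if k: "k \<in> nonzero_pairs" and q: "q \<in> ball p r" for k q
  proof -
    have gi: "integrable lborel (\<lambda>t. C * exp (- b * square_norm k) * (indicator {0<..} t * exp (- b * t)))"
      by (intro integrable_mult_right integrable_exp_decay b)
    have "(\<integral>t. norm (mellin_kernel k t q) \<partial>lborel) \<le> (\<integral>t. C * exp (- b * square_norm k) * (indicator {0<..} t * exp (- b * t)) \<partial>lborel)"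
      by (rule integral_mono'[OF gi ker[OF k q]]) (use C(1) in \<open>intro mult_nonneg_nonneg; simp\<close>)
    also have "\<dots> = C / b * exp (- b * square_norm k)" by (simp only: integral_mult_right_zero expint) simp
    finally show ?thesis .
  qed
  show thesis
  proof (rule that[OF r(1,4) C(1) b ker])
    show "norm (mellin k q) \<le> C / b * exp (- b * square_norm k)" if k: "k \<in> nonzero_pairs" and q: "q \<in> ball p r" for k q
      unfolding mellin_def by (rule order_trans[OF integral_norm_bound nint[OF that]])
  qed (use nint in auto)
qed

lemma integrable_mellin_kernel:
  assumes "p \<in> form_domain" "k \<in> nonzero_pairs"
  shows "integrable lborel (\<lambda>t. mellin_kernel k t p)"
proof -
  obtain r C b where r: "r > 0" "ball p r \<subseteq> form_domain" "C > 0" "b > 0"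
    "\<And>k q t. k \<in> nonzero_pairs \<Longrightarrow> q \<in> ball p r \<Longrightarrow>
       norm (mellin_kernel k t q) \<le> C * exp (- b * square_norm k) * (indicator {0<..} t * exp (- b * t))"
    by (rule mellin_local_bound[OF assms(1)]) (rule that)
  show ?thesis
  proof (rule Bochner_Integration.integrable_bound[OF _ mellin_kernel_measurable])
    show "integrable lborel (\<lambda>t. C * exp (- b * square_norm k) * (indicator {0<..} t * exp (- b * t)))"
      by (intro integrable_mult_right integrable_exp_decay r)
    show "AE t in lborel. norm (mellin_kernel k t p) \<le> norm (C * exp (- b * square_norm k) * (indicator {0<..} t * exp (- b * t)))"
    proof (rule AE_I2)
      fix t
      have "norm (mellin_kernel k t p) \<le> C * exp (- b * square_norm k) * (indicator {0<..} t * exp (- b * t))"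
        using r(1) by (intro r(5) assms(2)) simp
      then show "norm (mellin_kernel k t p) \<le> norm (C * exp (- b * square_norm k) * (indicator {0<..} t * exp (- b * t)))"
        by (rule order_trans) simp
    qed
  qed
qed

lemma holomorphic3_on_mellin:
  assumes k: "k \<in> nonzero_pairs"
  shows "mellin k holomorphic3_on form_domain"
  unfolding mellin_def[abs_def]
proof (rule holomorphic3_on_integral[OF open_form_domain holomorphic3_on_mellin_kernel mellin_kernel_measurable])
  fix p assume "p \<in> form_domain"
  then obtain r C b where r: "r > 0" "ball p r \<subseteq> form_domain" "C > 0" "b > 0"
    "\<And>k q t. k \<in> nonzero_pairs \<Longrightarrow> q \<in> ball p r \<Longrightarrow>
       norm (mellin_kernel k t q) \<le> C * exp (- b * square_norm k) * (indicator {0<..} t * exp (- b * t))"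
    by (rule mellin_local_bound) (rule that)
  show "\<exists>r>0. \<exists>g. ball p r \<subseteq> form_domain \<and> integrable lborel g \<and>
      (\<forall>q\<in>ball p r. \<forall>t\<in>space lborel. norm (mellin_kernel k t q) \<le> g t)"
    by (rule exI[of _ r], rule conjI[OF r(1)], rule exI[of _ "\<lambda>t. C * exp (- b * square_norm k) * (indicator {0<..} t * exp (- b * t))"])
      (intro conjI ballI r(2) r(5) k integrable_mult_right integrable_exp_decay r(4); assumption)
qed

lemma summable_exp_square_norm:
  "b > 0 \<Longrightarrow> (\<lambda>k. exp (- b * square_norm k)) summable_on nonzero_pairs"
  unfolding square_norm_def
  by (rule summable_on_subset_banach[OF summable_exp_sum_squares]) simp_all

lemma summable_mellin:
  assumes "p \<in> form_domain"
  shows "(\<lambda>k. norm (mellin k p)) summable_on nonzero_pairs"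
    "(\<lambda>k. \<integral>t. norm (mellin_kernel k t p) \<partial>lborel) summable_on nonzero_pairs"
proof -
  obtain r C b where r: "r > 0" "C > 0" "b > 0"
    "\<And>k q. k \<in> nonzero_pairs \<Longrightarrow> q \<in> ball p r \<Longrightarrow> norm (mellin k q) \<le> C / b * exp (- b * square_norm k)"
    "\<And>k q. k \<in> nonzero_pairs \<Longrightarrow> q \<in> ball p r \<Longrightarrow> (\<integral>t. norm (mellin_kernel k t q) \<partial>lborel) \<le> C / b * exp (- b * square_norm k)"
    by (rule mellin_local_bound[OF assms]) (rule that)
  have s: "(\<lambda>k. C / b * exp (- b * square_norm k)) summable_on nonzero_pairs"
    by (intro summable_on_cmult_right summable_exp_square_norm r)
  show "(\<lambda>k. norm (mellin k p)) summable_on nonzero_pairs"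
  proof (rule summable_on_comparison_test[OF s])
    fix k assume "k \<in> nonzero_pairs"
    then show "norm (mellin k p) \<le> C / b * exp (- b * square_norm k)" by (rule r(4)) (simp add: r(1))
  qed simp
  show "(\<lambda>k. \<integral>t. norm (mellin_kernel k t p) \<partial>lborel) summable_on nonzero_pairs"
  proof (rule summable_on_comparison_test[OF s])
    fix k assume "k \<in> nonzero_pairs"
    then show "(\<integral>t. norm (mellin_kernel k t p) \<partial>lborel) \<le> C / b * exp (- b * square_norm k)" by (rule r(5)) (simp add: r(1))
  qed simp
qed

text \<open>An integral for the counting measure, so that \<open>holomorphic3_on_integral\<close>
  applies to the sum as it did to the integral over t.\<close>

definition mellin_sum :: "c3 \<Rightarrow> complex" where
  "mellin_sum p = (\<integral>k. mellin k p \<partial>count_space nonzero_pairs)"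

lemma mellin_sum_eq: "p \<in> form_domain \<Longrightarrow> mellin_sum p = (\<Sum>\<^sub>\<infinity>k\<in>nonzero_pairs. mellin k p)"
  unfolding mellin_sum_def by (rule infsum_count_space(2)[OF summable_mellin(1)])

lemma holomorphic3_on_mellin_sum: "mellin_sum holomorphic3_on form_domain"
  unfolding mellin_sum_def[abs_def]
proof (rule holomorphic3_on_integral[OF open_form_domain])
  show "mellin k holomorphic3_on form_domain" if "k \<in> space (count_space nonzero_pairs)" for k
    using that by (simp add: holomorphic3_on_mellin)
  fix p assume p: "p \<in> form_domain"
  show "(\<lambda>k. mellin k p) \<in> borel_measurable (count_space nonzero_pairs)" by simp
  obtain r C b where r: "r > 0" "ball p r \<subseteq> form_domain" "C > 0" "b > 0"
    "\<And>k q. k \<in> nonzero_pairs \<Longrightarrow> q \<in> ball p r \<Longrightarrow> norm (mellin k q) \<le> C / b * exp (- b * square_norm k)"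
    by (rule mellin_local_bound[OF p]) (rule that)
  have i: "integrable (count_space nonzero_pairs) (\<lambda>k. C / b * exp (- b * square_norm k))"
    by (rule integrable_count_space_real[OF summable_on_cmult_right[OF summable_exp_square_norm]]) (use r in auto)
  show "\<exists>r>0. \<exists>g. ball p r \<subseteq> form_domain \<and> integrable (count_space nonzero_pairs) g \<and>
      (\<forall>q\<in>ball p r. \<forall>k\<in>space (count_space nonzero_pairs). norm (mellin k q) \<le> g k)"
    by (rule exI[of _ r], rule conjI[OF r(1)], rule exI, intro conjI ballI, rule r(2), rule i, rule r(5)) simp_all
qed

text \<open>Folding at \<open>t = 1\<close> leaves \<open>1 / (s - 1) - 1 / s\<close> from the index \<open>(0, 0)\<close>; multiplied by
  \<open>s (s - 1) / 2\<close> this is the leading \<open>1 / 2\<close>.\<close>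
definition completed_eisenstein :: "c3 \<Rightarrow> complex" where
  "completed_eisenstein p = 1 / 2 + (1 / 2 * (snd (snd p) * (snd (snd p) + (-1)))) * mellin_sum p"

lemma holomorphic3_on_completed_eisenstein: "completed_eisenstein holomorphic3_on form_domain"
  unfolding completed_eisenstein_def[abs_def]
  by (intro holomorphic3_on_add holomorphic3_on_mult holomorphic3_on_const holomorphic3_on_coord holomorphic3_on_mellin_sum)

section \<open>Analytic continuation of the Eisenstein series\<close>

lemma form_value_pos:
  assumes z: "Im z > 0" and k: "k \<in> nonzero_pairs"
  shows "form_value z k > 0"
proof -
  have "0 < Im z / ((Re z)^2 + (Im z)^2 + 1) * square_norm k"
    using z square_norm_ge_1[OF k] by (intro mult_pos_pos divide_pos_pos) (auto intro: add_nonneg_pos)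
  also have "\<dots> \<le> form_value z k" using form_value_ge[OF z, of k] by (simp add: square_norm_def)
  finally show ?thesis .
qed

lemma E0_eq_form_value:
  assumes z: "Im z > 0"
  shows "E0 z s = 1 / 2 * (\<Sum>\<^sub>\<infinity>k\<in>nonzero_pairs. of_real (form_value z k) powr (- s))"
proof -
  have "(case k of (m, n) \<Rightarrow> complex_of_real (Im z) powr s / complex_of_real (cmod (of_int m * z + of_int n)) powr (2 * s))
     = of_real (form_value z k) powr (- s)" if k: "k \<in> nonzero_pairs" for k
  proof -
    obtain m n where mn: "k = (m, n)" by (cases k)
    define c where "c = cmod (of_int m * z + of_int n)"
    have Q: "form_value z k > 0" by (rule form_value_pos[OF z k])
    have c2: "c^2 = form_value z k * Im z"
      using z by (simp add: c_def cmod_power2 form_value_def mn power_mult_distrib)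
    then have "c^2 > 0" using Q z by simp
    then have c: "c > 0" by (simp add: c_def zero_less_power2)
    have "ln (c^2) = ln (form_value z k) + ln (Im z)" unfolding c2 using Q z by (simp add: ln_mult)
    then have l: "ln (form_value z k) = 2 * ln c - ln (Im z)" using c by (simp add: ln_realpow)
    have "complex_of_real (Im z) powr s / complex_of_real c powr (2 * s) = exp (s * of_real (ln (Im z)) - 2 * s * of_real (ln c))"
      using z c by (simp add: powr_def Ln_of_real exp_diff)
    also have "\<dots> = of_real (form_value z k) powr (- s)"
      using Q by (simp add: powr_def Ln_of_real l algebra_simps)
    finally show ?thesis by (simp add: mn c_def)
  qed
  then have "(\<Sum>\<^sub>\<infinity>(m, n)\<in>nonzero_pairs. complex_of_real (Im z) powr s / complex_of_real (cmod (of_int m * z + of_int n)) powr (2 * s))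
     = (\<Sum>\<^sub>\<infinity>k\<in>nonzero_pairs. of_real (form_value z k) powr (- s))"
    by (rule infsum_cong)
  then show ?thesis unfolding E0_def nonzero_pairs_def by (simp only:)
qed

lemma form_value_powr_summable:
  assumes z: "Im z > 0" and \<sigma>: "\<sigma> > 1"
  shows "(\<lambda>k. form_value z k powr (- \<sigma>)) summable_on nonzero_pairs"
proof -
  define c where "c = Im z / ((Re z)^2 + (Im z)^2 + 1)"
  have c: "c > 0" unfolding c_def using z by (intro divide_pos_pos) (auto intro: add_nonneg_pos)
  have "(\<lambda>k. c powr (- \<sigma>) * square_norm k powr (- \<sigma>)) summable_on nonzero_pairs"
    by (intro summable_on_cmult_right summable_square_norm_powr \<sigma>)
  then show ?thesis
  proof (rule summable_on_comparison_test)
    fix k assume k: "k \<in> nonzero_pairs"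
    have "0 < c * square_norm k" using c square_norm_ge_1[OF k] by simp
    moreover have "c * square_norm k \<le> form_value z k"
      using form_value_ge[OF z, of k] unfolding c_def square_norm_def .
    ultimately have "form_value z k powr (- \<sigma>) \<le> (c * square_norm k) powr (- \<sigma>)"
      using \<sigma> by (intro powr_mono2') auto
    then show "form_value z k powr (- \<sigma>) \<le> c powr (- \<sigma>) * square_norm k powr (- \<sigma>)"
      using c square_norm_ge_1[OF k] by (simp add: powr_mult)
  qed simp
qed

lemma theta_nonzero_pairs:
  assumes z: "Im z > 0" and t: "t > 0"
  shows "(\<Sum>\<^sub>\<infinity>k\<in>nonzero_pairs. complex_of_real (exp (- pi * t * form_value z k)))
    = (\<Sum>\<^sub>\<infinity>k. complex_of_real (exp (- pi * t * form_value z k))) - 1"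
    "(\<lambda>k. exp (- pi * t * form_value z k)) summable_on nonzero_pairs"
proof -
  have s: "(\<lambda>k. complex_of_real (exp (- pi * t * form_value z k))) summable_on UNIV"
    using summable_theta[OF z t] by (simp add: summable_on_of_real)
  have "(\<Sum>\<^sub>\<infinity>k\<in>UNIV - {(0, 0)}. complex_of_real (exp (- pi * t * form_value z k)))
    = (\<Sum>\<^sub>\<infinity>k. complex_of_real (exp (- pi * t * form_value z k))) - (\<Sum>\<^sub>\<infinity>k\<in>{(0, 0)}. complex_of_real (exp (- pi * t * form_value z k)))"
    by (rule infsum_Diff[OF s]) simp_all
  then show "(\<Sum>\<^sub>\<infinity>k\<in>nonzero_pairs. complex_of_real (exp (- pi * t * form_value z k)))
    = (\<Sum>\<^sub>\<infinity>k. complex_of_real (exp (- pi * t * form_value z k))) - 1"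
    by (simp add: nonzero_pairs_def form_value_def)
  show "(\<lambda>k. exp (- pi * t * form_value z k)) summable_on nonzero_pairs"
    by (rule summable_on_subset_banach[OF summable_theta[OF z t]]) simp
qed

text \<open>Each term of the series, times \<pi>^(-s) Gamma s, is the integral of J over t > 0. It
  differs from the folded kernel by d, which lives on (0, 1). Summed over the lattice, d collapses
  by the theta transformation to t^(s - 2) - t^(s - 1), the trace of the omitted pair (0, 0), with
  integral 1 / (s - 1) - 1 / s. Only d has to be summed under the integral sign.\<close>

lemma completed_eisenstein_eq:
  assumes z: "Im z > 0" and s: "Re s > 1"
  shows "s * (s - 1) * complex_of_real pi powr (- s) * Gamma s * E0 z s
    = completed_eisenstein (of_real (Re z), of_real (Im z), s)"
proof -
  define P where "P = (complex_of_real (Re z), complex_of_real (Im z), s)"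
  define Q where "Q = form_value z"
  let ?X = nonzero_pairs
  have P: "P \<in> form_domain" "form3 k P = of_real (Q k)" for k
    using real_point_form[OF z] by (simp_all add: P_def Q_def)
  have Ps: "snd (snd P) = s" by (simp add: P_def)
  have Q: "Q k > 0" if "k \<in> ?X" for k unfolding Q_def by (rule form_value_pos[OF z that])
  have s0: "Re s > 0" using s by simp
  define J where "J = (\<lambda>k t. indicator {0<..} t *\<^sub>R (of_real t powr (s - 1) * of_real (exp (- (pi * Q k) * t))) :: complex)"
  define d where "d = (\<lambda>k t. J k t - mellin_kernel k t P)"
  have J: "has_bochner_integral lborel (J k) (Gamma s * of_real (pi * Q k) powr (- s))" if "k \<in> ?X" for k
    unfolding J_def by (rule gamma_integral_scaled[OF _ s0]) (use Q[OF that] in simp)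
  have Jn: "(\<integral>t. norm (J k t) \<partial>lborel) = norm (Gamma (complex_of_real (Re s))) * (pi powr (- Re s) * Q k powr (- Re s))" if k: "k \<in> ?X" for k
  proof -
    have "has_bochner_integral lborel (\<lambda>t. indicator {0<..} t *\<^sub>R (of_real t powr (of_real (Re s) - 1) * of_real (exp (- (pi * Q k) * t))))
       (Gamma (complex_of_real (Re s)) * of_real (pi * Q k) powr (- of_real (Re s)))"
      by (rule gamma_integral_scaled) (use Q[OF k] s0 in simp_all)
    moreover have "indicator {0<..} t *\<^sub>R (of_real t powr (of_real (Re s) - 1) * of_real (exp (- (pi * Q k) * t))) = complex_of_real (norm (J k t))" for t
    proof (cases "t > 0")
      case True
      have "complex_of_real t powr (of_real (Re s) - 1) = of_real (t powr (Re s - 1))"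
        using True powr_of_real[of t "Re s - 1"] by simp
      then show ?thesis using True by (simp add: J_def norm_mult norm_powr_real_powr)
    qed (simp add: J_def)
    ultimately have "complex_of_real (\<integral>t. norm (J k t) \<partial>lborel) = Gamma (complex_of_real (Re s)) * of_real (pi * Q k) powr (- of_real (Re s))"
      by (simp add: has_bochner_integral_iff)
    then have "norm (complex_of_real (\<integral>t. norm (J k t) \<partial>lborel)) = norm (Gamma (complex_of_real (Re s)) * of_real (pi * Q k) powr (- of_real (Re s)))"
      by (rule arg_cong)
    then show ?thesis using Q[OF k]
      by (simp add: norm_mult norm_powr_real_powr powr_mult del: of_real_mult)
  qed
  have ker: "integrable lborel (\<lambda>t. mellin_kernel k t P)" if "k \<in> ?X" for k
    by (rule integrable_mellin_kernel[OF P(1) that])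
  have dint: "integrable lborel (d k)" if "k \<in> ?X" for k
    unfolding d_def using J[OF that] ker[OF that] by (intro Bochner_Integration.integrable_diff) (auto simp: has_bochner_integral_iff)
  \<comment> \<open>For t \<ge> 1 the kernel is J itself, so only (0, 1) contributes.\<close>
  have dpt: "d k t = indicator {0<..<1} t *\<^sub>R (of_real t powr (s - 1) * of_real (exp (- pi * t * Q k))
      - of_real t powr (s - 2) * of_real (exp (- pi * (1 / t) * Q k)))" for k t
  proof -
    have e: "of_real t powr (s - c) = exp ((s - c) * of_real (ln t))" if "t > 0" for c
      using that by (simp add: powr_def Ln_of_real)
    consider "t \<le> 0" | "0 < t" "t < 1" | "t \<ge> 1" by linarith
    then show ?thesis
      by cases (simp_all add: d_def J_def mellin_kernel_def P Ps e exp_of_real[symmetric] mult_ac)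
  qed
  \<comment> \<open>Here Re s > 1 enters: the norms of J integrate to a multiple of Q^(- Re s), the
    terms of a convergent Eisenstein series.\<close>
  have dsum: "(\<lambda>k. \<integral>t. norm (d k t) \<partial>lborel) summable_on ?X"
  proof (rule summable_on_comparison_test)
    show "(\<lambda>k. norm (Gamma (complex_of_real (Re s))) * (pi powr (- Re s) * Q k powr (- Re s)) + (\<integral>t. norm (mellin_kernel k t P) \<partial>lborel)) summable_on ?X"
      unfolding Q_def
      by (intro summable_on_add summable_on_cmult_right form_value_powr_summable z s summable_mellin(2) P)
    fix k assume k: "k \<in> ?X"
    have Ji: "integrable lborel (J k)" using J[OF k] by (simp add: has_bochner_integral_iff)
    have "(\<integral>t. norm (d k t) \<partial>lborel) \<le> (\<integral>t. norm (J k t) + norm (mellin_kernel k t P) \<partial>lborel)"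
      unfolding d_def
      by (rule integral_mono) (auto intro!: Bochner_Integration.integrable_add integrable_norm Bochner_Integration.integrable_diff Ji ker k norm_triangle_ineq4)
    also have "\<dots> = (\<integral>t. norm (J k t) \<partial>lborel) + (\<integral>t. norm (mellin_kernel k t P) \<partial>lborel)"
      by (intro Bochner_Integration.integral_add integrable_norm Ji ker k)
    finally show "(\<integral>t. norm (d k t) \<partial>lborel) \<le> norm (Gamma (complex_of_real (Re s))) * (pi powr (- Re s) * Q k powr (- Re s)) + (\<integral>t. norm (mellin_kernel k t P) \<partial>lborel)"
      by (simp only: Jn[OF k])
  qed simp
  have theta_s: "(\<lambda>k. c * complex_of_real (exp (- pi * u * Q k))) summable_on ?X"
    "(\<lambda>k. norm (c * complex_of_real (exp (- pi * u * Q k)))) summable_on ?X" if "u > 0" for c u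
  proof -
    have "(\<lambda>k. norm c * exp (- pi * u * Q k)) summable_on ?X"
      unfolding Q_def by (intro summable_on_cmult_right theta_nonzero_pairs(2) z that)
    then show "(\<lambda>k. norm (c * complex_of_real (exp (- pi * u * Q k)))) summable_on ?X" by (simp add: norm_mult)
    then show "(\<lambda>k. c * complex_of_real (exp (- pi * u * Q k))) summable_on ?X" by (rule abs_summable_summable)
  qed
  have dptsum: "(\<lambda>k. norm (d k t)) summable_on ?X" for t
  proof (cases "0 < t \<and> t < 1")
    case True
    show ?thesis
    proof (rule summable_on_comparison_test)
      show "(\<lambda>k. norm (of_real t powr (s - 1) * complex_of_real (exp (- pi * t * Q k)))
        + norm (of_real t powr (s - 2) * complex_of_real (exp (- pi * (1 / t) * Q k)))) summable_on ?X"
        using True by (intro summable_on_add theta_s) auto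
      show "norm (d k t) \<le> norm (of_real t powr (s - 1) * complex_of_real (exp (- pi * t * Q k)))
        + norm (of_real t powr (s - 2) * complex_of_real (exp (- pi * (1 / t) * Q k)))" for k
        unfolding dpt using True by (simp add: norm_triangle_ineq4 del: norm_mult)
    qed simp
  next
    case False
    then have "d k t = 0" for k unfolding dpt by auto
    then show ?thesis by simp
  qed
  \<comment> \<open>The closed interval on the right is harmless: at t = 0 both powers are 0 by
    convention, and at t = 1 they cancel.\<close>
  have dval: "(\<Sum>\<^sub>\<infinity>k\<in>?X. d k t) = indicator {0..1} t *\<^sub>R (of_real t powr ((s - 1) - 1)) - indicator {0..1} t *\<^sub>R (of_real t powr (s - 1))" for t
  proof (cases "0 < t \<and> t < 1")
    case True
    define \<Theta> where "\<Theta> = (\<Sum>\<^sub>\<infinity>k. complex_of_real (exp (- pi * t * form_value z k)))"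
    have tt: "of_real t powr (s - 2) * of_real t = (of_real t powr (s - 1) :: complex)"
    proof -
      have "of_real t powr (s - 1) = of_real t powr ((s - 2) + 1)" by simp
      also have "\<dots> = of_real t powr (s - 2) * of_real t powr (1 :: complex)" by (rule powr_add)
      finally show ?thesis using True by simp
    qed
    have "(\<Sum>\<^sub>\<infinity>k\<in>?X. d k t) = (\<Sum>\<^sub>\<infinity>k\<in>?X. of_real t powr (s - 1) * of_real (exp (- pi * t * Q k))
      + (- (of_real t powr (s - 2))) * of_real (exp (- pi * (1 / t) * Q k)))"
      unfolding dpt using True by simp
    also have "\<dots> = (\<Sum>\<^sub>\<infinity>k\<in>?X. of_real t powr (s - 1) * of_real (exp (- pi * t * Q k)))
      + (\<Sum>\<^sub>\<infinity>k\<in>?X. (- (of_real t powr (s - 2))) * of_real (exp (- pi * (1 / t) * Q k)))"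
      by (rule infsum_add; rule theta_s(1)) (use True in simp_all)
    also have "\<dots> = of_real t powr (s - 1) * (\<Sum>\<^sub>\<infinity>k\<in>?X. of_real (exp (- pi * t * Q k)))
      + (- (of_real t powr (s - 2))) * (\<Sum>\<^sub>\<infinity>k\<in>?X. of_real (exp (- pi * (1 / t) * Q k)))"
      by (simp only: infsum_cmult_right')
    \<comment> \<open>\<Theta> includes the pair (0, 0), whence the two subtracted 1s. By the theta
      transformation the terms with \<Theta> cancel and only these remain.\<close>
    also have "\<dots> = of_real t powr (s - 1) * (\<Theta> - 1) - of_real t powr (s - 2) * (of_real t * \<Theta> - 1)"
      using True theta_nonzero_pairs(1)[OF z, of t] theta_nonzero_pairs(1)[OF z, of "1 / t"] theta_transformation[OF z, of t]
      by (simp add: Q_def \<Theta>_def)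
    also have "\<dots> = of_real t powr (s - 2) - of_real t powr (s - 1)"
      by (simp add: right_diff_distrib flip: tt mult.assoc)
    finally show ?thesis using True by simp
  next
    case False
    then have "(\<Sum>\<^sub>\<infinity>k\<in>?X. d k t) = 0" unfolding dpt by auto
    moreover have "indicator {0..1} t *\<^sub>R (of_real t powr ((s - 1) - 1)) - indicator {0..1} t *\<^sub>R (of_real t powr (s - 1)) = (0 :: complex)"
      using False by (cases "t = 0 \<or> t = 1") (auto simp: indicator_def)
    ultimately show ?thesis by simp
  qed
  have "(\<Sum>\<^sub>\<infinity>k\<in>?X. \<integral>t. d k t \<partial>lborel) = (\<integral>t. (\<Sum>\<^sub>\<infinity>k\<in>?X. d k t) \<partial>lborel)"
    by (rule infsum_integral_swap(1)[OF _ dint dsum dptsum]) simp_all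
  also have "\<dots> = 1 / (s - 1) - 1 / s"
    unfolding dval
    by (rule has_bochner_integral_integral_eq[OF has_bochner_integral_diff[OF has_bochner_integral_powr_unit has_bochner_integral_powr_unit]])
      (use s in simp_all)
  finally have swap: "(\<Sum>\<^sub>\<infinity>k\<in>?X. \<integral>t. d k t \<partial>lborel) = 1 / (s - 1) - 1 / s" .
  have dk: "(\<integral>t. d k t \<partial>lborel) + mellin k P = Gamma s * of_real (pi * Q k) powr (- s)" if k: "k \<in> ?X" for k
    unfolding d_def mellin_def using J[OF k] ker[OF k]
    by (subst Bochner_Integration.integral_diff) (auto simp: has_bochner_integral_iff)
  have "(\<Sum>\<^sub>\<infinity>k\<in>?X. Gamma s * of_real (pi * Q k) powr (- s)) = (\<Sum>\<^sub>\<infinity>k\<in>?X. (\<integral>t. d k t \<partial>lborel) + mellin k P)"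
    by (rule infsum_cong) (simp add: dk)
  also have "\<dots> = (\<Sum>\<^sub>\<infinity>k\<in>?X. \<integral>t. d k t \<partial>lborel) + (\<Sum>\<^sub>\<infinity>k\<in>?X. mellin k P)"
  proof (rule infsum_add)
    show "(\<lambda>k. mellin k P) summable_on ?X" by (rule abs_summable_summable[OF summable_mellin(1)[OF P(1)]])
    show "(\<lambda>k. \<integral>t. d k t \<partial>lborel) summable_on ?X"
      by (rule abs_summable_summable, rule summable_on_comparison_test[OF dsum]) (auto intro: integral_norm_bound)
  qed
  finally have total: "(\<Sum>\<^sub>\<infinity>k\<in>?X. Gamma s * of_real (pi * Q k) powr (- s)) = 1 / (s - 1) - 1 / s + mellin_sum P"
    unfolding swap mellin_sum_eq[OF P(1)] .
  have "complex_of_real pi powr (- s) * Gamma s * (\<Sum>\<^sub>\<infinity>k\<in>?X. of_real (Q k) powr (- s)) = (\<Sum>\<^sub>\<infinity>k\<in>?X. Gamma s * of_real (pi * Q k) powr (- s))"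
  proof -
    have "(\<Sum>\<^sub>\<infinity>k\<in>?X. Gamma s * of_real (pi * Q k) powr (- s)) = (\<Sum>\<^sub>\<infinity>k\<in>?X. (complex_of_real pi powr (- s) * Gamma s) * of_real (Q k) powr (- s))"
    proof (rule infsum_cong)
      fix k assume "k \<in> ?X"
      from Q[OF this] show "Gamma s * of_real (pi * Q k) powr (- s) = (complex_of_real pi powr (- s) * Gamma s) * of_real (Q k) powr (- s)"
        by (simp add: powr_times_real)
    qed
    then show ?thesis by (simp only: infsum_cmult_right')
  qed
  then have "s * (s - 1) * complex_of_real pi powr (- s) * Gamma s * E0 z s = s * (s - 1) * (1 / 2 * (1 / (s - 1) - 1 / s + mellin_sum P))"
    unfolding E0_eq_form_value[OF z] total Q_def[symmetric] by (simp add: mult_ac)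
  also have "\<dots> = completed_eisenstein P"
  proof -
    have "s \<noteq> 0" "s - 1 \<noteq> 0" using s by auto
    then show ?thesis by (simp add: completed_eisenstein_def P_def field_simps)
  qed
  finally show ?thesis by (simp add: P_def)
qed

lemma completed_eisenstein_entire:
  assumes "z \<in> upper_half"
  shows "(\<lambda>s. completed_eisenstein (of_real (Re z), of_real (Im z), s)) holomorphic_on UNIV"
  unfolding holomorphic_on_open[OF open_UNIV]
proof
  fix s
  have "((\<lambda>t. completed_eisenstein ((of_real (Re z), of_real (Im z), 0) + axis_s t)) has_field_derivative
     pderiv3 axis_s completed_eisenstein ((of_real (Re z), of_real (Im z), 0) + axis_s s)) (at s)"
    by (rule pderiv3_slice[OF holomorphic3_on_completed_eisenstein axes_axis(3)])
      (use assms in \<open>simp add: axis_s_def real_point_form upper_half_def\<close>)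
  then show "\<exists>f'. ((\<lambda>s. completed_eisenstein (of_real (Re z), of_real (Im z), s)) has_field_derivative f') (at s)"
    by (auto simp: axis_s_def)
qed

lemma entire_eqI:
  assumes "f holomorphic_on UNIV" "g holomorphic_on UNIV" "\<And>s. Re s > 1 \<Longrightarrow> f s = g s"
  shows "f = g"
proof
  fix s
  have "{s. Re s > 1} \<noteq> {}" by (auto intro!: exI[of _ 2])
  then show "f s = g s"
    using analytic_continuation_open[OF open_halfspace_Re_gt open_UNIV _ connected_UNIV subset_UNIV assms(1,2), of 1 s] assms(3)
    by simp
qed

text \<open>Existence is \<open>completed_eisenstein\<close>, uniqueness the identity theorem
  applied on Re s > 1. The prescribed value 0 off the half-plane makes the described function unique
  as a whole, so \<open>THE\<close> is resolved.\<close>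

lemma EE0_eq: "EE0 z = (if z \<in> upper_half then (\<lambda>s. completed_eisenstein (of_real (Re z), of_real (Im z), s)) else (\<lambda>s. 0))"
proof -
  define G where "G = (\<lambda>z. if z \<in> upper_half then (\<lambda>s. completed_eisenstein (of_real (Re z), of_real (Im z), s)) else (\<lambda>s. 0))"
  define Pr where "Pr = (\<lambda>G. \<forall>z. (z \<in> upper_half \<longrightarrow> G z holomorphic_on UNIV \<and>
            (\<forall>s. Re s > 1 \<longrightarrow> G z s = s * (s - 1) * complex_of_real pi powr (- s) * Gamma s * E0 z s))
          \<and> (z \<notin> upper_half \<longrightarrow> G z = (\<lambda>s. 0)))"
  have "Pr G" unfolding Pr_def G_def
    using completed_eisenstein_entire completed_eisenstein_eq by (simp add: upper_half_def)
  moreover have "G' = G" if "Pr G'" for G'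
  proof
    fix z
    show "G' z = G z"
    proof (cases "z \<in> upper_half")
      case True
      show ?thesis
        by (rule entire_eqI) (use that \<open>Pr G\<close> True in \<open>simp_all add: Pr_def\<close>)
    next
      case False
      then show ?thesis using that \<open>Pr G\<close> by (simp add: Pr_def)
    qed
  qed
  ultimately have "(THE G. Pr G) = G" by (rule the_equality)
  then show ?thesis by (simp add: EE0_def Pr_def G_def)
qed

section \<open>The Laplace equation of the Eisenstein series\<close>

lemma pderiv3_cong:
  assumes S: "open S" and A: "A \<in> axes" and p: "p \<in> S" and eq: "\<And>q. q \<in> S \<Longrightarrow> u q = v q"
  shows "pderiv3 A u p = pderiv3 A v p"
proof -
  obtain r where r: "r > 0" "ball p r \<subseteq> S" using openE[OF S p] by blast
  have "\<forall>\<^sub>F t in nhds 0. u (p + A t) = v (p + A t)"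
    unfolding eventually_nhds
  proof (intro exI[of _ "ball 0 r"] conjI ballI)
    fix t :: complex assume "t \<in> ball 0 r"
    then have "p + A t \<in> ball p r" using axes_norm[OF A, of t] by (simp add: dist_norm)
    then show "u (p + A t) = v (p + A t)" using r eq by blast
  qed (use r in auto)
  then show ?thesis unfolding pderiv3_def by (rule deriv_cong_ev) simp
qed

text \<open>Domination passes from a family to its A-derivatives at the cost of halving the radius
  and dividing by it, so differentiation under the sum can be done twice.\<close>

lemma pderiv3_twice_sum:
  fixes f :: "'a \<Rightarrow> c3 \<Rightarrow> complex"
  assumes S: "open S" and A: "A \<in> axes" and p: "p \<in> S"
    and hol: "\<And>k. k \<in> X \<Longrightarrow> f k holomorphic3_on S"
    and dom: "\<And>p. p \<in> S \<Longrightarrow> \<exists>r>0. \<exists>g. ball p r \<subseteq> S \<and> integrable (count_space X) g \<and>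
      (\<forall>q\<in>ball p r. \<forall>k\<in>X. norm (f k q) \<le> g k)"
  shows "pderiv3 A (pderiv3 A (\<lambda>p. \<integral>k. f k p \<partial>count_space X)) p = (\<integral>k. pderiv3 A (pderiv3 A (f k)) p \<partial>count_space X)"
    "integrable (count_space X) (\<lambda>k. pderiv3 A (pderiv3 A (f k)) p)"
proof -
  have D: "\<exists>r>0. \<exists>g. ball p r \<subseteq> S \<and> integrable (count_space X) g \<and>
      (\<forall>q\<in>ball p r. \<forall>k\<in>X. norm (pderiv3 A (h k) q) \<le> g k)"
    if h: "\<And>k. k \<in> X \<Longrightarrow> h k holomorphic3_on S" and p: "p \<in> S"
      and dom: "\<exists>r>0. \<exists>g. ball p r \<subseteq> S \<and> integrable (count_space X) g \<and> (\<forall>q\<in>ball p r. \<forall>k\<in>X. norm (h k q) \<le> g k)"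
    for h :: "'a \<Rightarrow> c3 \<Rightarrow> complex" and p
  proof -
    from dom obtain r' g where r': "r' > 0" "ball p r' \<subseteq> S" "integrable (count_space X) g"
      and g: "\<And>q k. q \<in> ball p r' \<Longrightarrow> k \<in> X \<Longrightarrow> norm (h k q) \<le> g k" by blast
    define r where "r = r' / 2"
    have r: "r > 0" "ball p (r + r) = ball p r'" using r' by (simp_all add: r_def)
    have "norm (pderiv3 A (h k) q) \<le> g k / r" if "q \<in> ball p r" "k \<in> X" for q k
    proof (rule norm_pderiv3_le[OF h[OF that(2)] A r(1)])
      fix t :: complex assume t: "norm t \<le> r"
      have "q + A t \<in> ball p r'" unfolding r(2)[symmetric] by (rule axes_ball[OF A that(1) t])
      then show "q + A t \<in> S" "norm (h k (q + A t)) \<le> g k" using r'(2) g that(2) by blast+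
    qed
    moreover have "ball p r \<subseteq> S" using r' r_def subset_ball[of r r' p] by auto
    moreover have "integrable (count_space X) (\<lambda>k. g k / r)" using r'(3) by simp
    ultimately show ?thesis using r(1) by (intro exI[of _ r] conjI exI[of _ "\<lambda>k. g k / r"]) auto
  qed
  have h1: "pderiv3 A (f k) holomorphic3_on S" if "k \<in> X" for k
    by (rule holomorphic3_on_pderiv3(1)[OF hol[OF that] S A])
  have d1: "\<exists>r>0. \<exists>g. ball p r \<subseteq> S \<and> integrable (count_space X) g \<and>
      (\<forall>q\<in>ball p r. \<forall>k\<in>X. norm (pderiv3 A (f k) q) \<le> g k)" if "p \<in> S" for p
    by (rule D[OF hol that dom[OF that]])
  have I: "pderiv3 A (\<lambda>p. \<integral>k. h k p \<partial>count_space X) q = (\<integral>k. pderiv3 A (h k) q \<partial>count_space X)"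
    if h: "\<And>k. k \<in> X \<Longrightarrow> h k holomorphic3_on S"
      and d: "\<And>p. p \<in> S \<Longrightarrow> \<exists>r>0. \<exists>g. ball p r \<subseteq> S \<and> integrable (count_space X) g \<and>
        (\<forall>q\<in>ball p r. \<forall>k\<in>X. norm (h k q) \<le> g k)" and q: "q \<in> S" for h q
  proof (rule pderiv3_integral[OF S _ _ _ A q])
    show "h k holomorphic3_on S" if "k \<in> space (count_space X)" for k
      by (rule h) (use that in simp)
    show "\<exists>r>0. \<exists>g. ball p r \<subseteq> S \<and> integrable (count_space X) g \<and>
        (\<forall>q\<in>ball p r. \<forall>k\<in>space (count_space X). norm (h k q) \<le> g k)" if "p \<in> S" for p
      unfolding space_count_space by (rule d[OF that])
  qed simp
  have "pderiv3 A (\<lambda>p. \<integral>k. f k p \<partial>count_space X) q = (\<integral>k. pderiv3 A (f k) q \<partial>count_space X)" if "q \<in> S" for q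
    by (rule I[OF hol dom that])
  from pderiv3_cong[OF S A p this]
  have "pderiv3 A (pderiv3 A (\<lambda>p. \<integral>k. f k p \<partial>count_space X)) p = pderiv3 A (\<lambda>q. \<integral>k. pderiv3 A (f k) q \<partial>count_space X) p" .
  also have "\<dots> = (\<integral>k. pderiv3 A (pderiv3 A (f k)) p \<partial>count_space X)"
    by (rule I[OF h1 d1 p])
  finally show "pderiv3 A (pderiv3 A (\<lambda>p. \<integral>k. f k p \<partial>count_space X)) p = (\<integral>k. pderiv3 A (pderiv3 A (f k)) p \<partial>count_space X)" .
  have "\<exists>r>0. \<exists>g. ball p r \<subseteq> S \<and> integrable (count_space X) g \<and>
      (\<forall>q\<in>ball p r. \<forall>k\<in>X. norm (pderiv3 A (pderiv3 A (f k)) q) \<le> g k)"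
    by (rule D[OF h1 p d1[OF p]])
  then obtain r g where r: "r > 0" and g: "integrable (count_space X) g"
    and b: "\<forall>q\<in>ball p r. \<forall>k\<in>X. norm (pderiv3 A (pderiv3 A (f k)) q) \<le> g k" by (elim exE conjE)
  show "integrable (count_space X) (\<lambda>k. pderiv3 A (pderiv3 A (f k)) p)"
  proof (rule Bochner_Integration.integrable_bound[OF g])
    show "AE k in count_space X. norm (pderiv3 A (pderiv3 A (f k)) p) \<le> norm (g k)"
      unfolding AE_count_space
    proof
      fix k assume "k \<in> X"
      then have "norm (pderiv3 A (pderiv3 A (f k)) p) \<le> g k" using b r by simp
      also have "g k \<le> norm (g k)" by simp
      finally show "norm (pderiv3 A (pderiv3 A (f k)) p) \<le> norm (g k)" .
    qed
  qed simp
qed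

section \<open>The Eisenstein series at complex points, for Re s > 1\<close>

definition eisenstein_domain :: "c3 set" where
  "eisenstein_domain = form_domain \<inter> {p. Re (snd (snd p)) > 1}"

lemma open_eisenstein_domain: "open eisenstein_domain"
  unfolding eisenstein_domain_def by (intro open_Int open_form_domain open_Collect_less continuous_intros)

text \<open>The power of \<open>form3\<close> with exponent -s through the principal logarithm,
  which is holomorphic here because \<open>form3\<close> stays in the right half-plane for nonzero
  pairs.\<close>

definition eisenstein_term :: "int \<times> int \<Rightarrow> c3 \<Rightarrow> complex" where
  "eisenstein_term k p = exp (- snd (snd p) * Ln (form3 k p))"

lemma Re_form3_pos:
  assumes "p \<in> form_domain" "k \<in> nonzero_pairs"
  shows "Re (form3 k p) > 0"
proof -
  have "0 < form_min p * square_norm k"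
    using form_min_pos[OF assms(1)] square_norm_ge_1[OF assms(2)] by (intro mult_pos_pos) auto
  then show ?thesis using Re_form3_ge[OF assms(1), of k] by linarith
qed

lemma holomorphic3_on_eisenstein_term:
  assumes k: "k \<in> nonzero_pairs"
  shows "eisenstein_term k holomorphic3_on form_domain"
proof -
  have "Ln holomorphic_on {w. Re w > 0}"
    by (intro holomorphic_intros) (auto elim!: nonpos_Reals_cases)
  then have L: "(\<lambda>p. Ln (form3 k p)) holomorphic3_on form_domain"
    by (rule holomorphic3_on_compose[OF holomorphic3_on_form3 _ open_halfspace_Re_gt]) (simp add: Re_form3_pos k)
  have "(\<lambda>p. (-1) * snd (snd p) * Ln (form3 k p)) holomorphic3_on form_domain"
    by (intro holomorphic3_on_mult holomorphic3_on_const holomorphic3_on_coord L)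
  from holomorphic3_on_compose[OF this holomorphic_on_exp open_UNIV]
  show ?thesis unfolding eisenstein_term_def[abs_def] by simp
qed

text \<open>|w^(-s)| = |w|^(- Re s) exp (Im s arg w). The argument contributes at most exp (R
  \<pi>), and |w| \<ge> \<kappa> N reduces the first factor to a multiple of N^(-\<sigma>).\<close>

lemma eisenstein_term_dominated:
  assumes p: "p \<in> eisenstein_domain"
  shows "\<exists>r>0. \<exists>g. ball p r \<subseteq> eisenstein_domain \<and> integrable (count_space nonzero_pairs) g \<and>
      (\<forall>q\<in>ball p r. \<forall>k\<in>nonzero_pairs. norm (eisenstein_term k q) \<le> g k)"
proof -
  have pf: "p \<in> form_domain" and s1: "Re (snd (snd p)) > 1" using p by (auto simp: eisenstein_domain_def)
  obtain r1 \<kappa>' R where r1: "r1 > 0" "\<kappa>' > 0" "R > 0" "ball p r1 \<subseteq> form_domain"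
    "\<And>q. q \<in> ball p r1 \<Longrightarrow> \<kappa>' \<le> form_min q" "\<And>q. q \<in> ball p r1 \<Longrightarrow> norm (snd (snd q)) \<le> R"
    by (rule form_domain_local[OF pf]) (rule that)
  define \<sigma> where "\<sigma> = (Re (snd (snd p)) + 1) / 2"
  have \<sigma>: "\<sigma> > 1" "Re (snd (snd p)) > \<sigma>" using s1 by (auto simp: \<sigma>_def)
  have "open {q :: c3. Re (snd (snd q)) > \<sigma>}" by (intro open_Collect_less continuous_intros)
  then obtain r2 where r2: "r2 > 0" "ball p r2 \<subseteq> {q. Re (snd (snd q)) > \<sigma>}"
    using openE[of "{q :: c3. Re (snd (snd q)) > \<sigma>}" p] \<sigma>(2) by blast
  define r where "r = min r1 r2"
  \<comment> \<open>Capped at 1 so that - ln \<kappa> \<ge> 0 and its factor Re s may be replaced by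
    the bound R.\<close>
  define \<kappa> where "\<kappa> = min \<kappa>' 1"
  have \<kappa>: "\<kappa> > 0" "\<kappa> \<le> 1" using r1 by (auto simp: \<kappa>_def)
  define C where "C = exp (R * (- ln \<kappa>) + R * pi)"
  have bound: "norm (eisenstein_term k q) \<le> C * square_norm k powr (- \<sigma>)" if q: "q \<in> ball p r" and k: "k \<in> nonzero_pairs" for q k
  proof -
    define s w N where "s = snd (snd q)" and "w = form3 k q" and "N = square_norm k"
    have N: "N \<ge> 1" unfolding N_def by (rule square_norm_ge_1[OF k])
    have q1: "q \<in> ball p r1" "q \<in> ball p r2" using q by (auto simp: r_def)
    have sR: "norm s \<le> R" unfolding s_def by (rule r1(6)[OF q1(1)])
    have sig: "Re s > \<sigma>" using r2(2) q1(2) by (auto simp: s_def)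
    have "\<kappa> * N \<le> form_min q * N" using r1(5)[OF q1(1)] N by (intro mult_right_mono) (auto simp: \<kappa>_def)
    also have "\<dots> \<le> Re w" unfolding N_def w_def using Re_form3_ge r1(4) q1(1) by blast
    also have "\<dots> \<le> norm w" by (rule complex_Re_le_cmod)
    finally have kN: "\<kappa> * N \<le> norm w" .
    have kN0: "\<kappa> * N > 0" using \<kappa> N by simp
    have w0: "w \<noteq> 0" using kN kN0 by auto
    have "ln (\<kappa> * N) \<le> ln (norm w)" using kN kN0 w0 by (subst ln_le_cancel_iff) auto
    then have ln: "ln \<kappa> + ln N \<le> ln (norm w)" using \<kappa> N by (simp add: ln_mult)
    have "- Re s * ln (norm w) \<le> - Re s * (ln \<kappa> + ln N)"
      using ln sig \<sigma> by (intro mult_left_mono_neg) auto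
    also have "\<dots> = Re s * (- ln \<kappa>) - Re s * ln N" by (simp add: algebra_simps)
    also have "Re s * (- ln \<kappa>) \<le> R * (- ln \<kappa>)"
      using sR complex_Re_le_cmod[of s] \<kappa> by (intro mult_right_mono) auto
    also have "R * (- ln \<kappa>) - Re s * ln N \<le> R * (- ln \<kappa>) - \<sigma> * ln N"
      using mult_right_mono[of \<sigma> "Re s" "ln N"] sig N by simp
    finally have a: "- Re s * ln (norm w) \<le> R * (- ln \<kappa>) - \<sigma> * ln N" by simp
    have "Im s * Im (Ln w) \<le> \<bar>Im s\<bar> * \<bar>Im (Ln w)\<bar>" by (simp flip: abs_mult)
    also have "\<dots> \<le> R * pi"
      using sR abs_Im_le_cmod[of s] mpi_less_Im_Ln[OF w0] Im_Ln_le_pi[OF w0] r1(3)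
      by (intro mult_mono) auto
    finally have b: "Im s * Im (Ln w) \<le> R * pi" .
    have "norm (eisenstein_term k q) = exp (- Re s * ln (norm w) + Im s * Im (Ln w))"
      using w0 by (simp add: eisenstein_term_def s_def[symmetric] w_def[symmetric])
    also have "\<dots> \<le> exp ((R * (- ln \<kappa>) - \<sigma> * ln N) + R * pi)" using a b by simp
    also have "\<dots> = C * N powr (- \<sigma>)" using N by (simp add: C_def powr_def flip: exp_add)
    finally show ?thesis by (simp add: N_def)
  qed
  have i: "integrable (count_space nonzero_pairs) (\<lambda>k. C * square_norm k powr (- \<sigma>))"
    by (rule integrable_count_space_real[OF summable_on_cmult_right[OF summable_square_norm_powr[OF \<sigma>(1)]]]) (simp add: C_def)
  have sub: "ball p r \<subseteq> eisenstein_domain"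
  proof
    fix q assume "q \<in> ball p r"
    then have "q \<in> ball p r1" "q \<in> ball p r2" by (simp_all add: r_def)
    then have "q \<in> form_domain" "Re (snd (snd q)) > \<sigma>" using r1(4) r2(2) by blast+
    then show "q \<in> eisenstein_domain" using \<sigma>(1) by (simp add: eisenstein_domain_def)
  qed
  show ?thesis
    by (rule exI[of _ r], rule conjI, use r1(1) r2(1) in \<open>simp add: r_def\<close>, rule exI, intro conjI ballI, rule sub, rule i, rule bound)
qed

definition eisenstein_sum :: "c3 \<Rightarrow> complex" where
  "eisenstein_sum p = (\<integral>k. eisenstein_term k p \<partial>count_space nonzero_pairs)"

lemma holomorphic3_on_eisenstein_sum: "eisenstein_sum holomorphic3_on eisenstein_domain"
  unfolding eisenstein_sum_def[abs_def]
proof (rule holomorphic3_on_integral[OF open_eisenstein_domain])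
  show "eisenstein_term k holomorphic3_on eisenstein_domain" if "k \<in> space (count_space nonzero_pairs)" for k
    by (rule holomorphic3_on_subset[OF holomorphic3_on_eisenstein_term]) (use that in \<open>auto simp: eisenstein_domain_def\<close>)
  show "\<exists>r>0. \<exists>g. ball p r \<subseteq> eisenstein_domain \<and> integrable (count_space nonzero_pairs) g \<and>
      (\<forall>q\<in>ball p r. \<forall>k\<in>space (count_space nonzero_pairs). norm (eisenstein_term k q) \<le> g k)" if "p \<in> eisenstein_domain" for p
    using eisenstein_term_dominated[OF that] by simp
qed simp

lemma power_function_derivatives:
  fixes g g1 :: "complex \<Rightarrow> complex"
  assumes g: "(g has_field_derivative g1 t) (at t)" and pos: "Re (g t) > 0"
  shows "((\<lambda>t. exp (- s * Ln (g t))) has_field_derivative - s * exp (- s * Ln (g t)) * g1 t * inverse (g t)) (at t)"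
    and "(g1 has_field_derivative g2) (at t) \<Longrightarrow>
      ((\<lambda>t. - s * exp (- s * Ln (g t)) * g1 t * inverse (g t)) has_field_derivative
        exp (- s * Ln (g t)) * (s * (s + 1) * (g1 t)^2 * (inverse (g t))^2 - s * g2 * inverse (g t))) (at t)"
proof -
  have nz: "g t \<notin> \<real>\<^sub>\<le>\<^sub>0" "g t \<noteq> 0" using pos by (auto elim!: nonpos_Reals_cases)
  have L: "((\<lambda>t. Ln (g t)) has_field_derivative g1 t * inverse (g t)) (at t)"
    using DERIV_chain2[OF has_field_derivative_Ln[OF nz(1)] g] by (simp add: mult.commute)
  from DERIV_chain2[OF DERIV_exp DERIV_cmult[OF L, of "- s"]]
  show E: "((\<lambda>t. exp (- s * Ln (g t))) has_field_derivative - s * exp (- s * Ln (g t)) * g1 t * inverse (g t)) (at t)"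
    by (simp add: mult_ac)
  assume g1: "(g1 has_field_derivative g2) (at t)"
  have I: "((\<lambda>t. inverse (g t)) has_field_derivative - (inverse (g t) * g1 t * inverse (g t))) (at t)"
    by (rule DERIV_inverse'[OF g nz(2)])
  from DERIV_mult[OF DERIV_mult[OF DERIV_cmult[OF E, of "- s"] g1] I]
  show "((\<lambda>t. - s * exp (- s * Ln (g t)) * g1 t * inverse (g t)) has_field_derivative
        exp (- s * Ln (g t)) * (s * (s + 1) * (g1 t)^2 * (inverse (g t))^2 - s * g2 * inverse (g t))) (at t)"
    by (rule DERIV_cong) (simp add: power2_eq_square algebra_simps)
qed

text \<open>The form q satisfies y^2 (q_x^2 + q_y^2) = q^2 and y^2 (q_xx + q_yy) = 2 q. Hence the
  operator multiplies q^(-s) by s (s + 1) - 2 s = s (s - 1).\<close>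

lemma eisenstein_term_laplace:
  assumes k: "k \<in> nonzero_pairs" and p: "p \<in> form_domain"
  shows "(fst (snd p))^2 * (pderiv3 axis_x (pderiv3 axis_x (eisenstein_term k)) p
      + pderiv3 axis_y (pderiv3 axis_y (eisenstein_term k)) p)
     = snd (snd p) * (snd (snd p) - 1) * eisenstein_term k p"
proof -
  define m n :: complex where "m = of_int (fst k)" and "n = of_int (snd k)"
  define q where "q = (\<lambda>p. form3 k p)"
  define qx where "qx = (\<lambda>p :: c3. 2 * m * (m * fst p + n) * inverse (fst (snd p)))"
  define qy where "qy = (\<lambda>p :: c3. m^2 - ((m * fst p + n) * inverse (fst (snd p)))^2)"
  define qxx where "qxx = (\<lambda>p :: c3. 2 * m^2 * inverse (fst (snd p)))"
  define qyy where "qyy = (\<lambda>p :: c3. 2 * (m * fst p + n)^2 * (inverse (fst (snd p)))^3)"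
  have y0: "fst (snd r) \<noteq> 0" if "r \<in> form_domain" for r using that by (simp add: form_domain_def)
  have pos: "Re (q r) > 0" if "r \<in> form_domain" for r unfolding q_def by (rule Re_form3_pos[OF that k])
  have dx: "((\<lambda>t. q (r + axis_x t)) has_field_derivative qx (r + axis_x 0)) (at 0)"
    and dxx: "((\<lambda>t. qx (r + axis_x t)) has_field_derivative qxx r) (at 0)"
    and dy: "((\<lambda>t. q (r + axis_y t)) has_field_derivative qy (r + axis_y 0)) (at 0)"
    and dyy: "((\<lambda>t. qy (r + axis_y t)) has_field_derivative qyy r) (at 0)" if r: "r \<in> form_domain" for r
    using y0[OF r] unfolding q_def form3_def m_def[symmetric] n_def[symmetric] qx_def qxx_def qy_def qyy_def axis_x_def axis_y_def
    by (auto intro!: derivative_eq_intros simp: power2_eq_square power3_eq_cube field_simps)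
  have D: "pderiv3 A (pderiv3 A (eisenstein_term k)) p = eisenstein_term k p *
      (snd (snd p) * (snd (snd p) + 1) * (q1 p)^2 * (inverse (q p))^2 - snd (snd p) * q2 p * inverse (q p))"
    if A: "A \<in> axes" and A0: "\<And>r t. snd (snd (r + A t)) = snd (snd r)"
      and d1: "\<And>r. r \<in> form_domain \<Longrightarrow> ((\<lambda>t. q (r + A t)) has_field_derivative q1 (r + A 0)) (at 0)"
      and d2: "\<And>r. r \<in> form_domain \<Longrightarrow> ((\<lambda>t. q1 (r + A t)) has_field_derivative q2 r) (at 0)" for A q1 q2
  proof -
    have z: "r + A 0 = r" for r using axes_0[OF A] by simp
    have e: "eisenstein_term k (r + A t) = exp (- snd (snd r) * Ln (q (r + A t)))" for r t
      unfolding eisenstein_term_def q_def A0 ..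
    have 1: "pderiv3 A (eisenstein_term k) r = - snd (snd r) * exp (- snd (snd r) * Ln (q r)) * q1 r * inverse (q r)" if r: "r \<in> form_domain" for r
      using power_function_derivatives(1)[where g = "\<lambda>t. q (r + A t)" and ?g1.0 = "\<lambda>t. q1 (r + A t)" and t = 0 and s = "snd (snd r)", OF d1[OF r]] pos[OF r]
      by (intro pderiv3_eqI) (simp add: e z)
    have "pderiv3 A (pderiv3 A (eisenstein_term k)) p =
        pderiv3 A (\<lambda>r. - snd (snd r) * exp (- snd (snd r) * Ln (q r)) * q1 r * inverse (q r)) p"
      by (rule pderiv3_cong[OF open_form_domain A p 1])
    also have "\<dots> = exp (- snd (snd p) * Ln (q p)) *
      (snd (snd p) * (snd (snd p) + 1) * (q1 p)^2 * (inverse (q p))^2 - snd (snd p) * q2 p * inverse (q p))"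
      using power_function_derivatives(2)[where g = "\<lambda>t. q (p + A t)" and ?g1.0 = "\<lambda>t. q1 (p + A t)" and t = 0 and s = "snd (snd p)", OF d1[OF p] _ d2[OF p]] pos[OF p]
      by (intro pderiv3_eqI, unfold A0) (simp add: z)
    finally show ?thesis by (simp add: eisenstein_term_def q_def)
  qed
  have X: "pderiv3 axis_x (pderiv3 axis_x (eisenstein_term k)) p = eisenstein_term k p *
      (snd (snd p) * (snd (snd p) + 1) * (qx p)^2 * (inverse (q p))^2 - snd (snd p) * qxx p * inverse (q p))"
    by (rule D[OF axes_axis(1) _ dx dxx]) (simp_all add: axis_x_def)
  have Y: "pderiv3 axis_y (pderiv3 axis_y (eisenstein_term k)) p = eisenstein_term k p *
      (snd (snd p) * (snd (snd p) + 1) * (qy p)^2 * (inverse (q p))^2 - snd (snd p) * qyy p * inverse (q p))"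
    by (rule D[OF axes_axis(2) _ dy dyy]) (simp_all add: axis_y_def)
  define x y s where "x = fst p" and "y = fst (snd p)" and "s = snd (snd p)"
  have y: "y \<noteq> 0" using y0[OF p] by (simp add: y_def)
  have q0: "q p \<noteq> 0" using pos[OF p] by auto
  have sq: "y^2 * ((qx p)^2 + (qy p)^2) = (q p)^2"
    using y unfolding q_def form3_def qx_def qy_def m_def[symmetric] n_def[symmetric] x_def[symmetric] y_def[symmetric]
    by (simp add: power2_eq_square field_simps)
  have lin: "y^2 * (qxx p + qyy p) = 2 * q p"
    using y unfolding q_def form3_def qxx_def qyy_def m_def[symmetric] n_def[symmetric] x_def[symmetric] y_def[symmetric]
    by (simp add: power2_eq_square power3_eq_cube field_simps)
  have "y^2 * (eisenstein_term k p * (s * (s + 1) * (qx p)^2 * (inverse (q p))^2 - s * qxx p * inverse (q p))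
      + eisenstein_term k p * (s * (s + 1) * (qy p)^2 * (inverse (q p))^2 - s * qyy p * inverse (q p)))
    = eisenstein_term k p * (s * (s + 1) * (y^2 * ((qx p)^2 + (qy p)^2)) * (inverse (q p))^2 - s * (y^2 * (qxx p + qyy p)) * inverse (q p))"
    by (simp add: algebra_simps)
  also have "\<dots> = eisenstein_term k p * (s * (s + 1) - s * 2)"
    unfolding sq lin using q0 by (simp add: power2_eq_square field_simps)
  also have "\<dots> = s * (s - 1) * eisenstein_term k p" by (simp add: algebra_simps)
  finally show ?thesis unfolding X Y y_def s_def .
qed

lemma eisenstein_sum_laplace:
  assumes p: "p \<in> eisenstein_domain"
  shows "(fst (snd p))^2 * (pderiv3 axis_x (pderiv3 axis_x eisenstein_sum) p
      + pderiv3 axis_y (pderiv3 axis_y eisenstein_sum) p)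
     = snd (snd p) * (snd (snd p) - 1) * eisenstein_sum p"
proof -
  have hol: "eisenstein_term k holomorphic3_on eisenstein_domain" if "k \<in> nonzero_pairs" for k
    by (rule holomorphic3_on_subset[OF holomorphic3_on_eisenstein_term[OF that]]) (auto simp: eisenstein_domain_def)
  note tw = pderiv3_twice_sum[OF open_eisenstein_domain _ p hol eisenstein_term_dominated]
  note X = tw[OF axes_axis(1)] and Y = tw[OF axes_axis(2)]
  have "(fst (snd p))^2 * (pderiv3 axis_x (pderiv3 axis_x eisenstein_sum) p + pderiv3 axis_y (pderiv3 axis_y eisenstein_sum) p)
    = (\<integral>k. (fst (snd p))^2 * (pderiv3 axis_x (pderiv3 axis_x (eisenstein_term k)) p
      + pderiv3 axis_y (pderiv3 axis_y (eisenstein_term k)) p) \<partial>count_space nonzero_pairs)"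
    unfolding eisenstein_sum_def[abs_def] using X Y by simp
  also have "\<dots> = (\<integral>k. snd (snd p) * (snd (snd p) - 1) * eisenstein_term k p \<partial>count_space nonzero_pairs)"
    by (rule Bochner_Integration.integral_cong) (use p in \<open>auto simp: eisenstein_term_laplace eisenstein_domain_def\<close>)
  also have "\<dots> = snd (snd p) * (snd (snd p) - 1) * eisenstein_sum p"
    unfolding eisenstein_sum_def by simp
  finally show ?thesis .
qed

section \<open>The Taylor coefficients at zero\<close>

lemma upper_half_form_domain:
  "z \<in> upper_half \<Longrightarrow> (of_real (Re z), of_real (Im z), s) \<in> form_domain"
  by (simp add: upper_half_def real_point_form)

lemma eisenstein_sum_real:
  assumes z: "Im z > 0" and s: "Re s > 1"
  shows "eisenstein_sum (of_real (Re z), of_real (Im z), s) = 2 * E0 z s"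
proof -
  have t: "eisenstein_term k (of_real (Re z), of_real (Im z), s) = of_real (form_value z k) powr (- s)" if "k \<in> nonzero_pairs" for k
    using form_value_pos[OF z that] by (simp add: eisenstein_term_def real_point_form[OF z] powr_def)
  have "(\<lambda>k. norm (eisenstein_term k (of_real (Re z), of_real (Im z), s))) summable_on nonzero_pairs"
  proof (rule summable_on_comparison_test[OF form_value_powr_summable[OF z s]])
    fix k assume k: "k \<in> nonzero_pairs"
    then show "norm (eisenstein_term k (of_real (Re z), of_real (Im z), s)) \<le> form_value z k powr (- Re s)"
      using form_value_pos[OF z k] by (simp add: t norm_powr_real_powr)
  qed simp
  from infsum_count_space(2)[OF this]
  have "eisenstein_sum (of_real (Re z), of_real (Im z), s) = (\<Sum>\<^sub>\<infinity>k\<in>nonzero_pairs. eisenstein_term k (of_real (Re z), of_real (Im z), s))"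
    by (simp add: eisenstein_sum_def)
  also have "\<dots> = (\<Sum>\<^sub>\<infinity>k\<in>nonzero_pairs. of_real (form_value z k) powr (- s))"
    by (rule infsum_cong) (rule t)
  finally show ?thesis by (simp add: E0_eq_form_value[OF z])
qed

lemma real_slice_entire:
  assumes w: "w holomorphic3_on form_domain" and z: "z \<in> upper_half"
  shows "((\<lambda>s. real_slice s w z) has_field_derivative real_slice s (pderiv3 axis_s w) z) (at s)"
    "(\<lambda>s. real_slice s w z) holomorphic_on UNIV"
proof -
  show D: "((\<lambda>s. real_slice s w z) has_field_derivative real_slice s (pderiv3 axis_s w) z) (at s)" for s
    using pderiv3_slice[OF w axes_axis(3), of "(of_real (Re z), of_real (Im z), 0)" s] upper_half_form_domain[OF z]
    by (simp add: axis_s_def real_slice_def)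
  then show "(\<lambda>s. real_slice s w z) holomorphic_on UNIV"
    unfolding holomorphic_on_open[OF open_UNIV] by blast
qed

lemma holomorphic3_on_pderiv3_funpow:
  assumes "w holomorphic3_on S" "open S" "A \<in> axes"
  shows "(pderiv3 A ^^ n) w holomorphic3_on S"
  by (induction n) (use assms holomorphic3_on_pderiv3(1) in auto)

lemma real_slice_higher_deriv:
  assumes w: "w holomorphic3_on form_domain" and z: "z \<in> upper_half"
  shows "(deriv ^^ n) (\<lambda>s. real_slice s w z) = (\<lambda>s. real_slice s ((pderiv3 axis_s ^^ n) w) z)"
proof (induction n)
  case (Suc n)
  show ?case
    using DERIV_imp_deriv[OF real_slice_entire(1)[OF holomorphic3_on_pderiv3_funpow[OF w open_form_domain axes_axis(3)] z]]
    by (simp add: Suc fun_eq_iff)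
qed simp

lemma pderiv3_funpow_commute:
  assumes w: "w holomorphic3_on S" and S: "open S" and A: "A \<in> axes" and B: "B \<in> axes" and p: "p \<in> S"
  shows "pderiv3 B ((pderiv3 A ^^ n) w) p = (pderiv3 A ^^ n) (pderiv3 B w) p"
  using p
proof (induction n arbitrary: p)
  case (Suc n)
  have "pderiv3 B ((pderiv3 A ^^ Suc n) w) p = pderiv3 A (pderiv3 B ((pderiv3 A ^^ n) w)) p"
    using holomorphic3_on_pderiv3(2)[OF holomorphic3_on_pderiv3_funpow[OF w S A] S A B Suc.prems] by simp
  also have "\<dots> = pderiv3 A ((pderiv3 A ^^ n) (pderiv3 B w)) p"
    by (rule pderiv3_cong[OF S A Suc.prems Suc.IH])
  finally show ?case by simp
qed simp

text \<open>For Re s > 1 the completed function is the series times a factor independent of z, so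
  the equation is inherited. Both sides are entire in s at fixed z, which extends it to every
  s.\<close>

lemma completed_eisenstein_laplace:
  assumes z: "z \<in> upper_half"
  shows "(of_real (Im z))^2 * (real_slice s (pderiv3 axis_x (pderiv3 axis_x completed_eisenstein)) z
      + real_slice s (pderiv3 axis_y (pderiv3 axis_y completed_eisenstein)) z)
    = s * (s - 1) * real_slice s completed_eisenstein z"
proof -
  let ?U = completed_eisenstein
  note U = holomorphic3_on_completed_eisenstein
  have xx: "pderiv3 axis_x (pderiv3 axis_x ?U) holomorphic3_on form_domain"
    and yy: "pderiv3 axis_y (pderiv3 axis_y ?U) holomorphic3_on form_domain"
    by (intro holomorphic3_on_pderiv3(1) open_form_domain axes_axis U)+
  let ?L = "\<lambda>s. (of_real (Im z))^2 * (real_slice s (pderiv3 axis_x (pderiv3 axis_x ?U)) z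
      + real_slice s (pderiv3 axis_y (pderiv3 axis_y ?U)) z)"
  have "?L = (\<lambda>s. s * (s - 1) * real_slice s ?U z)"
  proof (rule entire_eqI)
    show "?L holomorphic_on UNIV" "(\<lambda>s. s * (s - 1) * real_slice s ?U z) holomorphic_on UNIV"
      by (intro holomorphic_intros real_slice_entire(2) xx yy U z)+
    fix s :: complex assume s: "Re s > 1"
    define \<kappa> where "\<kappa> = s * (s - 1) * complex_of_real pi powr (- s) * Gamma s / 2"
    have inE: "(of_real (Re z), of_real (Im z), s) \<in> eisenstein_domain" if "z \<in> upper_half" for z
      using upper_half_form_domain[OF that] s by (simp add: eisenstein_domain_def)
    \<comment> \<open>The zero summand fits the equation to the two-term shape of
      \<open>laplacian_lincomb\<close>.\<close>
    have eq: "real_slice s ?U w = \<kappa> * real_slice s eisenstein_sum w + 0 * real_slice s eisenstein_sum w" if "w \<in> upper_half" for w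
      using completed_eisenstein_eq[of w s, symmetric] eisenstein_sum_real[of w s] s that
      by (simp add: real_slice_def \<kappa>_def upper_half_def mult_ac)
    have sm: "smooth_on_H (real_slice s eisenstein_sum)"
      by (rule smooth_on_H_real_slice[OF holomorphic3_on_eisenstein_sum open_eisenstein_domain inE])
    have "?L s = hyp_laplacian 0 (real_slice s ?U) z"
      by (rule laplacian_real_slice[OF U open_form_domain upper_half_form_domain z, symmetric])
    also have "\<dots> = hyp_laplacian 0 (\<lambda>w. \<kappa> * real_slice s eisenstein_sum w + 0 * real_slice s eisenstein_sum w) z"
      by (rule laplacian_cong[OF eq z])
    also have "\<dots> = \<kappa> * hyp_laplacian 0 (real_slice s eisenstein_sum) z"
      unfolding laplacian_lincomb[OF sm sm z] by simp
    also have "hyp_laplacian 0 (real_slice s eisenstein_sum) z = s * (s - 1) * real_slice s eisenstein_sum z"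
    proof -
      have "hyp_laplacian 0 (real_slice s eisenstein_sum) z = (of_real (Im z))^2 *
         (real_slice s (pderiv3 axis_x (pderiv3 axis_x eisenstein_sum)) z + real_slice s (pderiv3 axis_y (pderiv3 axis_y eisenstein_sum)) z)"
        by (rule laplacian_real_slice[OF holomorphic3_on_eisenstein_sum open_eisenstein_domain inE z])
      also have "\<dots> = s * (s - 1) * real_slice s eisenstein_sum z"
        using eisenstein_sum_laplace[OF inE[OF z]] by (simp add: real_slice_def)
      finally show ?thesis .
    qed
    also have "\<kappa> * (s * (s - 1) * real_slice s eisenstein_sum z) = s * (s - 1) * real_slice s ?U z"
      unfolding eq[OF z] by simp
    finally show "?L s = s * (s - 1) * real_slice s ?U z" .
  qed
  then show ?thesis by (rule fun_cong)
qed

lemma F_eq_real_slice: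
  assumes "z \<in> upper_half"
  shows "F n z = real_slice 0 ((pderiv3 axis_s ^^ n) completed_eisenstein) z / fact n"
proof -
  have "EE0 z = (\<lambda>s. real_slice s completed_eisenstein z)" using assms by (simp add: EE0_eq real_slice_def)
  then show ?thesis unfolding F_def
    by (simp add: real_slice_higher_deriv[OF holomorphic3_on_completed_eisenstein assms])
qed

text \<open>Leibniz' rule with the factor s, whose second derivative is 0. At n = 0 the truncated n
  - 1 is harmless because its coefficient is 0.\<close>

lemma higher_deriv_ident_mult:
  assumes "\<psi> holomorphic_on UNIV"
  shows "(deriv ^^ n) (\<lambda>s. s * \<psi> s) = (\<lambda>s. s * (deriv ^^ n) \<psi> s + of_nat n * (deriv ^^ (n - 1)) \<psi> s)"
proof (induction n)
  case (Suc n)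
  have D: "((deriv ^^ i) \<psi> has_field_derivative (deriv ^^ Suc i) \<psi> s) (at s)" for i s
    using holomorphic_derivI[OF holomorphic_higher_deriv[OF assms open_UNIV] open_UNIV UNIV_I, of i s] by simp
  show ?case
  proof
    fix s
    have n: "of_nat n * (deriv ^^ Suc (n - 1)) \<psi> s = of_nat n * (deriv ^^ n) \<psi> s" by (cases n) simp_all
    have "((\<lambda>s. s * (deriv ^^ n) \<psi> s + of_nat n * (deriv ^^ (n - 1)) \<psi> s) has_field_derivative
        (1 * (deriv ^^ n) \<psi> s + (deriv ^^ Suc n) \<psi> s * s) + of_nat n * (deriv ^^ Suc (n - 1)) \<psi> s) (at s)"
      by (intro DERIV_add DERIV_mult DERIV_ident D DERIV_cmult)
    from DERIV_imp_deriv[OF this] n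
    show "(deriv ^^ Suc n) (\<lambda>s. s * \<psi> s) s = s * (deriv ^^ Suc n) \<psi> s + of_nat (Suc n) * (deriv ^^ (Suc n - 1)) \<psi> s"
      by (simp add: Suc algebra_simps)
  qed
qed simp

text \<open>Multiplication by s^2 - s shifts Taylor coefficients by two and by one. The conditionals
  guard the truncated subtractions and keep the right side a combination of two terms, as
  \<open>laplacian_pow_lincomb\<close> expects.\<close>

lemma laplacian_F:
  assumes z: "z \<in> upper_half"
  shows "hyp_laplacian 0 (F n) z = (if n \<ge> 2 then 1 else 0) * F (n - 2) z + (if n \<ge> 1 then - 1 else 0) * F (n - 1) z"
proof -
  let ?U = completed_eisenstein
  note U = holomorphic3_on_completed_eisenstein
  define \<phi> where "\<phi> = (\<lambda>s. real_slice s ?U z)"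
  have phi: "\<phi> holomorphic_on UNIV" unfolding \<phi>_def by (rule real_slice_entire(2)[OF U z])
  have Fphi: "F i z = (deriv ^^ i) \<phi> 0 / fact i" for i
    unfolding F_eq_real_slice[OF z] \<phi>_def real_slice_higher_deriv[OF U z] by simp
  define W where "W = (pderiv3 axis_s ^^ n) ?U"
  have W: "W holomorphic3_on form_domain"
    unfolding W_def by (rule holomorphic3_on_pderiv3_funpow[OF U open_form_domain axes_axis(3)])
  \<comment> \<open>The Laplacian of a Taylor coefficient becomes a Taylor coefficient of the
    Laplacian, since derivatives in x and y commute with those in s.\<close>
  have second: "real_slice 0 (pderiv3 A (pderiv3 A W)) z = (deriv ^^ n) (\<lambda>s. real_slice s (pderiv3 A (pderiv3 A ?U)) z) 0"
    if A: "A \<in> axes" for A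
  proof -
    let ?P = "(of_real (Re z), of_real (Im z), 0)"
    note P = upper_half_form_domain[OF z, of 0]
    have dU: "pderiv3 A ?U holomorphic3_on form_domain" by (rule holomorphic3_on_pderiv3(1)[OF U open_form_domain A])
    have "pderiv3 A (pderiv3 A W) ?P = pderiv3 A ((pderiv3 axis_s ^^ n) (pderiv3 A ?U)) ?P"
      unfolding W_def
      by (rule pderiv3_cong[OF open_form_domain A P]) (rule pderiv3_funpow_commute[OF U open_form_domain axes_axis(3) A])
    also have "\<dots> = (pderiv3 axis_s ^^ n) (pderiv3 A (pderiv3 A ?U)) ?P"
      by (rule pderiv3_funpow_commute[OF dU open_form_domain axes_axis(3) A P])
    finally show ?thesis
      unfolding real_slice_higher_deriv[OF holomorphic3_on_pderiv3(1)[OF dU open_form_domain A] z]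
      by (simp add: real_slice_def)
  qed
  have sm: "smooth_on_H (real_slice 0 W)"
    by (rule smooth_on_H_real_slice[OF W open_form_domain upper_half_form_domain])
  let ?xx = "\<lambda>s. real_slice s (pderiv3 axis_x (pderiv3 axis_x ?U)) z"
  let ?yy = "\<lambda>s. real_slice s (pderiv3 axis_y (pderiv3 axis_y ?U)) z"
  have hol: "?xx holomorphic_on UNIV" "?yy holomorphic_on UNIV"
    by (intro real_slice_entire(2) holomorphic3_on_pderiv3(1) open_form_domain axes_axis U z)+
  have "hyp_laplacian 0 (F n) z = hyp_laplacian 0 (\<lambda>w. (1 / fact n) * real_slice 0 W w + 0 * real_slice 0 W w) z"
    by (rule laplacian_cong[OF _ z]) (simp add: F_eq_real_slice W_def)
  also have "\<dots> = (1 / fact n) * hyp_laplacian 0 (real_slice 0 W) z"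
    unfolding laplacian_lincomb[OF sm sm z] by simp
  also have "hyp_laplacian 0 (real_slice 0 W) z = (of_real (Im z))^2 *
      (real_slice 0 (pderiv3 axis_x (pderiv3 axis_x W)) z + real_slice 0 (pderiv3 axis_y (pderiv3 axis_y W)) z)"
    by (rule laplacian_real_slice[OF W open_form_domain upper_half_form_domain z])
  also have "\<dots> = (of_real (Im z))^2 * ((deriv ^^ n) ?xx 0 + (deriv ^^ n) ?yy 0)"
    by (simp only: second[OF axes_axis(1)] second[OF axes_axis(2)])
  also have "\<dots> = (deriv ^^ n) (\<lambda>s. (of_real (Im z))^2 * (?xx s + ?yy s)) 0"
  proof -
    have "(deriv ^^ n) (\<lambda>s. ?xx s + ?yy s) 0 = (deriv ^^ n) ?xx 0 + (deriv ^^ n) ?yy 0"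
      by (rule higher_deriv_add[OF hol open_UNIV UNIV_I])
    moreover have "(deriv ^^ n) (\<lambda>s. (of_real (Im z))^2 * (?xx s + ?yy s)) 0 = (of_real (Im z))^2 * (deriv ^^ n) (\<lambda>s. ?xx s + ?yy s) 0"
      by (rule higher_deriv_cmult[where A = UNIV]) (intro holomorphic_intros hol, simp_all)
    ultimately show ?thesis by simp
  qed
  \<comment> \<open>Nested as s (s \<phi> - \<phi>) so that the rule for the factor s applies
    twice.\<close>
  also have "(\<lambda>s. (of_real (Im z))^2 * (?xx s + ?yy s)) = (\<lambda>s. s * (s * \<phi> s - \<phi> s))"
    unfolding completed_eisenstein_laplace[OF z] \<phi>_def by (simp add: fun_eq_iff algebra_simps)
  also have "(deriv ^^ n) \<dots> 0 = of_nat n * (deriv ^^ (n - 1)) (\<lambda>s. s * \<phi> s - \<phi> s) 0"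
    by (subst higher_deriv_ident_mult) (auto intro!: holomorphic_intros phi)
  also have "(deriv ^^ (n - 1)) (\<lambda>s. s * \<phi> s - \<phi> s) 0 = (deriv ^^ (n - 1)) (\<lambda>s. s * \<phi> s) 0 - (deriv ^^ (n - 1)) \<phi> 0"
    by (rule higher_deriv_diff[where S = UNIV]) (auto intro!: holomorphic_intros phi)
  also have "(deriv ^^ (n - 1)) (\<lambda>s. s * \<phi> s) 0 = of_nat (n - 1) * (deriv ^^ (n - 1 - 1)) \<phi> 0"
    by (subst higher_deriv_ident_mult[OF phi]) simp
  finally have eq: "hyp_laplacian 0 (F n) z = 1 / fact n * (of_nat n * (of_nat (n - 1) * (deriv ^^ (n - 1 - 1)) \<phi> 0 - (deriv ^^ (n - 1)) \<phi> 0))" .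
  consider "n = 0" | "n = 1" | m where "n = Suc (Suc m)" by (metis One_nat_def not0_implies_Suc)
  then show ?thesis
  proof cases
    case 3
    have "fact n = of_nat n * (of_nat (n - 1) * (fact m :: complex))" "fact n = of_nat n * (fact (n - 1) :: complex)"
      unfolding 3 by simp_all
    then show ?thesis unfolding eq Fphi using 3 by (simp add: field_simps del: fact_Suc of_nat_Suc)
  qed (use eq in \<open>simp_all add: Fphi\<close>)
qed

lemma F_0: "z \<in> upper_half \<Longrightarrow> F 0 z = 1 / 2"
  by (simp add: F_eq_real_slice real_slice_def completed_eisenstein_def)

section \<open>Membership of the Taylor coefficients in the space of modular forms\<close>

lemma on_H_F: "on_H (F n)"
proof -
  have "(deriv ^^ n) (\<lambda>s. 0 :: complex) = (\<lambda>s. 0)" by (induction n) simp_all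
  then show ?thesis by (simp add: on_H_def F_def EE0_eq)
qed

lemma smooth_on_H_cong:
  assumes "smooth_on_H f" "\<And>z. z \<in> upper_half \<Longrightarrow> f z = g z"
  shows "smooth_on_H g"
  unfolding smooth_on_H_def
proof (intro allI ballI)
  fix bs z assume z: "z \<in> upper_half"
  have "iter_partials bs f w = iter_partials bs g w" if "w \<in> upper_half" for w
    by (rule iter_partials_cong[OF assms(2) that])
  then have "iter_partials bs f differentiable (at z) \<longleftrightarrow> iter_partials bs g differentiable (at z)"
    by (rule differentiable_cong_upper_half[OF _ z])
  then show "iter_partials bs g differentiable (at z)"
    using assms(1) z unfolding smooth_on_H_def by simp
qed

lemma smooth_on_H_F: "smooth_on_H (F n)"
proof (rule smooth_on_H_cong)
  show "smooth_on_H (\<lambda>z. (1 / fact n) * real_slice 0 ((pderiv3 axis_s ^^ n) completed_eisenstein) z)"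
    by (intro smooth_on_H_mult smooth_on_H_const
      smooth_on_H_real_slice[OF holomorphic3_on_pderiv3_funpow[OF holomorphic3_on_completed_eisenstein open_form_domain axes_axis(3)] open_form_domain]
      upper_half_form_domain)
qed (simp add: F_eq_real_slice)

text \<open>The matrix acts on the index as on a row vector from the right, and |c z + d|^2 cancels
  between the squared modulus and Im w.\<close>

lemma moebius_form_value:
  assumes z: "Im z > 0" and det: "a * d - b * c = (1 :: int)"
  defines "w \<equiv> (of_int a * z + of_int b) / (of_int c * z + of_int d)"
  shows "Im w > 0" "form_value w (m, n) = form_value z (m * a + n * c, m * b + n * d)"
proof -
  let ?D = "of_int c * z + of_int d :: complex"
  have D: "?D \<noteq> 0"
  proof
    assume "?D = 0"
    then have "of_int c * Im z = 0" "of_int c * Re z + of_int d = 0" by (simp_all add: complex_eq_iff)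
    then have "c = 0" "d = 0" using z by auto
    then show False using det by simp
  qed
  have fv: "form_value z k = (cmod (of_int (fst k) * z + of_int (snd k)))^2 / Im z" for z k
    by (simp add: form_value_def cmod_power2)
  have detr: "real_of_int a * real_of_int d - real_of_int b * real_of_int c = 1"
    using det by (metis of_int_1 of_int_diff of_int_mult)
  have "Im w = Im ((of_int a * z + of_int b) * cnj ?D) / (cmod ?D)^2"
    unfolding w_def by (simp add: complex_div_cnj[of _ ?D] Im_divide_of_real flip: of_real_power)
  also have "Im ((of_int a * z + of_int b) * cnj ?D) = (real_of_int a * real_of_int d - real_of_int b * real_of_int c) * Im z"
    by (simp add: algebra_simps)
  finally have Imw: "Im w = Im z / (cmod ?D)^2" using detr by simp
  then show "Im w > 0" using z D by simp
  have "of_int m * w + of_int n = (of_int (m * a + n * c) * z + of_int (m * b + n * d)) / ?D"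
    using D by (simp add: w_def field_simps)
  then show "form_value w (m, n) = form_value z (m * a + n * c, m * b + n * d)"
    unfolding fv Imw using z D by (simp add: norm_divide power_divide)
qed

text \<open>The index map permutes the nonzero pairs, with the inverse matrix as its inverse, so the
  series agree. \<open>entire_eqI\<close> carries this from Re s > 1 to the continuation, and
  thereby to all Taylor coefficients at once.\<close>

lemma EE0_moebius:
  assumes z: "z \<in> upper_half" and det: "a * d - b * c = (1 :: int)"
  shows "EE0 ((of_int a * z + of_int b) / (of_int c * z + of_int d)) = EE0 z"
proof -
  define w where "w = (of_int a * z + of_int b) / (of_int c * z + of_int d)"
  have Imz: "Im z > 0" using z by (simp add: upper_half_def)
  have Imw: "Im w > 0" and fw: "\<And>m n. form_value w (m, n) = form_value z (m * a + n * c, m * b + n * d)"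
    using moebius_form_value[OF Imz det] by (simp_all add: w_def)
  have w: "w \<in> upper_half" using Imw by (simp add: upper_half_def)
  have E0: "E0 w s = E0 z s" for s
  proof -
    let ?i = "\<lambda>(m, n). (d * m - c * n, a * n - b * m)" and ?j = "\<lambda>(m, n). (m * a + n * c, m * b + n * d)"
    have det': "a * d = 1 + b * c" using det by simp
    have inv: "d * (m * a + n * c) - c * (m * b + n * d) = m" "a * (m * b + n * d) - b * (m * a + n * c) = n"
      "(d * m - c * n) * a + (a * n - b * m) * c = m" "(d * m - c * n) * b + (a * n - b * m) * d = n" for m n
    proof -
      have "d * (m * a + n * c) - c * (m * b + n * d) = m * (a * d - b * c)"
        "a * (m * b + n * d) - b * (m * a + n * c) = n * (a * d - b * c)"
        "(d * m - c * n) * a + (a * n - b * m) * c = m * (a * d - b * c)"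
        "(d * m - c * n) * b + (a * n - b * m) * d = n * (a * d - b * c)" by (simp_all add: algebra_simps)
      then show "d * (m * a + n * c) - c * (m * b + n * d) = m" "a * (m * b + n * d) - b * (m * a + n * c) = n"
      "(d * m - c * n) * a + (a * n - b * m) * c = m" "(d * m - c * n) * b + (a * n - b * m) * d = n" by (simp_all add: det)
    qed
    have "(\<Sum>\<^sub>\<infinity>k\<in>nonzero_pairs. complex_of_real (form_value w k) powr (- s)) = (\<Sum>\<^sub>\<infinity>k\<in>nonzero_pairs. of_real (form_value z k) powr (- s))"
    proof (rule infsum_reindex_bij_witness[where i = ?i and j = ?j])
      fix k assume k: "k \<in> nonzero_pairs"
      obtain m n where mn: "k = (m, n)" by (cases k)
      show "?i (?j k) = k" "?j (?i k) = k" using inv by (simp_all add: mn)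
      show "?j k \<in> nonzero_pairs" using k inv(1,2)[of m n] by (auto simp: mn nonzero_pairs_def)
      show "?i k \<in> nonzero_pairs" using k inv(3,4)[of m n] by (auto simp: mn nonzero_pairs_def)
      show "complex_of_real (form_value z (?j k)) powr (- s) = of_real (form_value w k) powr (- s)"
        by (simp add: mn fw)
    qed
    then show ?thesis by (simp add: E0_eq_form_value[OF Imw] E0_eq_form_value[OF Imz])
  qed
  have "EE0 w = EE0 z"
  proof (rule entire_eqI)
    show "EE0 w holomorphic_on UNIV" "EE0 z holomorphic_on UNIV"
      using completed_eisenstein_entire w z by (simp_all add: EE0_eq)
    show "EE0 w s = EE0 z s" if "Re s > 1" for s
      using completed_eisenstein_eq[OF Imw that] completed_eisenstein_eq[OF Imz that] w z E0
      by (simp add: EE0_eq)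
  qed
  then show ?thesis by (simp add: w_def)
qed

lemma modular_of_weight_F: "modular_of_weight 0 (F n)"
  unfolding modular_of_weight_def F_def by (simp add: EE0_moebius)

text \<open>For |Re z| \<le> 1 \<le> Im z the form is at least N / (3 Im z), so the exponential rate
  in T is 2 c with c = \<pi> N / (6 Im z). Half of it absorbs T^3 through u^3 \<le> 27 exp u at u =
  c T, the other half integrates to 1 / c. The total 27 / c^4 is summable over the lattice and
  polynomial in Im z.\<close>

lemma norm_mellin_le:
  assumes z: "Im z \<ge> 1" "\<bar>Re z\<bar> \<le> 1" and s: "norm s \<le> 1" and k: "k \<in> nonzero_pairs"
  shows "norm (mellin k (of_real (Re z), of_real (Im z), s)) \<le> 27 * (6 / pi)^4 * Im z ^ 4 * square_norm k powr (- 4)"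
proof -
  define P where "P = (complex_of_real (Re z), complex_of_real (Im z), s)"
  define N y where "N = square_norm k" and "y = Im z"
  define w where "w = N / (3 * y)"
  define c where "c = pi * w / 2"
  have y: "y \<ge> 1" using z by (simp add: y_def)
  have N: "N \<ge> 1" unfolding N_def by (rule square_norm_ge_1[OF k])
  have w: "w > 0" using N y by (simp add: w_def)
  have c: "c > 0" using w by (simp add: c_def)
  have "(Re z)^2 \<le> 1" using z(2) by (simp add: abs_square_le_1)
  moreover have "1 \<le> y^2" using y by (simp add: power2_eq_square mult_ge1_I)
  ultimately have "(Re z)^2 + y^2 + 1 \<le> 3 * y^2" by simp
  then have "y / (3 * y^2) \<le> y / ((Re z)^2 + y^2 + 1)"
    using y by (intro divide_left_mono) (auto intro!: mult_pos_pos add_nonneg_pos)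
  moreover have "y / (3 * y^2) = 1 / (3 * y)" using y by (simp add: power2_eq_square)
  ultimately have "1 / (3 * y) * N \<le> y / ((Re z)^2 + y^2 + 1) * N" using N by (intro mult_right_mono) auto
  also have "\<dots> \<le> form_value z k" using form_value_ge[of z k] y by (simp add: y_def N_def square_norm_def)
  finally have q: "Re (form3 k P) \<ge> w" using y real_point_form(2)[of z k s] by (simp add: P_def w_def y_def)
  have cube: "u^3 \<le> 27 * exp u" if "u > 0" for u :: real
  proof -
    have "u / 3 \<le> exp (u / 3)" using exp_ge_add_one_self[of "u / 3"] by linarith
    then have "(u / 3)^3 \<le> exp (u / 3)^3" using that by (intro power_mono) auto
    also have "\<dots> = exp u" by (simp flip: exp_of_nat_mult)
    finally show ?thesis by (simp add: power_divide)
  qed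
  have ker: "norm (mellin_kernel k t P) \<le> 27 / c^3 * (indicator {0<..} t * exp (- c * t))" for t
  proof (cases "t > 0")
    case True
    define T where "T = max t (1 / t)"
    have T: "T > 0" "T \<ge> t" using True by (auto simp: T_def)
    have "norm (mellin_kernel k t P) \<le> exp (- pi * w * T) * T powr (1 + 2)"
      unfolding T_def by (rule norm_mellin_kernel_le[OF True _ q]) (use s in \<open>simp add: P_def\<close>)
    also have "T powr (1 + 2) = T^3" using T powr_realpow[of T 3] by simp
    also have "exp (- pi * w * T) * T^3 = exp (- pi * w * T) * (c * T)^3 / c^3"
      using c by (simp add: power_mult_distrib)
    also have "\<dots> \<le> exp (- pi * w * T) * (27 * exp (c * T)) / c^3"
      using cube[of "c * T"] c T by (intro divide_right_mono mult_left_mono) auto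
    also have "\<dots> = 27 / c^3 * exp (- c * T)"
      by (simp add: c_def flip: exp_add)
    also have "\<dots> \<le> 27 / c^3 * exp (- c * t)"
      using c T by (intro mult_left_mono) auto
    finally show ?thesis using True by simp
  qed (simp add: mellin_kernel_def)
  have "has_bochner_integral lborel (\<lambda>t. indicator {0<..} t *\<^sub>R (of_real t powr ((1 :: complex) - 1) * of_real (exp (- c * t)))) (Gamma 1 * of_real c powr (- 1))"
    by (rule gamma_integral_scaled[OF c]) simp
  moreover have "indicator {0<..} t *\<^sub>R (of_real t powr ((1 :: complex) - 1) * of_real (exp (- c * t))) = of_real (indicator {0<..} t * exp (- c * t))" for t
    by (cases "t > 0") simp_all
  moreover have "Gamma 1 * complex_of_real c powr (- 1) = of_real (1 / c)"
    using c by (simp add: powr_minus divide_inverse)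
  ultimately have "has_bochner_integral lborel (\<lambda>t. complex_of_real (indicator {0<..} t * exp (- c * t))) (of_real (1 / c))"
    by (simp only:)
  then have "complex_of_real (\<integral>t. indicator {0<..} t * exp (- c * t) \<partial>lborel) = of_real (1 / c)"
    using has_bochner_integral_integral_eq integral_complex_of_real by metis
  then have expint: "(\<integral>t. indicator {0<..} t * exp (- c * t) \<partial>lborel) = 1 / c" by (simp only: of_real_eq_iff)
  have "norm (mellin k P) \<le> (\<integral>t. norm (mellin_kernel k t P) \<partial>lborel)"
    unfolding mellin_def by (rule integral_norm_bound)
  also have "\<dots> \<le> (\<integral>t. 27 / c^3 * (indicator {0<..} t * exp (- c * t)) \<partial>lborel)"
    by (rule integral_mono'[OF integrable_mult_right[OF integrable_exp_decay[OF c]] ker]) (use c in \<open>intro mult_nonneg_nonneg; simp\<close>)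
  also have "\<dots> = 27 / c^3 * (1 / c)" by (simp only: integral_mult_right_zero expint)
  also have "\<dots> = 27 * (6 / pi)^4 * y ^ 4 * N powr (- 4)"
  proof -
    have "N powr (- 4) = 1 / N^4" using N by (simp add: powr_minus powr_realpow[of N 4, simplified] divide_inverse)
    then show ?thesis using N y by (simp add: c_def w_def power_divide power_mult_distrib field_simps eval_nat_numeral)
  qed
  finally show ?thesis by (simp add: P_def N_def y_def)
qed

text \<open>The bound is uniform in |s| \<le> 1, so Cauchy's inequality on the unit circle hands it
  to every Taylor coefficient. An integer translation brings Re z into the range where it was
  proved.\<close>

lemma moderate_growth_F: "moderate_growth (F n)"
proof -
  define K where "K = (\<Sum>\<^sub>\<infinity>k\<in>nonzero_pairs. 27 * (6 / pi)^4 * square_norm k powr (- 4))"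
  have sumK: "(\<lambda>k. 27 * (6 / pi)^4 * square_norm k powr (- 4)) summable_on nonzero_pairs"
    by (intro summable_on_cmult_right summable_square_norm_powr) simp
  have K: "K \<ge> 0" unfolding K_def by (rule infsum_nonneg) simp
  have bound: "norm (completed_eisenstein (of_real (Re z), of_real (Im z), s)) \<le> (1 / 2 + K) * Im z ^ 4"
    if z: "Im z \<ge> 1" "\<bar>Re z\<bar> \<le> 1" and s: "norm s \<le> 1" for z s
  proof -
    let ?P = "(complex_of_real (Re z), complex_of_real (Im z), s)"
    have P: "?P \<in> form_domain" using z real_point_form(1)[of z] by simp
    have "((\<lambda>k. mellin k ?P) has_sum mellin_sum ?P) nonzero_pairs"
      unfolding mellin_sum_eq[OF P] by (rule has_sum_infsum[OF abs_summable_summable[OF summable_mellin(1)[OF P]]])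
    moreover have "((\<lambda>k. Im z ^ 4 * (27 * (6 / pi)^4 * square_norm k powr (- 4))) has_sum Im z ^ 4 * K) nonzero_pairs"
      unfolding K_def by (intro has_sum_cmult_right has_sum_infsum sumK)
    ultimately have M: "norm (mellin_sum ?P) \<le> Im z ^ 4 * K"
    proof (rule norm_infsum_le)
      show "norm (mellin k ?P) \<le> Im z ^ 4 * (27 * (6 / pi)^4 * square_norm k powr (- 4))" if "k \<in> nonzero_pairs" for k
        using norm_mellin_le[OF z s that] by (simp add: mult_ac)
    qed
    have ss: "norm (1 / 2 * (s * (s + (-1)))) \<le> 1"
    proof -
      have "norm (s + (-1)) \<le> norm s + norm (-1 :: complex)" by (rule norm_triangle_ineq)
      also have "\<dots> \<le> 2" using s by simp
      finally have "norm s * norm (s + (-1)) \<le> 1 * 2" using s by (intro mult_mono) auto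
      then show ?thesis by (simp add: norm_mult)
    qed
    have y4: "1 \<le> Im z ^ 4" using z by (intro one_le_power)
    have "norm (completed_eisenstein ?P) \<le> norm (1 / 2 :: complex) + norm (1 / 2 * (s * (s + (-1))) * mellin_sum ?P)"
      unfolding completed_eisenstein_def by (simp only: fst_conv snd_conv norm_triangle_ineq)
    also have "\<dots> \<le> 1 / 2 + 1 * (Im z ^ 4 * K)"
      unfolding norm_mult[of "1 / 2 * (s * (s + (-1)))"] using ss M
      by (intro add_mono mult_mono) (auto simp del: norm_mult)
    also have "\<dots> \<le> (1 / 2 + K) * Im z ^ 4" using y4 by (simp add: algebra_simps)
    finally show ?thesis .
  qed
  have Fb: "norm (F n z) \<le> (1 / 2 + K) * Im z ^ 4" if z: "Im z \<ge> 1" "\<bar>Re z\<bar> \<le> 1" for z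
  proof -
    have zH: "z \<in> upper_half" using z by (simp add: upper_half_def)
    let ?f = "\<lambda>s. completed_eisenstein (of_real (Re z), of_real (Im z), s)"
    have h: "?f holomorphic_on UNIV" by (rule completed_eisenstein_entire[OF zH])
    have "norm ((deriv ^^ n) ?f 0) \<le> fact n * ((1 / 2 + K) * Im z ^ 4) / 1 ^ n"
    proof (rule Cauchy_inequality)
      show "?f holomorphic_on ball 0 1" "continuous_on (cball 0 1) ?f"
        using holomorphic_on_subset[OF h] holomorphic_on_imp_continuous_on[OF h] continuous_on_subset by blast+
      show "norm (?f s) \<le> (1 / 2 + K) * Im z ^ 4" if "norm (0 - s) = 1" for s
        by (rule bound[OF z]) (use that in simp)
    qed simp
    then show ?thesis using zH by (simp add: F_def EE0_eq norm_divide divide_le_eq mult.commute)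
  qed
  have "norm (F n z) \<le> (1 / 2 + K) * Im z powr 4" if z: "Im z \<ge> 1" for z
  proof -
    define w where "w = z + of_int (- \<lfloor>Re z\<rfloor>)"
    have "z \<in> upper_half" using z by (simp add: upper_half_def)
    from EE0_moebius[OF this, of 1 1 "- \<lfloor>Re z\<rfloor>" 0] have "EE0 w = EE0 z" by (simp add: w_def)
    then have "F n w = F n z" by (simp add: F_def)
    moreover have "norm (F n w) \<le> (1 / 2 + K) * Im w ^ 4"
      by (rule Fb) (use z in \<open>simp_all add: w_def abs_le_iff\<close>, linarith+)
    moreover have "Im z powr 4 = Im z ^ 4" using z powr_realpow[of "Im z" 4] by simp
    ultimately show ?thesis by (simp add: w_def)
  qed
  then show ?thesis unfolding moderate_growth_def by blast
qed

lemma F_in_weight_form_space: "F n \<in> weight_form_space 0"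
  by (simp add: weight_form_space_def on_H_F smooth_on_H_F modular_of_weight_F moderate_growth_F)

section \<open>Dimension and basis\<close>

lemma vector_space_fscale: "vector_space fscale"
  by unfold_locales (simp_all add: fscale_def plus_fun_def fun_eq_iff algebra_simps)

lemma modular_of_weight_0_generators:
  assumes "modular_of_weight 0 f" "z \<in> upper_half"
  shows "f (z + 1) = f z" "f (- 1 / z) = f z"
proof -
  have inv: "f ((of_int a * z + of_int b) / (of_int c * z + of_int d)) = f z"
    if "a * d - b * c = 1" for a b c d :: int
    using assms that unfolding modular_of_weight_def by fastforce
  \<comment> \<open>The instances list the matrix entries in the order a, d, b, c, in which they
    occur in the determinant.\<close>
  show "f (z + 1) = f z" using inv[of 1 1 1 0] by simp
  show "f (- 1 / z) = f z" using inv[of 0 0 "-1" 1] by simp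
qed

lemma moderate_growth_lincomb:
  assumes "moderate_growth f" "moderate_growth g"
  shows "moderate_growth (\<lambda>z. a * f z + b * g z)"
proof -
  obtain \<alpha> C Y where f: "\<And>z. Im z \<ge> Y \<Longrightarrow> cmod (f z) \<le> C * Im z powr \<alpha>"
    using assms(1) unfolding moderate_growth_def by auto
  obtain \<beta> D X where g: "\<And>z. Im z \<ge> X \<Longrightarrow> cmod (g z) \<le> D * Im z powr \<beta>"
    using assms(2) unfolding moderate_growth_def by auto
  define \<gamma> where "\<gamma> = max \<alpha> \<beta>"
  have mono: "B * y powr e \<le> \<bar>B\<bar> * y powr \<gamma>" if "y \<ge> 1" "e \<le> \<gamma>" for B y e :: real
    using that by (intro mult_mono powr_mono) auto
  have "cmod (a * f z + b * g z) \<le> (cmod a * \<bar>C\<bar> + cmod b * \<bar>D\<bar>) * Im z powr \<gamma>"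
    if z: "Im z \<ge> max 1 (max Y X)" for z
  proof -
    have "cmod (f z) \<le> \<bar>C\<bar> * Im z powr \<gamma>"
      using f[of z] mono[of "Im z" \<alpha> C] z by (simp add: \<gamma>_def)
    moreover have "cmod (g z) \<le> \<bar>D\<bar> * Im z powr \<gamma>"
      using g[of z] mono[of "Im z" \<beta> D] z by (simp add: \<gamma>_def)
    ultimately have "cmod a * cmod (f z) + cmod b * cmod (g z)
        \<le> cmod a * (\<bar>C\<bar> * Im z powr \<gamma>) + cmod b * (\<bar>D\<bar> * Im z powr \<gamma>)"
      by (intro add_mono mult_left_mono) auto
    then show ?thesis
      using norm_triangle_ineq[of "a * f z" "b * g z"] by (simp add: norm_mult algebra_simps)
  qed
  then show ?thesis unfolding moderate_growth_def by blast
qed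

lemma weight_form_space_lincomb:
  assumes "f \<in> weight_form_space 0" "g \<in> weight_form_space 0"
  shows "(\<lambda>z. a * f z + b * g z) \<in> weight_form_space 0"
  using assms moderate_growth_lincomb[of f g a b] smooth_on_H_lincomb[of f g a b]
  by (auto simp: weight_form_space_def on_H_def modular_of_weight_def)

lemma V_int_lincomb:
  assumes "f \<in> V_int 0 m" "g \<in> V_int 0 m"
  shows "(\<lambda>z. a * f z + b * g z) \<in> V_int 0 m"
proof -
  have "smooth_on_H f" "smooth_on_H g" using assms by (simp_all add: V_int_def weight_form_space_def)
  from laplacian_pow_lincomb[OF this] show ?thesis
    using assms weight_form_space_lincomb[of f g a b] by (simp add: V_int_def)
qed

text \<open>The surplus j lets the strong induction deliver both facts at once: the constant at j =
  0 and vanishing for j > 0.\<close>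

lemma laplacian_pow_F:
  assumes "z \<in> upper_half"
  shows "(hyp_laplacian 0 ^^ (n + j)) (F n) z = (if j = 0 then (- 1) ^ n / 2 else 0)"
  using assms
proof (induction n arbitrary: j z rule: less_induct)
  case (less n)
  show ?case
  proof (cases n)
    case 0
    have "(hyp_laplacian 0 ^^ i) (F 0) w = (if i = 0 then 1 / 2 else 0)" if "w \<in> upper_half" for i w
    proof (cases i)
      case (Suc l)
      have "hyp_laplacian 0 (F 0) v = 0 * F 0 v + 0 * F 0 v" if "v \<in> upper_half" for v
        using laplacian_F[OF that, of 0] by simp
      then have "(hyp_laplacian 0 ^^ l) (hyp_laplacian 0 (F 0)) w = (hyp_laplacian 0 ^^ l) (\<lambda>v. 0 * F 0 v + 0 * F 0 v) w"
        by (rule laplacian_pow_cong[OF _ that])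
      then show ?thesis
        using laplacian_pow_lincomb[OF smooth_on_H_F smooth_on_H_F that, of l 0 0 0 0] Suc
        by (simp add: funpow_swap1)
    qed (simp add: F_0 that)
    from this[OF less.prems] show ?thesis using 0 by simp
  next
    case (Suc m)
    define a :: complex where "a = (if n \<ge> 2 then 1 else 0)"
    have D: "hyp_laplacian 0 (F n) w = a * F (n - 2) w + (- 1) * F m w" if "w \<in> upper_half" for w
      using laplacian_F[OF that, of n] Suc by (simp add: a_def)
    have "(hyp_laplacian 0 ^^ (n + j)) (F n) z = (hyp_laplacian 0 ^^ (m + j)) (hyp_laplacian 0 (F n)) z"
      using Suc by (simp add: funpow_swap1)
    also have "\<dots> = (hyp_laplacian 0 ^^ (m + j)) (\<lambda>w. a * F (n - 2) w + (- 1) * F m w) z"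
      by (rule laplacian_pow_cong[OF D less.prems])
    also have "\<dots> = a * (hyp_laplacian 0 ^^ (m + j)) (F (n - 2)) z + (- 1) * (hyp_laplacian 0 ^^ (m + j)) (F m) z"
      by (rule laplacian_pow_lincomb[OF smooth_on_H_F smooth_on_H_F less.prems])
    \<comment> \<open>\<open>F (n - 2)\<close> receives at least one Laplacian too many and drops
      out; only \<open>F m\<close> survives, with its sign.\<close>
    also have "a * (hyp_laplacian 0 ^^ (m + j)) (F (n - 2)) z = 0"
    proof (cases "n \<ge> 2")
      case True
      then have "m + j = (n - 2) + Suc j" using Suc by simp
      then show ?thesis using less.IH[of "n - 2" z "Suc j"] True less.prems by simp
    qed (simp add: a_def)
    also have "(hyp_laplacian 0 ^^ (m + j)) (F m) z = (if j = 0 then (- 1) ^ m / 2 else 0)"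
      by (rule less.IH) (use Suc less.prems in auto)
    finally show ?thesis using Suc by simp
  qed
qed

lemma F_in_V_int: "n < m \<Longrightarrow> F n \<in> V_int 0 m"
  using laplacian_pow_F[of _ n "m - n"] by (simp add: V_int_def F_in_weight_form_space)

lemma F_notin_V_int: "F m \<notin> V_int 0 m"
proof -
  have i: "\<i> \<in> upper_half" by (simp add: upper_half_def)
  have "(hyp_laplacian 0 ^^ m) (F m) \<i> = (- 1) ^ m / 2" using laplacian_pow_F[OF i, of m 0] by simp
  then have "(hyp_laplacian 0 ^^ m) (F m) \<i> \<noteq> 0" by (simp only:) simp
  then show ?thesis using i by (auto simp: V_int_def)
qed

lemma V_int_Suc_constant:
  assumes "f \<in> V_int 0 (Suc m)"
  obtains c where "\<And>z. z \<in> upper_half \<Longrightarrow> (hyp_laplacian 0 ^^ m) f z = c"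
proof (rule laplacian_pow_constant[of f m])
  have f: "smooth_on_H f" "modular_of_weight 0 f" "moderate_growth f"
    "\<And>z. z \<in> upper_half \<Longrightarrow> (hyp_laplacian 0 ^^ Suc m) f z = 0"
    using assms by (simp_all add: V_int_def weight_form_space_def)
  show "smooth_on_H f" "moderate_growth f" by fact+
  show "f (z + 1) = f z" "f (- 1 / z) = f z" if "z \<in> upper_half" for z
    using modular_of_weight_0_generators[OF f(2) that] by simp_all
  show "(hyp_laplacian 0 ^^ Suc m) f z = 0" if "z \<in> upper_half" for z
    using f(4)[OF that] .
qed (rule that)

text \<open>Constants are holomorphic, and the Laplacian annihilates holomorphic functions. In
  effect a holomorphic \<open>\<Delta>^m f\<close> must be constant.\<close>

lemma V_int_eq_V_half: "V_int 0 (Suc m) = V_half 0 m"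
proof (intro equalityI subsetI)
  fix f assume f: "f \<in> V_int 0 (Suc m)"
  obtain c where c: "\<And>z. z \<in> upper_half \<Longrightarrow> (hyp_laplacian 0 ^^ m) f z = c"
    by (rule V_int_Suc_constant[OF f]) (rule that)
  have "(hyp_laplacian 0 ^^ m) f holomorphic_on upper_half"
    by (rule holomorphic_transform[OF holomorphic_on_const[of c]]) (simp add: c)
  then show "f \<in> V_half 0 m" using f by (simp add: V_int_def V_half_def)
next
  fix f assume "f \<in> V_half 0 m"
  then show "f \<in> V_int 0 (Suc m)"
    using laplacian_holomorphic[of "(hyp_laplacian 0 ^^ m) f"] by (simp add: V_int_def V_half_def)
qed

interpretation fun_space: vector_space fscale
  by (rule vector_space_fscale)

lemma subspace_V_int: "fun_space.subspace (V_int 0 m)"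
proof -
  have "f + g \<in> V_int 0 m" "fscale a f \<in> V_int 0 m" if "f \<in> V_int 0 m" "g \<in> V_int 0 m" for f g a
    using V_int_lincomb[OF that, of 1 1] V_int_lincomb[OF that, of a 0]
    by (simp_all add: plus_fun_def fscale_def)
  \<comment> \<open>The zero function is the combination 0 F + 0 F, which reuses the closure
    lemmas.\<close>
  moreover have "0 \<in> V_int 0 m"
    using laplacian_pow_lincomb[OF smooth_on_H_F smooth_on_H_F, of _ m 0 0 0 0] weight_form_space_lincomb[OF F_in_weight_form_space F_in_weight_form_space, of 0 0 0 0]
    by (simp add: V_int_def zero_fun_def)
  ultimately show ?thesis unfolding fun_space.subspace_def by blast
qed

text \<open>\<open>\<Delta>^m f\<close> is constant and that of \<open>F m\<close> is a nonzero
  constant, so subtracting a multiple of \<open>F m\<close> lands in the previous space.\<close>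

lemma span_F: "fun_space.span (F ` {..<m}) = V_int 0 m"
proof (induction m)
  case 0
  have "f z = 0" if "f \<in> V_int 0 0" for f z
    using that by (cases "z \<in> upper_half") (auto simp: V_int_def weight_form_space_def on_H_def)
  then have "V_int 0 0 \<subseteq> {0}" by (auto simp: fun_eq_iff)
  then show ?case using fun_space.subspace_0[OF subspace_V_int[of 0]] by auto
next
  case (Suc m)
  show ?case
  proof
    show "fun_space.span (F ` {..<Suc m}) \<subseteq> V_int 0 (Suc m)"
      by (rule fun_space.span_minimal[OF _ subspace_V_int]) (auto intro: F_in_V_int)
    show "V_int 0 (Suc m) \<subseteq> fun_space.span (F ` {..<Suc m})"
    proof
      fix f assume f: "f \<in> V_int 0 (Suc m)"
      obtain c where c: "\<And>z. z \<in> upper_half \<Longrightarrow> (hyp_laplacian 0 ^^ m) f z = c"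
        by (rule V_int_Suc_constant[OF f]) (rule that)
      \<comment> \<open>The solution of c = b (-1)^m / 2, as (-1)^m is its own inverse.\<close>
      define b where "b = 2 * c * (- 1) ^ m"
      define g where "g = (\<lambda>z. 1 * f z + (- b) * F m z)"
      have sm: "smooth_on_H f" using f by (simp add: V_int_def weight_form_space_def)
      have "(hyp_laplacian 0 ^^ m) g z = 0" if z: "z \<in> upper_half" for z
      proof -
        have "(hyp_laplacian 0 ^^ m) (F m) z = (- 1) ^ m / 2" using laplacian_pow_F[OF z, of m 0] by simp
        then show ?thesis
          unfolding g_def laplacian_pow_lincomb[OF sm smooth_on_H_F z] c[OF z] by (simp only: b_def) simp
      qed
      moreover have "g \<in> V_int 0 (Suc m)"
        unfolding g_def by (rule V_int_lincomb[OF f F_in_V_int]) simp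
      ultimately have "g \<in> fun_space.span (F ` {..<m})" by (simp add: Suc V_int_def)
      then have "g \<in> fun_space.span (F ` {..<Suc m})"
        using fun_space.span_mono[of "F ` {..<m}" "F ` {..<Suc m}"] by (auto simp: lessThan_Suc)
      moreover have "fscale b (F m) \<in> fun_space.span (F ` {..<Suc m})"
        by (intro fun_space.span_scale fun_space.span_base) simp
      ultimately have "g + fscale b (F m) \<in> fun_space.span (F ` {..<Suc m})"
        by (rule fun_space.span_add)
      then show "f \<in> fun_space.span (F ` {..<Suc m})"
        by (simp add: g_def fscale_def plus_fun_def)
    qed
  qed
qed

text \<open>\<open>F m\<close> lies outside \<open>V_int 0 m\<close>, which by \<open>span_F\<close>
  is the span of its predecessors. This gives injectivity and independence together.\<close>

lemma independent_F: "inj_on F {..<m} \<and> fun_space.independent (F ` {..<m})"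
proof (induction m)
  case (Suc m)
  have "F m \<notin> fun_space.span (F ` {..<m})" unfolding span_F by (rule F_notin_V_int)
  then show ?case
    using Suc fun_space.span_base[of "F m" "F ` {..<m}"]
    by (auto simp: lessThan_Suc fun_space.independent_insert)
qed (simp add: fun_space.independent_empty)

theorem theorem1p1:
  fixes m :: nat
  assumes "m \<ge> 1"
  shows "V_int 0 m = V_half 0 (m - 1)
         \<and> vector_space.dim fscale (V_int 0 m) = m
         \<and> inj_on F {..<m}
         \<and> \<not> module.dependent fscale (F ` {..<m})
         \<and> module.span fscale (F ` {..<m}) = V_int 0 m"
proof -
  have "V_int 0 m = V_half 0 (m - 1)" using V_int_eq_V_half[of "m - 1"] assms by simp
  \<comment> \<open>By \<open>span_F\<close> this is the dimension of the span of an independent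
    set, which has m elements by injectivity.\<close>
  moreover have "fun_space.dim (V_int 0 m) = m"
    using independent_F[of m] fun_space.dim_eq_card_independent[of "F ` {..<m}"] fun_space.dim_span[of "F ` {..<m}"]
    by (simp add: span_F card_image)
  ultimately show ?thesis using independent_F[of m] span_F[of m] by blast
qed

end
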